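(* Let $\mathbf{D}\subset\mathbb{R}^n$, $n\in\mathbb{N}$, be a compact set with $\boldsymbol 0\in\mathbf{D}$. Let $\{\xi_u(\boldsymbol t),\boldsymbol t\in\mathbf{D}\}$, $u>0$, be a family of centered Gaussian random fields with a.s. continuous sample paths and variance functions $\sigma_{\xi_u}^2(\cdot)$, satisfying conditions C1, C2, C3 (stated in the context) with some function $d(\cdot)$ and some Gaussian random field $\eta$. Let $F:C(\mathbf{D})\to\mathbb{R}$ be a continuous functional satisfying F1 and F2 (stated in the context). Then, for any positive measurable function $g(\cdot)$ with $\lim_{u\to\infty}g(u)/u=a\in(0,\infty)$, $$\mathbb{P}\{F(\xi_u)>g(u)\}=\mathcal{H}^F_{a\eta,a^2d}(\mathbf{D})\,\Psi(g(u))(1+o(1)),\qquad u\to\infty,$$ provided that $\mathbb{P}\{F(\xi_u)>g(u)\}>0$ for all large $u$.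
   Context: **Conditions on $\xi_u$.** C1: $\sigma_{\xi_u}(\boldsymbol 0)=1$ for all large $u$, and there exists a bounded measurable function $d(\cdot)$ on $\mathbf{D}$ such that $$\lim_{u\to\infty}\sup_{\boldsymbol t\in\mathbf{D}}\big|u^2(1-\sigma_{\xi_u}(\boldsymbol t))-d(\boldsymbol t)\big|=0.$$ C2: There exists a centered Gaussian random field $\{\eta(\boldsymbol t),\boldsymbol t\in\mathbb{R}^n\}$ with a.s. continuous sample paths, $\eta(\boldsymbol 0)=0$ and variance function $\sigma_\eta^2(\cdot)$ such that $$\lim_{u\to\infty}u^2\,\mathrm{Var}(\xi_u(\boldsymbol t)-\xi_u(\boldsymbol s))=2\,\mathrm{Var}(\eta(\boldsymbol t)-\eta(\boldsymbol s))\quad\text{for all }\boldsymbol t,\boldsymbol s\in\mathbf{D}.$$ C3: There exist constants $G,\nu>0$ and $u_0>0$ such that, for any $u>u_0$, $$u^2\,\mathrm{Var}(\xi_u(\boldsymbol t)-\xi_u(\boldsymbol s))\le G\,\|\boldsymbol t-\boldsymbol s\|^\nu$$ holds uniformly in $\boldsymbol t,\boldsymbol s\in\mathbf{D}$, where $\|\cdot\|$ is the Euclidean norm. **Conditions on $F$.** $C(\mathbf{D})$ is the space of real continuous functions on $\mathbf{D}$ (with the supremum norm). F1: $|F(f)|\le\sup_{\boldsymbol t\in\mathbf{D}}|f(\boldsymbol t)|$ for any $f\in C(\mathbf{D})$. F2: $F(af+b)=aF(f)+b$ for any $f\in C(\mathbf{D})$, $a>0$, $b\in\mathbb{R}$.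 **Constant.** For a centered Gaussian field $\eta$ with a.s. continuous paths and variance function $\sigma_\eta^2$, and a function $d$ on $\mathbf{D}$ with $d(\boldsymbol 0)=0$, $$\mathcal{H}^F_{\eta,d}(\mathbf{D})=\mathbb{E}\Big\{\exp\Big(F\big(\sqrt2\,\eta(\boldsymbol t)-\sigma_\eta^2(\boldsymbol t)-d(\boldsymbol t)\big)\Big)\Big\},$$ where $F$ acts on the function $\boldsymbol t\mapsto\sqrt2\,\eta(\boldsymbol t)-\sigma_\eta^2(\boldsymbol t)-d(\boldsymbol t)$, $\boldsymbol t\in\mathbf{D}$. Thus $\mathcal{H}^F_{a\eta,a^2d}(\mathbf{D})=\mathbb{E}\{\exp(F(\sqrt2a\,\eta(\boldsymbol t)-a^2\sigma_\eta^2(\boldsymbol t)-a^2d(\boldsymbol t)))\}$. $\Psi$ is the tail distribution function of an $N(0,1)$ random variable, and $f(u)=h(u)(1+o(1))$ means $f(u)/h(u)\to1$. *)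

theory Defs
  imports "HOL-Probability.Probability"
begin

definition var :: "'w measure \<Rightarrow> ('w \<Rightarrow> real) \<Rightarrow> real" where
  "var M X = integral\<^sup>L M (\<lambda>w. (X w - integral\<^sup>L M X)\<^sup>2)"

(* The degenerate law N(0,0) counts as a centered normal law. *)
definition centered_normal :: "'w measure \<Rightarrow> ('w \<Rightarrow> real) \<Rightarrow> bool" where
  "centered_normal M X \<longleftrightarrow>
     X \<in> borel_measurable M \<and>
     ((AE w in M. X w = 0) \<or>
      (\<exists>\<sigma>>0. distributed M lborel X (normal_density 0 \<sigma>)))"

(* A random field is a map X of the parameter t and the sample point w; only the values
   at parameters t in T matter.  Finite-dimensional distributions are multivariate normal
   in the sense that all linear combinations are univariate normal. *)
definition centered_gaussian_field ::
  "'w measure \<Rightarrow> 't set \<Rightarrow> ('t \<Rightarrow> 'w \<Rightarrow> real) \<Rightarrow> bool" where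
  "centered_gaussian_field M T X \<longleftrightarrow>
     (\<forall>S c. finite S \<and> S \<subseteq> T \<longrightarrow> centered_normal M (\<lambda>w. \<Sum>t\<in>S. c t * X t w))"

definition as_continuous_paths ::
  "'w measure \<Rightarrow> 't::topological_space set \<Rightarrow> ('t \<Rightarrow> 'w \<Rightarrow> real) \<Rightarrow> bool" where
  "as_continuous_paths M T X \<longleftrightarrow> (AE w in M. continuous_on T (\<lambda>t. X t w))"

(* The supremum is taken in the extended reals, so that it is meaningful (infinite)
   also when the function under it is unbounded. *)
definition cond_C1 ::
  "(real \<Rightarrow> 'w measure) \<Rightarrow> (real^'n) set \<Rightarrow> (real \<Rightarrow> real^'n \<Rightarrow> 'w \<Rightarrow> real) \<Rightarrow>
   (real^'n \<Rightarrow> real) \<Rightarrow> bool" where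
  "cond_C1 M D \<xi> d \<longleftrightarrow>
     (\<forall>\<^sub>F u in at_top. sqrt (var (M u) (\<xi> u 0)) = 1) \<and>
     bounded (d ` D) \<and> d \<in> borel_measurable (restrict_space borel D) \<and>
     ((\<lambda>u. SUP t\<in>D. ereal \<bar>u\<^sup>2 * (1 - sqrt (var (M u) (\<xi> u t))) - d t\<bar>) \<longlongrightarrow> 0) at_top"

definition cond_C2 ::
  "(real \<Rightarrow> 'w measure) \<Rightarrow> (real^'n) set \<Rightarrow> (real \<Rightarrow> real^'n \<Rightarrow> 'w \<Rightarrow> real) \<Rightarrow>
   'v measure \<Rightarrow> (real^'n \<Rightarrow> 'v \<Rightarrow> real) \<Rightarrow> bool" where
  "cond_C2 M D \<xi> N \<eta> \<longleftrightarrow>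
     prob_space N \<and> centered_gaussian_field N UNIV \<eta> \<and> as_continuous_paths N UNIV \<eta> \<and>
     (AE w in N. \<eta> 0 w = 0) \<and>
     (\<forall>t\<in>D. \<forall>s\<in>D.
        ((\<lambda>u. u\<^sup>2 * var (M u) (\<lambda>w. \<xi> u t w - \<xi> u s w))
           \<longlongrightarrow> 2 * var N (\<lambda>w. \<eta> t w - \<eta> s w)) at_top)"

definition cond_C3 ::
  "(real \<Rightarrow> 'w measure) \<Rightarrow> (real^'n) set \<Rightarrow> (real \<Rightarrow> real^'n \<Rightarrow> 'w \<Rightarrow> real) \<Rightarrow> bool" where
  "cond_C3 M D \<xi> \<longleftrightarrow>
     (\<exists>G>0. \<exists>\<nu>>0. \<exists>u0>0. \<forall>u>u0. \<forall>t\<in>D. \<forall>s\<in>D.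
        u\<^sup>2 * var (M u) (\<lambda>w. \<xi> u t w - \<xi> u s w) \<le> G * norm (t - s) powr \<nu>)"

(* The library space cfunspace consists of the bounded continuous functions on D
   (extended by undefined outside D) with the supremum distance; D is compact in all uses,
   so boundedness is no restriction. *)
definition CD :: "(real^'n) set \<Rightarrow> (real^'n \<Rightarrow> real) metric" where
  "CD D = cfunspace (top_of_set D) euclidean_metric"

definition continuous_functional ::
  "(real^'n) set \<Rightarrow> ((real^'n \<Rightarrow> real) \<Rightarrow> real) \<Rightarrow> bool" where
  "continuous_functional D F \<longleftrightarrow> continuous_map (mtopology_of (CD D)) euclideanreal F"

definition cond_F1 :: "(real^'n) set \<Rightarrow> ((real^'n \<Rightarrow> real) \<Rightarrow> real) \<Rightarrow> bool" where
  "cond_F1 D F \<longleftrightarrow> (\<forall>f \<in> mspace (CD D). \<bar>F f\<bar> \<le> (SUP t\<in>D. \<bar>f t\<bar>))"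

definition cond_F2 :: "(real^'n) set \<Rightarrow> ((real^'n \<Rightarrow> real) \<Rightarrow> real) \<Rightarrow> bool" where
  "cond_F2 D F \<longleftrightarrow>
     (\<forall>f \<in> mspace (CD D). \<forall>a>0. \<forall>b. F (\<lambda>t\<in>D. a * f t + b) = a * F f + b)"

(* Paths are continuous only almost surely and the values of F outside C(D) are arbitrary,
   so functionals of the paths are measurable only with respect to the completed measure. *)
definition prob_F_exceeds ::
  "'w measure \<Rightarrow> (real^'n) set \<Rightarrow> ((real^'n \<Rightarrow> real) \<Rightarrow> real) \<Rightarrow>
   (real^'n \<Rightarrow> 'w \<Rightarrow> real) \<Rightarrow> real \<Rightarrow> real" where
  "prob_F_exceeds M D F X x =
     measure (completion M) {w \<in> space M. F (\<lambda>t\<in>D. X t w) > x}"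

definition H_const ::
  "'v measure \<Rightarrow> (real^'n) set \<Rightarrow> ((real^'n \<Rightarrow> real) \<Rightarrow> real) \<Rightarrow>
   (real^'n \<Rightarrow> 'v \<Rightarrow> real) \<Rightarrow> (real^'n \<Rightarrow> real) \<Rightarrow> real" where
  "H_const N D F \<eta> d =
     integral\<^sup>L (completion N)
       (\<lambda>w. exp (F (\<lambda>t\<in>D. sqrt 2 * \<eta> t w - var N (\<eta> t) - d t)))"

definition Psi :: "real \<Rightarrow> real" where
  "Psi x = measure (density lborel std_normal_density) {x<..}"

end

theory Submission
  imports Defs "HOL-Complex_Analysis.Great_Picard"
begin

text \<open>
  Write \<open>\<xi>\<^sub>u = Z R + Y\<close> with \<open>Z = \<xi>\<^sub>u(0)\<close> standard normal, \<open>R\<close> the covariance with \<open>Z\<close>, and \<open>Y\<close> independent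
  of \<open>Z\<close>. Substituting \<open>z = g - y/g\<close> in the law of \<open>Z\<close> and using \<open>F(af + b) = aF(f) + b\<close> gives
  \<open>P(F(\<xi>\<^sub>u) > g) = \<phi>(g)/g \<cdot> \<integral> exp(y - y\<^sup>2/(2g\<^sup>2)) P(F(gY + (g\<^sup>2 - y)(R - 1)) > y) dy\<close>.
  For fixed \<open>y\<close> the field inside \<open>F\<close> converges weakly in \<open>C(D)\<close> to the field in the definition of the
  constant, so the integral tends to \<open>\<integral> exp(y) P(F(limit) > y) dy = E exp(F(limit))\<close>, once it is dominated.
  Tightness and domination both come from chaining, which controls the modulus of continuity of
  \<open>gY\<close> with arbitrarily large exponential rates. Weak convergence is reduced to characteristic
  functions: on equicontinuous sets a continuous functional is a uniform limit of trigonometric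
  polynomials in finitely many values of the path, bounded on the whole space.
\<close>

section \<open>Continuous functionals and trigonometric polynomials\<close>

text \<open>Three obstacles shape the proof. The weight \<open>exp y\<close> demands an exceedance
  probability that decays strictly faster than \<open>exp (- y)\<close>, uniformly in large
  \<open>u\<close>. But the drift \<open>(g\<^sup>2 - y) * (R - 1)\<close> itself grows linearly in
  \<open>y\<close>, with slope of order \<open>1 / g\<^sup>2\<close>. For large \<open>u\<close> it
  uses up at most half of \<open>y\<close>, up to a constant, and the supremum of \<open>gY\<close>
  has to beat the rest; the scale of that supremum is an unknown chaining constant, so the
  exponential rate must be at one's disposal. Next, the increments converge only pointwise. Their
  Hoelder bound, uniform in \<open>u\<close> after scaling, makes the drifts equicontinuous, which
  upgrades this to uniform convergence and also makes the limiting drift continuous, although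
  \<open>d\<close> is only bounded and measurable. Finally, the probability spaces change with
  \<open>u\<close>, and paths are continuous only almost surely. Hence the argument compares laws
  only, works with modifications all of whose paths are continuous, and takes limits along arbitrary
  sequences tending to infinity, since compactness and dominated convergence are sequential.\<close>

definition cont_fun :: "'a::metric_space set \<Rightarrow> (('a \<Rightarrow> real) \<Rightarrow> real) \<Rightarrow> bool" where
  "cont_fun D \<Phi> \<longleftrightarrow> (\<forall>f h. (\<forall>n. continuous_on D (f n)) \<longrightarrow> uniform_limit D f h sequentially
     \<longrightarrow> (\<lambda>n. \<Phi> (f n)) \<longlonglongrightarrow> \<Phi> h)"

lemma cont_funD:
  "cont_fun D \<Phi> \<Longrightarrow> (\<And>n. continuous_on D (f n)) \<Longrightarrow> uniform_limit D f h sequentially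
     \<Longrightarrow> (\<lambda>n. \<Phi> (f n)) \<longlonglongrightarrow> \<Phi> h"
  unfolding cont_fun_def by blast

lemma cont_fun_compose:
  assumes "cont_fun D \<Phi>" "continuous_on UNIV (h :: real \<Rightarrow> real)"
  shows "cont_fun D (\<lambda>f. h (\<Phi> f))"
  unfolding cont_fun_def
proof (intro allI impI)
  fix f :: "nat \<Rightarrow> 'a \<Rightarrow> real" and k
  assume f: "\<forall>n. continuous_on D (f n)" and u: "uniform_limit D f k sequentially"
  have "(\<lambda>n. \<Phi> (f n)) \<longlonglongrightarrow> \<Phi> k" by (rule cont_funD[OF assms(1) _ u]) (use f in blast)
  moreover have "isCont h (\<Phi> k)" using assms(2) by (simp add: continuous_on_eq_continuous_at)
  ultimately show "(\<lambda>n. h (\<Phi> (f n))) \<longlonglongrightarrow> h (\<Phi> k)"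
    by (rule isCont_tendsto_compose[rotated])
qed

lemma restrict_mem_CD:
  fixes D :: "(real^'n) set"
  assumes "compact D" "continuous_on D f"
  shows "restrict f D \<in> mspace (CD D)"
proof -
  have "compact (f ` D)" using assms compact_continuous_image by blast
  then have "bounded (restrict f D ` D)" by (metis compact_imp_bounded image_restrict_eq)
  moreover have "continuous_on D (restrict f D)" using assms(2) by (simp cong: continuous_on_cong_simp)
  ultimately show ?thesis by (auto simp: CD_def)
qed

text \<open>\<open>cont_fun\<close> speaks of functions on the whole type, so that arithmetic on
  paths needs no \<open>restrict\<close>. Applied to constant sequences it makes
  \<open>\<Phi>\<close> depend, for continuous arguments, only on the values on \<open>D\<close>;
  composing \<open>F\<close> with \<open>restrict\<close> has this form.\<close>

lemma continuous_functional_cont_fun: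
  fixes D :: "(real^'n) set"
  assumes "compact D" "continuous_functional D F"
  shows "cont_fun D (\<lambda>f. F (restrict f D))"
  unfolding cont_fun_def
proof (intro allI impI)
  fix f :: "nat \<Rightarrow> real^'n \<Rightarrow> real" and h
  assume f: "\<forall>n. continuous_on D (f n)" and u: "uniform_limit D f h sequentially"
  have h: "continuous_on D h"
    by (rule uniform_limit_theorem[OF _ u]) (use f in auto)
  interpret m: Metric_space "mspace (CD D)" "mdist (CD D)" by simp
  have "limitin (mtopology_of (CD D)) (\<lambda>n. restrict (f n) D) (restrict h D) sequentially"
    unfolding mtopology_of_def m.limitin_metric
  proof (intro conjI allI impI)
    show "restrict h D \<in> mspace (CD D)" by (rule restrict_mem_CD[OF assms(1) h])
    fix e :: real assume "e > 0"
    \<comment> \<open>The supremum distance inherits only a non-strict bound, hence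
      \<open>e/2\<close>.\<close>
    then have "\<forall>\<^sub>F n in sequentially. \<forall>t\<in>D. dist (f n t) (h t) < e/2"
      using u half_gt_zero unfolding uniform_limit_iff by blast
    then show "\<forall>\<^sub>F n in sequentially. restrict (f n) D \<in> mspace (CD D) \<and> mdist (CD D) (restrict (f n) D) (restrict h D) < e"
    proof eventually_elim
      case (elim n)
      have "mdist (CD D) (restrict (f n) D) (restrict h D) \<le> e/2"
        unfolding CD_def
        by (rule mdist_cfunspace_le) (use \<open>e > 0\<close> elim in \<open>auto intro: less_imp_le\<close>)
      then show ?case using restrict_mem_CD[OF assms(1)] f \<open>e > 0\<close> by auto
    qed
  qed
  from continuous_map_limit[OF assms(2)[unfolded continuous_functional_def] this]
  show "(\<lambda>n. F (restrict (f n) D)) \<longlonglongrightarrow> F (restrict h D)"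
    by (simp add: o_def)
qed

section \<open>Equicontinuous families of functions\<close>

definition equicont_family :: "'a::metric_space set \<Rightarrow> ('a \<Rightarrow> real) set \<Rightarrow> bool" where
  "equicont_family D K \<longleftrightarrow> (\<exists>b. \<forall>f\<in>K. \<forall>t\<in>D. \<bar>f t\<bar> \<le> b) \<and>
     (\<forall>e>0. \<exists>r>0. \<forall>f\<in>K. \<forall>t\<in>D. \<forall>s\<in>D. dist t s < r \<longrightarrow> \<bar>f t - f s\<bar> < e)"

lemma equicont_family_continuous:
  assumes "equicont_family D K" "f \<in> K"
  shows "continuous_on D f"
  unfolding continuous_on_iff
proof (intro ballI allI impI)
  fix x e :: real fix x assume "x \<in> D" "0 < e"
  then obtain r where "r > 0" "\<forall>f\<in>K. \<forall>t\<in>D. \<forall>s\<in>D. dist t s < r \<longrightarrow> \<bar>f t - f s\<bar> < e"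
    using assms(1) unfolding equicont_family_def by blast
  then show "\<exists>d>0. \<forall>x'\<in>D. dist x' x < d \<longrightarrow> dist (f x') (f x) < e"
    using assms(2) \<open>x \<in> D\<close> by (auto simp: dist_real_def intro!: exI[of _ r])
qed

lemma equicont_family_singleton:
  assumes "compact D" "continuous_on D f"
  shows "equicont_family D {f}"
proof -
  have "bounded (f ` D)" using assms compact_continuous_image compact_imp_bounded by blast
  then obtain b where b: "\<forall>t\<in>D. \<bar>f t\<bar> \<le> b" by (auto simp: bounded_iff)
  have "uniformly_continuous_on D f" using assms compact_uniformly_continuous by blast
  then show ?thesis
    using b unfolding equicont_family_def uniformly_continuous_on_def dist_real_def
    by (simp add: dist_commute abs_minus_commute) (metis dist_commute)
qed

text \<open>Equicontinuous families are relatively compact, so continuity becomes uniform near them.\<close>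

lemma cont_fun_uniform_near:
  fixes D :: "'a::euclidean_space set"
  assumes D: "compact D" and \<Phi>: "cont_fun D \<Phi>" and K: "equicont_family D K"
    and f: "\<And>n. f n \<in> K" and g: "\<And>n. continuous_on D (g n)"
    and u: "uniform_limit D (\<lambda>n t. g n t - f n t) (\<lambda>_. 0) sequentially"
  shows "(\<lambda>n. \<Phi> (g n) - \<Phi> (f n)) \<longlonglongrightarrow> 0"
proof (rule ccontr)
  assume "\<not> ?thesis"
  then obtain e where e: "e > 0" "\<not> (\<forall>\<^sub>F n in sequentially. dist (\<Phi> (g n) - \<Phi> (f n)) 0 < e)"
    unfolding tendsto_iff by blast
  from not_eventually_sequentiallyD[OF e(2)] obtain r :: "nat \<Rightarrow> nat"
    where r: "strict_mono r" "\<And>n. \<not> dist (\<Phi> (g (r n)) - \<Phi> (f (r n))) 0 < e" by blast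
  obtain b where b: "\<And>h t. h \<in> K \<Longrightarrow> t \<in> D \<Longrightarrow> \<bar>h t\<bar> \<le> b"
    using K unfolding equicont_family_def by blast
  have "\<exists>h k. continuous_on D h \<and> strict_mono (k :: nat \<Rightarrow> nat) \<and>
     (\<forall>e>0. \<exists>N. \<forall>n x. n \<ge> N \<and> x \<in> D \<longrightarrow> norm (f (r (k n)) x - h x) < e)"
  proof (rule Arzela_Ascoli[OF D, of "\<lambda>n. f (r n)" b])
    show "norm (f (r n) x) \<le> b" if "x \<in> D" for n x using b f that by simp
    show "\<exists>d>0. \<forall>n y. y \<in> D \<and> norm (x - y) < d \<longrightarrow> norm (f (r n) x - f (r n) y) < e"
      if "x \<in> D" "0 < e" for x e
    proof -
      obtain d where "d > 0" "\<forall>f\<in>K. \<forall>t\<in>D. \<forall>s\<in>D. dist t s < d \<longrightarrow> \<bar>f t - f s\<bar> < e"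
        using K \<open>0 < e\<close> unfolding equicont_family_def by blast
      then show ?thesis
        using f that by (intro exI[of _ d]) (auto simp: dist_norm)
    qed
  qed blast
  then obtain h k where h: "continuous_on D h" and k: "strict_mono (k :: nat \<Rightarrow> nat)"
    and lim: "\<And>e. e > 0 \<Longrightarrow> \<exists>N. \<forall>n x. n \<ge> N \<and> x \<in> D \<longrightarrow> norm (f (r (k n)) x - h x) < e"
    by blast
  have uf: "uniform_limit D (\<lambda>n. f (r (k n))) h sequentially"
    unfolding uniform_limit_iff eventually_sequentially dist_norm using lim by blast
  have "strict_mono (r \<circ> k)" using r(1) k by (rule strict_mono_o)
  then have "uniform_limit D (\<lambda>n t. g (r (k n)) t - f (r (k n)) t) (\<lambda>_. 0) sequentially"
    using filterlim_compose[OF u filterlim_subseq] by (simp add: o_def)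
  from uniform_limit_add[OF this uf]
  have ug: "uniform_limit D (\<lambda>n. g (r (k n))) h sequentially" by (simp add: algebra_simps)
  \<comment> \<open>Both subsequences have the same uniform limit \<open>h\<close>, so continuity at
    the single function \<open>h\<close> contradicts the gap \<open>e\<close>.\<close>
  have "(\<lambda>n. \<Phi> (g (r (k n))) - \<Phi> (f (r (k n)))) \<longlonglongrightarrow> \<Phi> h - \<Phi> h"
    by (intro tendsto_diff cont_funD[OF \<Phi>] uf ug g equicont_family_continuous[OF K f])
  then have "(\<lambda>n. \<Phi> (g (r (k n))) - \<Phi> (f (r (k n)))) \<longlonglongrightarrow> 0" by simp
  then have "\<forall>\<^sub>F n in sequentially. dist (\<Phi> (g (r (k n))) - \<Phi> (f (r (k n)))) 0 < e"
    using e(1) unfolding tendsto_iff by blast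
  with r(2) show False by simp
qed

section \<open>Trigonometric polynomials in finitely many values of a path\<close>

inductive_set trig :: "'a set \<Rightarrow> (('a \<Rightarrow> real) \<Rightarrow> real) set" for S where
  cosine: "(\<lambda>f. a * cos (b + (\<Sum>s\<in>S. c s * f s))) \<in> trig S"
| add: "p \<in> trig S \<Longrightarrow> q \<in> trig S \<Longrightarrow> (\<lambda>f. p f + q f) \<in> trig S"

text \<open>The product-to-sum formula closes the class under products, as Stone-Weierstrass
  requires. The phase \<open>b\<close> of a generator absorbs sines, so cosines alone suffice; since
  only sums are needed to build the class, expectations can be treated one cosine at a time.\<close>

lemma trig_mult:
  assumes "p \<in> trig S" "q \<in> trig S"
  shows "(\<lambda>f. p f * q f) \<in> trig S"
  using assms(1)
proof induction
  case (cosine a b c)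
  from assms(2) show ?case
  proof induction
    case (cosine a' b' c')
    have "(\<lambda>f. a * cos (b + (\<Sum>s\<in>S. c s * f s)) * (a' * cos (b' + (\<Sum>s\<in>S. c' s * f s)))) =
      (\<lambda>f. (a * a' / 2) * cos ((b - b') + (\<Sum>s\<in>S. (c s - c' s) * f s)) +
           (a * a' / 2) * cos ((b + b') + (\<Sum>s\<in>S. (c s + c' s) * f s)))"
    proof
      fix f
      have 1: "(b - b') + (\<Sum>s\<in>S. (c s - c' s) * f s) =
         (b + (\<Sum>s\<in>S. c s * f s)) - (b' + (\<Sum>s\<in>S. c' s * f s))"
        by (simp add: left_diff_distrib sum_subtractf)
      have 2: "(b + b') + (\<Sum>s\<in>S. (c s + c' s) * f s) =
         (b + (\<Sum>s\<in>S. c s * f s)) + (b' + (\<Sum>s\<in>S. c' s * f s))"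
        by (simp add: distrib_right sum.distrib)
      show "a * cos (b + (\<Sum>s\<in>S. c s * f s)) * (a' * cos (b' + (\<Sum>s\<in>S. c' s * f s))) =
        (a * a' / 2) * cos ((b - b') + (\<Sum>s\<in>S. (c s - c' s) * f s)) +
           (a * a' / 2) * cos ((b + b') + (\<Sum>s\<in>S. (c s + c' s) * f s))"
        unfolding 1 2 cos_diff cos_add by (simp add: field_simps)
    qed
    then show ?case by (simp only: trig.intros)
  next
    case (add p q)
    show ?case unfolding distrib_left by (rule trig.add[OF add.IH])
  qed
next
  case (add p q)
  show ?case unfolding distrib_right by (rule trig.add[OF add.IH])
qed

lemma trig_const: "(\<lambda>f. a) \<in> trig S"
  using trig.cosine[of a 0 "\<lambda>_. 0" S] by simp

text \<open>A sine is a cosine with phase \<open>- (pi/2)\<close>; the coefficients pick out the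
  single point \<open>s\<close>. With \<open>a = L\<close> this is the bounded stand-in for the
  coordinate \<open>f s\<close>.\<close>

lemma trig_sin_coord:
  assumes "finite S" "s \<in> S"
  shows "(\<lambda>f. a * sin (f s / L)) \<in> trig S"
proof -
  have "(\<Sum>t\<in>S. (if t = s then 1 / L else 0) * f t) = f s / L" for f :: "'a \<Rightarrow> real"
    using assms by (simp add: if_distrib[of "\<lambda>x. x * _"] sum.delta cong: if_cong)
  moreover have "cos (- (pi/2) + y) = sin y" for y :: real
    using cos_add[of "- (pi/2)" y] by simp
  ultimately show ?thesis
    using trig.cosine[of a "- (pi/2)" "\<lambda>t. if t = s then 1 / L else 0" S] by (simp only:)
qed

text \<open>The substitution of \<open>L sin (x / L)\<close> for \<open>x\<close> turns polynomial approximation on a cube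
  into approximation by trigonometric polynomials that is uniform on the whole space.\<close>

lemma trig_dense:
  fixes \<Psi> :: "(nat \<Rightarrow> real) \<Rightarrow> real"
  assumes S: "finite S" "\<And>i. i < m \<Longrightarrow> s i \<in> S" and "e > 0" "L > 0"
    and \<Psi>: "continuous_on {x. \<forall>i. x i \<in> (if i < m then {-L..L} else {0})} \<Psi>"
  shows "\<exists>p\<in>trig S. \<forall>f. \<bar>\<Psi> (\<lambda>i. if i < m then L * sin (f (s i) / L) else 0) - p f\<bar> < e"
proof -
  \<comment> \<open>A cube of dimension \<open>m\<close> without a type for \<open>m\<close>: the
    coordinates from \<open>m\<close> on are pinned to 0, so that Tychonoff gives compactness and
    points differ only in the first \<open>m\<close> coordinates.\<close>
  define Q where "Q = {x::nat \<Rightarrow> real. \<forall>i. x i \<in> (if i < m then {-L..L} else {0})}"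
  define \<tau> where "\<tau> f = (\<lambda>i. if i < m then L * sin (f (s i) / L) else 0)" for f
  \<comment> \<open>The algebra for Stone-Weierstrass: continuous functions on the cube that become
    trigonometric polynomials after the substitution \<open>\<tau>\<close>.\<close>
  define R where "R = {q. continuous_on Q q \<and> (\<lambda>f. q (\<tau> f)) \<in> trig S}"
  have QP: "Q = (\<Pi>\<^sub>E i\<in>UNIV. if i < m then {-L..L} else {0})"
    by (auto simp: Q_def PiE_def Pi_def)
  interpret function_ring_on R Q
  proof
    have "compactin (product_topology (\<lambda>i::nat. euclidean::real topology) UNIV) Q"
      unfolding QP compactin_PiE by auto
    then show "compact Q" by (simp add: euclidean_product_topology)
    show "\<exists>f\<in>R. f x \<noteq> f y" if xy: "x \<in> Q" "y \<in> Q" "x \<noteq> y" for x y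
    proof -
      obtain i where i: "x i \<noteq> y i" using xy(3) by blast
      have "i < m" using i xy unfolding Q_def by (auto split: if_splits) (metis singletonD)+
      have "continuous_on Q (\<lambda>z. z i)"
        by (rule continuous_on_subset[OF continuous_on_product_coordinates]) simp
      then have "(\<lambda>z. z i) \<in> R"
        using \<open>i < m\<close> trig_sin_coord[OF S(1) S(2), of i L L] by (simp add: R_def \<tau>_def)
      with i show ?thesis by (intro bexI[where x = "\<lambda>z. z i"])
    qed
    show "continuous_on Q f" if "f \<in> R" for f using that by (simp add: R_def)
    show "(\<lambda>x. f x + g x) \<in> R" if "f \<in> R" "g \<in> R" for f g
      using that unfolding R_def mem_Collect_eq
      by (elim conjE) (rule conjI[OF continuous_on_add trig.add])
    show "(\<lambda>x. f x * g x) \<in> R" if "f \<in> R" "g \<in> R" for f g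
      using that unfolding R_def mem_Collect_eq
      by (elim conjE) (rule conjI[OF continuous_on_mult trig_mult])
    show "(\<lambda>_. c) \<in> R" for c by (simp add: R_def trig_const)
  qed
  obtain q where q: "q \<in> R" "\<forall>x\<in>Q. \<bar>\<Psi> x - q x\<bar> < e"
    using Stone_Weierstrass_basic[OF \<Psi>[folded Q_def] \<open>e > 0\<close>] by blast
  have "\<tau> f \<in> Q" for f
  proof -
    have "\<bar>L * sin x\<bar> \<le> L" for x
      using mult_left_mono[OF abs_sin_le_one, of L x] \<open>L > 0\<close> by (simp add: abs_mult)
    then show ?thesis by (auto simp: \<tau>_def Q_def abs_le_iff minus_le_iff)
  qed
  with q(2) have "\<forall>f. \<bar>\<Psi> (\<tau> f) - q (\<tau> f)\<bar> < e" by simp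
  moreover have "(\<lambda>f. q (\<tau> f)) \<in> trig S" using q(1) by (simp add: R_def)
  ultimately show ?thesis
    unfolding \<tau>_def[symmetric] by (rule bexI[where x = "\<lambda>f. q (\<tau> f)"])
qed

text \<open>Tent functions around a finite net of mesh \<open>r\<close>, divided by their sum. An
  average with these weights at \<open>t\<close> only sees net points within \<open>r\<close> of
  \<open>t\<close>.\<close>

lemma partition_of_unity:
  fixes D :: "'a::metric_space set"
  assumes "compact D" "r > 0"
  shows "\<exists>m (s::nat \<Rightarrow> 'a) \<psi>. (\<forall>i<m. s i \<in> D \<and> continuous_on D (\<psi> i) \<and>
     (\<forall>t\<in>D. 0 \<le> \<psi> i t \<and> (r \<le> dist t (s i) \<longrightarrow> \<psi> i t = (0::real)))) \<and>
     (\<forall>t\<in>D. (\<Sum>i<m. \<psi> i t) = 1)"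
proof -
  obtain S where S: "finite S" "S \<subseteq> D" "D \<subseteq> (\<Union>s\<in>S. ball s r)"
    using seq_compact_imp_totally_bounded[OF iffD1[OF compact_eq_seq_compact_metric assms(1)], rule_format, OF assms(2)]
    by (elim exE conjE)
  obtain s where s: "bij_betw s {0..<card S} S" using ex_bij_betw_nat_finite[OF S(1)] by blast
  define m where "m = card S"
  have sD: "s i \<in> D" if "i < m" for i
    using s S that by (auto simp: bij_betw_def m_def)
  define \<phi> where "\<phi> i t = max 0 (r - dist t (s i))" for i t
  have pos: "(\<Sum>i<m. \<phi> i t) > 0" if "t \<in> D" for t
  proof -
    from S(3) that obtain z where "z \<in> S" "t \<in> ball z r" by blast
    then have "z \<in> S" "dist t z < r" by (simp_all add: dist_commute)
    moreover have "s ` {0..<m} = S" using s by (simp add: bij_betw_def m_def)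
    ultimately obtain i where "i < m" "dist t (s i) < r" by force
    then show ?thesis by (intro sum_pos2[of _ i]) (auto simp: \<phi>_def)
  qed
  show ?thesis
  proof (intro exI[of _ m] exI[of _ s] exI[of _ "\<lambda>i t. \<phi> i t / (\<Sum>i<m. \<phi> i t)"] conjI allI impI ballI)
    show "continuous_on D (\<lambda>t. \<phi> i t / (\<Sum>i<m. \<phi> i t))" for i
      unfolding \<phi>_def by (intro continuous_intros) (use pos in \<open>force simp: \<phi>_def\<close>)
    show "0 \<le> \<phi> i t / (\<Sum>i<m. \<phi> i t)" if "t \<in> D" for i t
      using pos[OF that] by (simp add: \<phi>_def)
    show "(\<Sum>i<m. \<phi> i t / (\<Sum>i<m. \<phi> i t)) = 1" if "t \<in> D" for t
      using pos[OF that] by (simp flip: sum_divide_distrib)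
  qed (use sD in \<open>auto simp: \<phi>_def\<close>)
qed

lemma uniform_limit_sum_lessThan:
  fixes f :: "nat \<Rightarrow> 'b \<Rightarrow> 'a \<Rightarrow> real"
  assumes "\<And>i. i < m \<Longrightarrow> uniform_limit D (f i) (h i) F"
  shows "uniform_limit D (\<lambda>n t. \<Sum>i<m. f i n t) (\<lambda>t. \<Sum>i<m. h i t) F"
  using assms
proof (induction m)
  case (Suc m)
  then show ?case by (simp add: uniform_limit_add)
qed (simp add: uniform_limit_const)

text \<open>\<open>T f\<close> interpolates the values \<open>L * sin (f (s i) / L)\<close> at
  finitely many net points by a partition of unity. Thus \<open>\<Phi> (T f)\<close> is a continuous
  function of finitely many bounded numbers, and \<open>trig_dense\<close> applies for every
  \<open>f\<close>, even a discontinuous one. The distance from \<open>T f\<close> to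
  \<open>f\<close> has two sources: the oscillation of \<open>f\<close> at scale \<open>r\<close>,
  and the replacement of \<open>x\<close> by \<open>L * sin (x / L)\<close>, which costs at most
  \<open>b\<^sup>2 / (2 * L)\<close> for values bounded by \<open>b\<close>.\<close>

lemma trig_approx_step:
  fixes D :: "'a::metric_space set"
  assumes D: "compact D" and \<Phi>: "cont_fun D \<Phi>" and pos: "e > 0" "r > 0" "L > 0"
  shows "\<exists>S p T. finite S \<and> S \<subseteq> D \<and> p \<in> trig S \<and> (\<forall>f. continuous_on D (T f)) \<and>
     (\<forall>f. \<bar>p f - \<Phi> (T f)\<bar> < e) \<and>
     (\<forall>f b \<epsilon>. (\<forall>t\<in>D. \<bar>f t\<bar> \<le> b) \<longrightarrow> (\<forall>t\<in>D. \<forall>s\<in>D. dist t s < r \<longrightarrow> \<bar>f t - f s\<bar> < \<epsilon>) \<longrightarrow>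
        (\<forall>t\<in>D. \<bar>T f t - f t\<bar> \<le> \<epsilon> + b\<^sup>2 / (2 * L)))"
proof -
  obtain m and s :: "nat \<Rightarrow> 'a" and \<psi> :: "nat \<Rightarrow> 'a \<Rightarrow> real" where
    P: "(\<forall>i<m. s i \<in> D \<and> continuous_on D (\<psi> i) \<and>
      (\<forall>t\<in>D. 0 \<le> \<psi> i t \<and> (r \<le> dist t (s i) \<longrightarrow> \<psi> i t = 0))) \<and> (\<forall>t\<in>D. (\<Sum>i<m. \<psi> i t) = 1)"
    using partition_of_unity[OF D \<open>r > 0\<close>] by (elim exE)
  have sD: "s i \<in> D" and cont: "continuous_on D (\<psi> i)" if "i < m" for i using P that by simp_all
  have nonneg: "0 \<le> \<psi> i t" and supp: "r \<le> dist t (s i) \<Longrightarrow> \<psi> i t = 0"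
    if "i < m" "t \<in> D" for i t using P that by simp_all
  have one: "(\<Sum>i<m. \<psi> i t) = 1" if "t \<in> D" for t using P that by simp
  define \<Psi> where "\<Psi> x = \<Phi> (\<lambda>t. \<Sum>i<m. x i * \<psi> i t)" for x
  have cont': "continuous_on D (\<lambda>t. \<Sum>i<m. x i * \<psi> i t)" for x
    by (intro continuous_intros) (use cont in auto)
  have "continuous_on UNIV \<Psi>"
    unfolding continuous_on_sequentially o_def \<Psi>_def
  proof (intro allI ballI impI)
    fix x :: "nat \<Rightarrow> nat \<Rightarrow> real" and a
    assume "(\<forall>n. x n \<in> UNIV) \<and> x \<longlonglongrightarrow> a"
    then have "x \<longlonglongrightarrow> a" by simp
    moreover have "isCont (\<lambda>y::nat \<Rightarrow> real. y i) a" for i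
      by (rule iffD1[OF continuous_on_eq_continuous_at[OF open_UNIV] continuous_on_product_coordinates, rule_format]) simp
    ultimately have lim: "(\<lambda>n. x n i) \<longlonglongrightarrow> a i" for i
      by (rule isCont_tendsto_compose[rotated])
    show "(\<lambda>n. \<Phi> (\<lambda>t. \<Sum>i<m. x n i * \<psi> i t)) \<longlonglongrightarrow> \<Phi> (\<lambda>t. \<Sum>i<m. a i * \<psi> i t)"
    proof (rule cont_funD[OF \<Phi> cont'])
      have bdd: "bounded (\<psi> i ` D)" if "i < m" for i
        using cont[OF that] D compact_continuous_image compact_imp_bounded by blast
      show "uniform_limit D (\<lambda>n t. \<Sum>i<m. x n i * \<psi> i t) (\<lambda>t. \<Sum>i<m. a i * \<psi> i t) sequentially"
      proof (rule uniform_limit_sum_lessThan)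
        fix i assume "i < m"
        moreover have "uniform_limit D (\<lambda>n t. x n i) (\<lambda>t. a i) sequentially"
          using lim[of i] unfolding uniform_limit_iff tendsto_iff by simp
        ultimately show "uniform_limit D (\<lambda>n t. x n i * \<psi> i t) (\<lambda>t. a i * \<psi> i t) sequentially"
          using bdd by (intro uniform_lim_mult uniform_limit_const) (auto simp: image_constant_conv)
      qed
    qed
  qed
  then have "continuous_on {x. \<forall>i. x i \<in> (if i < m then {-L..L} else {0})} \<Psi>"
    using continuous_on_subset by blast
  then have "\<exists>p\<in>trig (s ` {..<m}). \<forall>f. \<bar>\<Psi> (\<lambda>i. if i < m then L * sin (f (s i) / L) else 0) - p f\<bar> < e"
    by (rule trig_dense[OF _ _ pos(1) pos(3), rotated 2]) simp_all
  then obtain p where p: "p \<in> trig (s ` {..<m})"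
    "\<forall>f. \<bar>\<Psi> (\<lambda>i. if i < m then L * sin (f (s i) / L) else 0) - p f\<bar> < e" by (elim bexE)
  define T where "T f = (\<lambda>t. \<Sum>i<m. (if i < m then L * sin (f (s i) / L) else 0) * \<psi> i t)" for f
  have "\<bar>T f t - f t\<bar> \<le> \<epsilon> + b\<^sup>2 / (2 * L)"
    if b: "\<forall>t\<in>D. \<bar>f t\<bar> \<le> b" and \<epsilon>: "\<forall>t\<in>D. \<forall>s\<in>D. dist t s < r \<longrightarrow> \<bar>f t - f s\<bar> < \<epsilon>"
      and t: "t \<in> D" for f b \<epsilon> t
  proof -
    \<comment> \<open>Where the weight is not 0, \<open>s i\<close> is within \<open>r\<close> of
      \<open>t\<close> and both sources of error are under control; summing against weights of total
      1 preserves the bound.\<close>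
    have *: "\<bar>L * sin (f (s i) / L) - f t\<bar> * \<psi> i t \<le> (\<epsilon> + b\<^sup>2 / (2 * L)) * \<psi> i t" if i: "i < m" for i
    proof (cases "dist t (s i) < r")
      case True
      have "\<bar>sin x - x\<bar> \<le> x\<^sup>2 / 2" for x :: real
      proof -
        have "(\<Sum>m<2. sin_coeff m * x ^ m) = x" by (simp add: numeral_2_eq_2 sin_coeff_def)
        then show ?thesis using Maclaurin_sin_bound[of x 2] by simp
      qed
      from mult_left_mono[OF this, of L "f (s i) / L"]
      have "L * \<bar>sin (f (s i) / L) - f (s i) / L\<bar> \<le> (f (s i))\<^sup>2 / (2 * L)"
        using pos by (simp add: field_simps power2_eq_square)
      moreover have "L * \<bar>sin (f (s i) / L) - f (s i) / L\<bar> = \<bar>L * sin (f (s i) / L) - f (s i)\<bar>"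
        using pos(3) by (subst abs_of_pos[OF pos(3), symmetric], subst abs_mult[symmetric]) (simp add: right_diff_distrib)
      moreover have "(f (s i))\<^sup>2 \<le> b\<^sup>2"
        using b sD[OF i] by (metis abs_le_square_iff abs_of_nonneg abs_ge_zero order_trans)
      then have "(f (s i))\<^sup>2 / (2 * L) \<le> b\<^sup>2 / (2 * L)"
        using pos by (simp add: divide_right_mono)
      moreover have "\<bar>f t - f (s i)\<bar> < \<epsilon>" using \<epsilon> t sD[OF i] True by blast
      ultimately have "\<bar>L * sin (f (s i) / L) - f t\<bar> \<le> \<epsilon> + b\<^sup>2 / (2 * L)" by linarith
      then show ?thesis using nonneg[OF i t] by (rule mult_right_mono)
    next
      case False
      then show ?thesis using supp[OF i t] by simp
    qed
    have "T f t - f t = (\<Sum>i<m. (L * sin (f (s i) / L) - f t) * \<psi> i t)"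
      by (simp add: T_def left_diff_distrib sum_subtractf one[OF t] flip: sum_distrib_left)
    also have "\<bar>\<dots>\<bar> \<le> (\<Sum>i<m. \<bar>L * sin (f (s i) / L) - f t\<bar> * \<psi> i t)"
      by (rule order_trans[OF sum_abs]) (use nonneg t in \<open>auto simp: abs_mult intro!: sum_mono\<close>)
    also have "\<dots> \<le> (\<Sum>i<m. (\<epsilon> + b\<^sup>2 / (2 * L)) * \<psi> i t)"
      by (intro sum_mono *) auto
    also have "\<dots> = \<epsilon> + b\<^sup>2 / (2 * L)" by (simp add: one[OF t] flip: sum_distrib_left)
    finally show ?thesis .
  qed
  note T_near = this
  show ?thesis
  proof (intro exI[of _ "s ` {..<m}"] exI[of _ p] exI[of _ T] conjI allI impI ballI)
    show "continuous_on D (T f)" for f unfolding T_def by (rule cont')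
    show "\<bar>p f - \<Phi> (T f)\<bar> < e" for f
      using p(2)[rule_format, of f] by (simp only: \<Psi>_def T_def abs_minus_commute)
    show "\<bar>T f t - f t\<bar> \<le> \<epsilon> + b\<^sup>2 / (2 * L)"
      if "\<forall>t\<in>D. \<bar>f t\<bar> \<le> b" "\<forall>t\<in>D. \<forall>s\<in>D. dist t s < r \<longrightarrow> \<bar>f t - f s\<bar> < \<epsilon>" "t \<in> D" for f b \<epsilon> t
      using that by (rule T_near)
  qed (use p(1) sD in \<open>simp_all add: image_subset_iff\<close>)
qed

text \<open>The previous approximation with \<open>r = e = 1 / (k + 1)\<close> and
  \<open>L = k + 1\<close>. The bound \<open>C + 1\<close> holds for arbitrary \<open>f\<close>
  because \<open>p k f\<close> is within 1 of the value of \<open>\<Phi>\<close> at the continuous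
  function \<open>T k f\<close>. It is stated for every \<open>C\<close> rather than a fixed one, so
  that the same approximants serve unbounded \<open>\<Phi>\<close>, as in the proof of
  measurability.\<close>

lemma trig_approx:
  fixes D :: "'a::euclidean_space set"
  assumes D: "compact D" and \<Phi>: "cont_fun D \<Phi>"
  obtains S :: "nat \<Rightarrow> 'a set" and p where
    "\<And>k. finite (S k)" "\<And>k. S k \<subseteq> D" "\<And>k. p k \<in> trig (S k)"
    "\<forall>C. (\<forall>f. continuous_on D f \<longrightarrow> \<bar>\<Phi> f\<bar> \<le> C) \<longrightarrow> (\<forall>k f. \<bar>p k f\<bar> \<le> C + 1)"
    "\<And>K e. equicont_family D K \<Longrightarrow> e > 0 \<Longrightarrow>
       \<forall>\<^sub>F k in sequentially. \<forall>f\<in>K. \<bar>p k f - \<Phi> f\<bar> < e"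
proof -
  have "\<forall>k::nat. \<exists>S p T. finite S \<and> S \<subseteq> D \<and> p \<in> trig S \<and> (\<forall>f. continuous_on D (T f)) \<and>
     (\<forall>f. \<bar>p f - \<Phi> (T f)\<bar> < 1 / real (Suc k)) \<and>
     (\<forall>f b \<epsilon>. (\<forall>t\<in>D. \<bar>f t\<bar> \<le> b) \<longrightarrow> (\<forall>t\<in>D. \<forall>s\<in>D. dist t s < 1 / real (Suc k) \<longrightarrow> \<bar>f t - f s\<bar> < \<epsilon>) \<longrightarrow>
        (\<forall>t\<in>D. \<bar>T f t - f t\<bar> \<le> \<epsilon> + b\<^sup>2 / (2 * real (Suc k))))"
    by (rule allI, rule trig_approx_step[OF D \<Phi>]) simp_all
  then obtain S p T where H: "\<forall>k::nat. finite (S k) \<and> S k \<subseteq> D \<and> p k \<in> trig (S k) \<and> (\<forall>f. continuous_on D (T k f)) \<and>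
     (\<forall>f. \<bar>p k f - \<Phi> (T k f)\<bar> < 1 / real (Suc k)) \<and>
     (\<forall>f b \<epsilon>. (\<forall>t\<in>D. \<bar>f t\<bar> \<le> b) \<longrightarrow> (\<forall>t\<in>D. \<forall>s\<in>D. dist t s < 1 / real (Suc k) \<longrightarrow> \<bar>f t - f s\<bar> < \<epsilon>) \<longrightarrow>
        (\<forall>t\<in>D. \<bar>T k f t - f t\<bar> \<le> \<epsilon> + b\<^sup>2 / (2 * real (Suc k))))"
    unfolding choice_iff by (elim exE)
  have S: "\<And>k. finite (S k)" "\<And>k. S k \<subseteq> D" "\<And>k. p k \<in> trig (S k)"
    and T: "\<And>k f. continuous_on D (T k f)"
    and pT: "\<And>k f. \<bar>p k f - \<Phi> (T k f)\<bar> < 1 / real (Suc k)"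
    using H by (simp_all del: of_nat_Suc)
  have Tf: "\<bar>T k f t - f t\<bar> \<le> \<epsilon> + b\<^sup>2 / (2 * real (Suc k))"
    if "\<And>t. t\<in>D \<Longrightarrow> \<bar>f t\<bar> \<le> b" "\<And>t s. t\<in>D \<Longrightarrow> s\<in>D \<Longrightarrow> dist t s < 1 / real (Suc k) \<Longrightarrow> \<bar>f t - f s\<bar> < \<epsilon>" "t \<in> D"
    for k f b \<epsilon> t
    using H[rule_format, of k] that by (simp del: of_nat_Suc)
  \<comment> \<open>Along a sequence in \<open>K\<close> the functions \<open>T k (f k)\<close>
    approach \<open>f k\<close> uniformly, so that \<open>cont_fun_uniform_near\<close>
    applies.\<close>
  have seq: "(\<lambda>k. p k (f k) - \<Phi> (f k)) \<longlonglongrightarrow> 0" if K: "equicont_family D K" and f: "\<And>k. f k \<in> K" for K f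
  proof -
    obtain b where b: "\<And>h t. h \<in> K \<Longrightarrow> t \<in> D \<Longrightarrow> \<bar>h t\<bar> \<le> b"
      using K unfolding equicont_family_def by blast
    have "uniform_limit D (\<lambda>k t. T k (f k) t - f k t) (\<lambda>_. 0) sequentially"
      unfolding uniform_limit_iff
    proof (intro allI impI)
      fix e :: real assume "e > 0"
      then obtain r where r: "r > 0" "\<forall>f\<in>K. \<forall>t\<in>D. \<forall>s\<in>D. dist t s < r \<longrightarrow> \<bar>f t - f s\<bar> < e / 2"
        using K unfolding equicont_family_def by (meson half_gt_zero)
      have "(\<lambda>k. 1 / real (Suc k)) \<longlonglongrightarrow> 0" by (rule lim_1_over_n[THEN LIMSEQ_Suc])
      then have "\<forall>\<^sub>F k in sequentially. 1 / real (Suc k) < r"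
        using r(1) by (rule order_tendstoD)
      moreover have "(\<lambda>k. b\<^sup>2 / 2 * (1 / real (Suc k))) \<longlonglongrightarrow> b\<^sup>2 / 2 * 0"
        by (intro tendsto_intros lim_1_over_n[THEN LIMSEQ_Suc])
      then have "\<forall>\<^sub>F k in sequentially. b\<^sup>2 / 2 * (1 / real (Suc k)) < e / 2"
        using \<open>e > 0\<close> by (intro order_tendstoD) auto
      ultimately show "\<forall>\<^sub>F k in sequentially. \<forall>t\<in>D. dist (T k (f k) t - f k t) 0 < e"
      proof eventually_elim
        case (elim k)
        show ?case
        proof
          fix t assume "t \<in> D"
          then have "\<bar>T k (f k) t - f k t\<bar> \<le> e / 2 + b\<^sup>2 / (2 * real (Suc k))"
            by (intro Tf) (use b f r elim in \<open>auto simp del: of_nat_Suc\<close>)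
          also have "b\<^sup>2 / (2 * real (Suc k)) = b\<^sup>2 / 2 * (1 / real (Suc k))" by simp
          also have "e / 2 + b\<^sup>2 / 2 * (1 / real (Suc k)) < e" using elim by linarith
          finally show "dist (T k (f k) t - f k t) 0 < e" by simp
        qed
      qed
    qed
    from cont_fun_uniform_near[OF D \<Phi> K f T this]
    have "(\<lambda>k. \<Phi> (T k (f k)) - \<Phi> (f k)) \<longlonglongrightarrow> 0" .
    moreover have "(\<lambda>k. p k (f k) - \<Phi> (T k (f k))) \<longlonglongrightarrow> 0"
      by (rule Lim_null_comparison[OF _ lim_1_over_n[THEN LIMSEQ_Suc]])
        (use pT in \<open>auto intro!: always_eventually less_imp_le simp del: of_nat_Suc\<close>)
    ultimately show ?thesis using tendsto_add by fastforce
  qed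
  show ?thesis
  proof (rule that[OF S])
    show "\<forall>C. (\<forall>f. continuous_on D f \<longrightarrow> \<bar>\<Phi> f\<bar> \<le> C) \<longrightarrow> (\<forall>k f. \<bar>p k f\<bar> \<le> C + 1)"
    proof (intro allI impI)
      fix C k f assume "\<forall>f. continuous_on D f \<longrightarrow> \<bar>\<Phi> f\<bar> \<le> C"
      then have "\<bar>\<Phi> (T k f)\<bar> \<le> C" using T by simp
      moreover have "1 / real (Suc k) \<le> 1" by simp
      ultimately show "\<bar>p k f\<bar> \<le> C + 1" using pT[of k f] by linarith
    qed
    show "\<forall>\<^sub>F k in sequentially. \<forall>f\<in>K. \<bar>p k f - \<Phi> f\<bar> < e"
      if K: "equicont_family D K" and e: "e > 0" for K e
    proof (cases "K = {}")
      case False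
      \<comment> \<open>For each \<open>k\<close> a violator of the bound is chosen if there is one,
        and any member of \<open>K\<close> otherwise: uniformity over \<open>K\<close> then follows
        from the sequential statement \<open>seq\<close>.\<close>
      have "\<forall>k. \<exists>f. f \<in> K \<and> ((\<exists>f\<in>K. \<not> \<bar>p k f - \<Phi> f\<bar> < e) \<longrightarrow> \<not> \<bar>p k f - \<Phi> f\<bar> < e)"
      proof
        fix k
        show "\<exists>f. f \<in> K \<and> ((\<exists>f\<in>K. \<not> \<bar>p k f - \<Phi> f\<bar> < e) \<longrightarrow> \<not> \<bar>p k f - \<Phi> f\<bar> < e)"
        proof (cases "\<exists>f\<in>K. \<not> \<bar>p k f - \<Phi> f\<bar> < e")
          case True
          then obtain f where "f \<in> K" "\<not> \<bar>p k f - \<Phi> f\<bar> < e" by (elim bexE)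
          then show ?thesis by (intro exI[of _ f] conjI impI)
        next
          case False
          obtain f where "f \<in> K" using \<open>K \<noteq> {}\<close> by (metis ex_in_conv)
          then show ?thesis using False by (intro exI[of _ f] conjI impI) (simp_all only: False simp_thms)
        qed
      qed
      then obtain f where "\<forall>k. f k \<in> K \<and> ((\<exists>f\<in>K. \<not> \<bar>p k f - \<Phi> f\<bar> < e) \<longrightarrow> \<not> \<bar>p k (f k) - \<Phi> (f k)\<bar> < e)"
        unfolding choice_iff by (elim exE)
      then have f: "f k \<in> K" "(\<exists>f\<in>K. \<not> \<bar>p k f - \<Phi> f\<bar> < e) \<Longrightarrow> \<not> \<bar>p k (f k) - \<Phi> (f k)\<bar> < e" for k
        by simp_all
      have "\<forall>\<^sub>F k in sequentially. dist (p k (f k) - \<Phi> (f k)) 0 < e"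
        by (rule tendstoD[OF seq[OF K f(1)] e])
      then show ?thesis
      proof (rule eventually_mono)
        fix k assume lt: "dist (p k (f k) - \<Phi> (f k)) 0 < e"
        show "\<forall>f\<in>K. \<bar>p k f - \<Phi> f\<bar> < e"
        proof (rule ballI, rule ccontr)
          fix h assume "h \<in> K" "\<not> \<bar>p k h - \<Phi> h\<bar> < e"
          then have "\<exists>f\<in>K. \<not> \<bar>p k f - \<Phi> f\<bar> < e" by (intro bexI[of _ h])
          from f(2)[OF this] lt show False by (simp add: dist_real_def)
        qed
      qed
    qed simp
  qed
qed

section \<open>Moments of centered normal variables\<close>

lemma (in prob_space) centered_normal_borel:
  "centered_normal M X \<Longrightarrow> X \<in> borel_measurable M"
  by (simp add: centered_normal_def)

lemma integral_std_normal_cos: "(\<integral>x. std_normal_density x * cos (t * x) \<partial>lborel) = exp (- t\<^sup>2 / 2)"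
proof -
  interpret real_distribution std_normal_distribution by (rule real_dist_normal_dist)
  have int: "complex_integrable std_normal_distribution (\<lambda>x. iexp (t * x))"
    by (intro integrable_iexp) auto
  have "complex_of_real (exp (- t\<^sup>2 / 2)) = char std_normal_distribution t"
    by (simp add: char_std_normal_distribution)
  also have "\<dots> = (CLINT x|std_normal_distribution. iexp (t * x))" by (simp add: char_def)
  finally have "exp (- t\<^sup>2 / 2) = Re (CLINT x|std_normal_distribution. iexp (t * x))"
    by (metis Re_complex_of_real)
  also have "\<dots> = (\<integral>x. cos (t * x) \<partial>std_normal_distribution)"
    by (subst integral_Re[OF int, symmetric]) (simp add: Re_exp)
  also have "\<dots> = (\<integral>x. std_normal_density x * cos (t * x) \<partial>lborel)"
    by (subst integral_real_density) auto
  finally show ?thesis by simp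
qed

text \<open>Completing the square: exponential tilting moves the mean to
  \<open>\<theta> * \<sigma>\<^sup>2\<close>, and the factor in front is the moment generating
  function.\<close>

lemma normal_density_mult_exp:
  assumes "\<sigma> > 0"
  shows "normal_density 0 \<sigma> x * exp (\<theta> * x) = exp (\<theta>\<^sup>2 * \<sigma>\<^sup>2 / 2) * normal_density (\<theta> * \<sigma>\<^sup>2) \<sigma> x"
proof -
  have "- (x - 0)\<^sup>2 / (2 * \<sigma>\<^sup>2) + \<theta> * x = \<theta>\<^sup>2 * \<sigma>\<^sup>2 / 2 + - (x - \<theta> * \<sigma>\<^sup>2)\<^sup>2 / (2 * \<sigma>\<^sup>2)"
    using assms by (simp add: field_simps power2_eq_square)
  then have "exp (- (x - 0)\<^sup>2 / (2 * \<sigma>\<^sup>2)) * exp (\<theta> * x) =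
      exp (\<theta>\<^sup>2 * \<sigma>\<^sup>2 / 2) * exp (- (x - \<theta> * \<sigma>\<^sup>2)\<^sup>2 / (2 * \<sigma>\<^sup>2))"
    by (simp only: exp_add[symmetric])
  then show ?thesis by (simp add: normal_density_def)
qed

context prob_space
begin

lemma centered_normal_cases:
  assumes "centered_normal M X"
  obtains (zero) "AE w in M. X w = 0"
  | (normal) \<sigma> where "\<sigma> > 0" "distributed M lborel X (normal_density 0 \<sigma>)"
  using assms unfolding centered_normal_def by blast

lemma centered_normal_square_integrable:
  assumes "centered_normal M X"
  shows "integrable M (\<lambda>w. (X w)\<^sup>2)"
  using assms
proof (cases rule: centered_normal_cases)
  case zero
  have [measurable]: "X \<in> borel_measurable M" using assms by (rule centered_normal_borel)
  have "integrable M (\<lambda>w. (X w)\<^sup>2) \<longleftrightarrow> integrable M (\<lambda>w. 0 :: real)"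
    by (rule integrable_cong_AE) (use zero in auto)
  then show ?thesis by simp
next
  case (normal \<sigma>)
  then show ?thesis
    using distributed_integrable[OF normal(2), of "\<lambda>x. x\<^sup>2"] integrable_normal_moment[OF normal(1), of 0 2]
    by simp
qed

lemma centered_normal_expectation:
  assumes "centered_normal M X"
  shows "expectation X = 0"
  using assms
proof (cases rule: centered_normal_cases)
  case zero
  then have "expectation X = expectation (\<lambda>_. 0)"
    using centered_normal_borel[OF assms] by (intro integral_cong_AE) auto
  then show ?thesis by simp
next
  case (normal \<sigma>)
  then show ?thesis by (rule normal_distributed_expectation)
qed

lemma centered_normal_var:
  assumes "centered_normal M X"
  shows "var M X = expectation (\<lambda>w. (X w)\<^sup>2)"
  by (simp add: var_def centered_normal_expectation[OF assms])

lemma centered_normal_variance_normal: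
  assumes "\<sigma> > 0" "distributed M lborel X (normal_density 0 \<sigma>)"
  shows "expectation (\<lambda>w. (X w)\<^sup>2) = \<sigma>\<^sup>2"
  using normal_distributed_variance[OF assms] normal_distributed_expectation[OF assms] by simp

text \<open>By symmetry \<open>sin X\<close> has mean 0, so only \<open>cos b * cos X\<close>
  survives the addition formula. One formula for all phases \<open>b\<close> replaces the complex
  characteristic function; the degenerate law fits in with second moment 0.\<close>

lemma centered_normal_cos:
  assumes "centered_normal M X"
  shows "expectation (\<lambda>w. cos (b + X w)) = cos b * exp (- expectation (\<lambda>w. (X w)\<^sup>2) / 2)"
  using assms
proof (cases rule: centered_normal_cases)
  case zero
  have [measurable]: "X \<in> borel_measurable M" using assms by (rule centered_normal_borel)
  have "expectation (\<lambda>w. cos (b + X w)) = expectation (\<lambda>w. cos b)"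
    by (intro integral_cong_AE) (use zero in auto)
  moreover have "expectation (\<lambda>w. (X w)\<^sup>2) = expectation (\<lambda>w. 0)"
    by (intro integral_cong_AE) (use zero in auto)
  ultimately show ?thesis by (simp add: prob_space)
next
  case (normal \<sigma>)
  have Z: "distributed M lborel (\<lambda>w. (X w - 0) / \<sigma>) std_normal_density"
    using normal normal_standard_normal_convert by blast
  have D: "distributed M lborel (\<lambda>w. X w / \<sigma>) std_normal_density" using Z by simp
  have [measurable]: "X \<in> borel_measurable M" using assms by (rule centered_normal_borel)
  have int: "integrable M (\<lambda>w. cos (X w))" "integrable M (\<lambda>w. sin (X w))"
    by (auto intro!: integrable_const_bound[where B = 1] abs_cos_le_one abs_sin_le_one)
  have eq: "\<sigma> * (X w / \<sigma>) = X w" for w using normal(1) by simp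
  have c: "expectation (\<lambda>w. cos (X w)) = exp (- \<sigma>\<^sup>2 / 2)"
    using distributed_integral[OF D, of "\<lambda>x. cos (\<sigma> * x)"] unfolding integral_std_normal_cos eq by simp
  have "expectation (\<lambda>w. sin (X w)) = (\<integral>x. normal_density 0 \<sigma> x * sin x \<partial>lborel)"
    using distributed_integral[OF normal(2), of sin] by simp
  also have "\<dots> = (\<integral>x. normal_density 0 \<sigma> (-x) * sin (-x) \<partial>lborel)"
    using lborel_integral_real_affine[of "-1" "\<lambda>x. normal_density 0 \<sigma> x * sin x" 0] by simp
  also have "\<dots> = - (\<integral>x. normal_density 0 \<sigma> x * sin x \<partial>lborel)"
    by (simp add: normal_density_def)
  finally have s: "expectation (\<lambda>w. sin (X w)) = 0"
    using distributed_integral[OF normal(2), of sin] by simp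
  show ?thesis
    using int by (simp add: cos_add c s centered_normal_variance_normal[OF normal])
qed

lemma centered_normal_exp:
  assumes "centered_normal M X"
  shows "integrable M (\<lambda>w. exp (\<theta> * X w))"
    and "expectation (\<lambda>w. exp (\<theta> * X w)) = exp (\<theta>\<^sup>2 * expectation (\<lambda>w. (X w)\<^sup>2) / 2)"
proof -
  have [measurable]: "X \<in> borel_measurable M" using assms by (rule centered_normal_borel)
  have "integrable M (\<lambda>w. exp (\<theta> * X w)) \<and>
    expectation (\<lambda>w. exp (\<theta> * X w)) = exp (\<theta>\<^sup>2 * expectation (\<lambda>w. (X w)\<^sup>2) / 2)"
    using assms
  proof (cases rule: centered_normal_cases)
    case zero
    have "integrable M (\<lambda>w. exp (\<theta> * X w)) \<longleftrightarrow> integrable M (\<lambda>w. 1 :: real)"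
      by (rule integrable_cong_AE) (use zero in auto)
    moreover have "expectation (\<lambda>w. exp (\<theta> * X w)) = expectation (\<lambda>w. 1)"
      by (intro integral_cong_AE) (use zero in auto)
    moreover have "expectation (\<lambda>w. (X w)\<^sup>2) = expectation (\<lambda>w. 0)"
      by (intro integral_cong_AE) (use zero in auto)
    ultimately show ?thesis by (simp add: prob_space)
  next
    case (normal \<sigma>)
    have "integrable M (\<lambda>w. exp (\<theta> * X w))"
      using distributed_integrable[OF normal(2), of "\<lambda>x. exp (\<theta> * x)"] normal(1)
      by (simp add: normal_density_mult_exp integrable_normal_density)
    moreover have "expectation (\<lambda>w. exp (\<theta> * X w)) = exp (\<theta>\<^sup>2 * \<sigma>\<^sup>2 / 2)"
      using distributed_integral[OF normal(2), of "\<lambda>x. exp (\<theta> * x)"] normal(1)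
      by (simp add: normal_density_mult_exp integral_normal_density)
    ultimately show ?thesis by (simp add: centered_normal_variance_normal[OF normal])
  qed
  then show "integrable M (\<lambda>w. exp (\<theta> * X w))"
    "expectation (\<lambda>w. exp (\<theta> * X w)) = exp (\<theta>\<^sup>2 * expectation (\<lambda>w. (X w)\<^sup>2) / 2)" by blast+
qed

text \<open>Chernoff bound with exponent \<open>l / s\<close>, deliberately not optimised in
  \<open>x\<close>: a tail that is exponential with a free rate \<open>l\<close> is what chaining
  consumes, since a threshold of the form \<open>b + lev j\<close> then splits into a
  product.\<close>

lemma centered_normal_tail:
  assumes X: "centered_normal M X" and v: "expectation (\<lambda>w. (X w)\<^sup>2) \<le> s\<^sup>2" and s: "s > 0" and l: "l > 0"
  shows "prob {w \<in> space M. \<bar>X w\<bar> > s * x} \<le> 2 * exp (l\<^sup>2 / 2) * exp (- l * x)"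
proof -
  have [measurable]: "X \<in> borel_measurable M" using X by (rule centered_normal_borel)
  define Y where "Y w = exp (l / s * X w) + exp (- (l / s) * X w)" for w
  have int: "integrable M Y" unfolding Y_def
    by (intro Bochner_Integration.integrable_add centered_normal_exp X)
  have "(l / s)\<^sup>2 * expectation (\<lambda>w. (X w)\<^sup>2) \<le> (l / s)\<^sup>2 * s\<^sup>2"
    using v by (intro mult_left_mono) auto
  then have "(l / s)\<^sup>2 * expectation (\<lambda>w. (X w)\<^sup>2) \<le> l\<^sup>2" using s by (simp add: power_divide)
  moreover have "expectation Y = 2 * exp ((l / s)\<^sup>2 * expectation (\<lambda>w. (X w)\<^sup>2) / 2)"
  proof -
    have "expectation Y = expectation (\<lambda>w. exp (l / s * X w)) + expectation (\<lambda>w. exp (- (l / s) * X w))"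
      unfolding Y_def by (intro Bochner_Integration.integral_add centered_normal_exp X)
    then show ?thesis by (simp only: centered_normal_exp(2)[OF X] power2_minus mult_2)
  qed
  ultimately have "expectation Y \<le> 2 * exp (l\<^sup>2 / 2)" by simp
  have "prob {w \<in> space M. \<bar>X w\<bar> > s * x} \<le> prob {w \<in> space M. Y w \<ge> exp (l * x)}"
  proof (intro finite_measure_mono subsetI)
    fix w assume "w \<in> {w \<in> space M. \<bar>X w\<bar> > s * x}"
    then have w: "w \<in> space M" "\<bar>X w\<bar> > s * x" by auto
    then have "x \<le> \<bar>X w\<bar> / s" using s by (simp add: field_simps)
    then have "l * x \<le> l * (\<bar>X w\<bar> / s)" using l by (intro mult_left_mono) auto
    then have "l * x \<le> l / s * X w \<or> l * x \<le> - (l / s) * X w" by (auto simp: abs_if split: if_splits)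
    then have "exp (l * x) \<le> exp (l / s * X w) \<or> exp (l * x) \<le> exp (- (l / s) * X w)" by simp
    moreover have "0 < exp (l / s * X w)" "0 < exp (- (l / s) * X w)" by simp_all
    ultimately have "exp (l * x) \<le> Y w" unfolding Y_def by linarith
    then show "w \<in> {w \<in> space M. Y w \<ge> exp (l * x)}" using w(1) by simp
  qed (simp add: Y_def)
  also have "\<dots> \<le> expectation Y / exp (l * x)"
    by (rule integral_Markov_inequality_measure[OF int, where A = "{}"]) (auto simp: Y_def intro!: AE_I2 add_nonneg_nonneg)
  also have "\<dots> \<le> 2 * exp (l\<^sup>2 / 2) / exp (l * x)"
    using \<open>expectation Y \<le> 2 * exp (l\<^sup>2 / 2)\<close> by (intro divide_right_mono) auto
  also have "\<dots> = 2 * exp (l\<^sup>2 / 2) * exp (- l * x)"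
    unfolding mult_minus_left exp_minus by (simp only: divide_inverse)
  finally show ?thesis .
qed

end

lemma trig_measurable:
  assumes "p \<in> trig S" "\<And>t. t \<in> S \<Longrightarrow> X t \<in> borel_measurable M"
  shows "(\<lambda>w. p (\<lambda>t. X t w)) \<in> borel_measurable M"
  using assms(1)
proof induction
  case (cosine a b c)
  have "(\<lambda>w. \<Sum>s\<in>S. c s * X s w) \<in> borel_measurable M"
    by (intro borel_measurable_sum borel_measurable_times assms(2)) auto
  then show ?case by measurable
next
  case (add p q)
  then show ?case by (intro borel_measurable_add)
qed

lemma trig_bounded:
  assumes "p \<in> trig S"
  shows "\<exists>C. \<forall>f. \<bar>p f\<bar> \<le> C"
  using assms
proof induction
  case (cosine a b c)
  have "\<bar>a * cos x\<bar> \<le> \<bar>a\<bar>" for x :: real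
    using mult_left_mono[OF abs_cos_le_one, of "\<bar>a\<bar>" x] by (simp add: abs_mult)
  then show ?case by blast
next
  case (add p q)
  then obtain C C' where "\<forall>f. \<bar>p f\<bar> \<le> C" "\<forall>f. \<bar>q f\<bar> \<le> C'" by (elim exE)
  then have "\<forall>f. \<bar>p f + q f\<bar> \<le> C + C'" by (meson abs_triangle_ineq add_mono order_trans)
  then show ?case by (rule exI)
qed

lemma (in prob_space) trig_integrable:
  assumes "p \<in> trig S" "\<And>t. t \<in> S \<Longrightarrow> X t \<in> borel_measurable M"
  shows "integrable M (\<lambda>w. p (\<lambda>t. X t w))"
proof -
  obtain C where "\<forall>f. \<bar>p f\<bar> \<le> C" using trig_bounded[OF assms(1)] by (elim exE)
  then show ?thesis
    using trig_measurable[OF assms] by (intro integrable_const_bound[where B = C]) auto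
qed

text \<open>Convergence of all finite-dimensional distributions: with the phase \<open>b\<close>,
  cosines of linear combinations carry both the real and the imaginary part of the characteristic
  functions.\<close>

definition trig_conv ::
  "(nat \<Rightarrow> 'w measure) \<Rightarrow> 'a set \<Rightarrow> (nat \<Rightarrow> 'a \<Rightarrow> 'w \<Rightarrow> real) \<Rightarrow> 'v measure \<Rightarrow> ('a \<Rightarrow> 'v \<Rightarrow> real) \<Rightarrow> bool" where
  "trig_conv M D X N Y \<longleftrightarrow> (\<forall>S b c. finite S \<longrightarrow> S \<subseteq> D \<longrightarrow>
     (\<lambda>n. \<integral>w. cos (b + (\<Sum>s\<in>S. c s * X n s w)) \<partial>M n) \<longlonglongrightarrow> (\<integral>w. cos (b + (\<Sum>s\<in>S. c s * Y s w)) \<partial>N))"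

lemma trig_conv_tendsto:
  assumes X: "\<And>n. prob_space (M n)" "\<And>n t. t \<in> S \<Longrightarrow> X n t \<in> borel_measurable (M n)"
    and Y: "prob_space N" "\<And>t. t \<in> S \<Longrightarrow> Y t \<in> borel_measurable N"
    and S: "finite S" "S \<subseteq> D" and conv: "trig_conv M D X N Y" and p: "p \<in> trig S"
  shows "(\<lambda>n. \<integral>w. p (\<lambda>t. X n t w) \<partial>M n) \<longlonglongrightarrow> (\<integral>w. p (\<lambda>t. Y t w) \<partial>N)"
  using p
proof induction
  case (cosine a b c)
  have "(\<lambda>n. a * (\<integral>w. cos (b + (\<Sum>s\<in>S. c s * X n s w)) \<partial>M n)) \<longlonglongrightarrow>
      a * (\<integral>w. cos (b + (\<Sum>s\<in>S. c s * Y s w)) \<partial>N)"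
    using conv S unfolding trig_conv_def by (intro tendsto_mult_left) blast
  then show ?case by simp
next
  case (add p q)
  note pq = add.hyps
  have A: "(\<integral>w. p (\<lambda>t. X n t w) + q (\<lambda>t. X n t w) \<partial>M n) =
      (\<integral>w. p (\<lambda>t. X n t w) \<partial>M n) + (\<integral>w. q (\<lambda>t. X n t w) \<partial>M n)" for n
    using prob_space.trig_integrable[OF X(1) pq(1) X(2)] prob_space.trig_integrable[OF X(1) pq(2) X(2)]
    by (rule Bochner_Integration.integral_add)
  have B: "(\<integral>w. p (\<lambda>t. Y t w) + q (\<lambda>t. Y t w) \<partial>N) =
      (\<integral>w. p (\<lambda>t. Y t w) \<partial>N) + (\<integral>w. q (\<lambda>t. Y t w) \<partial>N)"
    using prob_space.trig_integrable[OF Y(1) pq(1) Y(2)] prob_space.trig_integrable[OF Y(1) pq(2) Y(2)]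
    by (rule Bochner_Integration.integral_add)
  show ?case unfolding A B by (rule tendsto_add[OF add.IH])
qed

section \<open>Weak convergence of continuous processes\<close>

text \<open>Every path is continuous, not almost every path. Continuous functionals of the process
  are then measurable for \<open>M\<close> itself, and the completion stays out of the limit
  arguments.\<close>

definition cont_process :: "'w measure \<Rightarrow> 'a::metric_space set \<Rightarrow> ('a \<Rightarrow> 'w \<Rightarrow> real) \<Rightarrow> bool" where
  "cont_process M D X \<longleftrightarrow> (\<forall>t\<in>D. X t \<in> borel_measurable M) \<and> (\<forall>w\<in>space M. continuous_on D (\<lambda>t. X t w))"

lemma cont_process_borel: "cont_process M D X \<Longrightarrow> t \<in> D \<Longrightarrow> X t \<in> borel_measurable M"
  by (simp add: cont_process_def)

lemma cont_process_continuous: "cont_process M D X \<Longrightarrow> w \<in> space M \<Longrightarrow> continuous_on D (\<lambda>t. X t w)"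
  by (simp add: cont_process_def)

lemma trig_approx_pointwise:
  fixes D :: "'a::euclidean_space set"
  assumes D: "compact D" and f: "continuous_on D f"
    and near: "\<And>K e. equicont_family D K \<Longrightarrow> e > 0 \<Longrightarrow> \<forall>\<^sub>F k in sequentially. \<forall>f\<in>K. \<bar>p k f - \<Phi> f\<bar> < e"
  shows "(\<lambda>k. p k f) \<longlonglongrightarrow> (\<Phi> f :: real)"
proof (rule tendstoI)
  fix e :: real assume "e > 0"
  from near[OF equicont_family_singleton[OF D f] this]
  show "\<forall>\<^sub>F k in sequentially. dist (p k f) (\<Phi> f) < e" by (simp add: dist_real_def)
qed

text \<open>A pointwise limit of trigonometric polynomials, each measurable because it reads
  finitely many values of the path. No sigma-algebra on the path space enters.\<close>

lemma cont_fun_measurable: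
  fixes D :: "'a::euclidean_space set"
  assumes D: "compact D" and \<Phi>: "cont_fun D \<Phi>" and X: "cont_process M D X"
  shows "(\<lambda>w. \<Phi> (\<lambda>t. X t w)) \<in> borel_measurable M"
proof -
  obtain S p where p: "\<And>k. finite (S k)" "\<And>k. S k \<subseteq> D" "\<And>k. p k \<in> trig (S k)"
    and near: "\<And>K e. equicont_family D K \<Longrightarrow> e > 0 \<Longrightarrow> \<forall>\<^sub>F k in sequentially. \<forall>f\<in>K. \<bar>p k f - \<Phi> f\<bar> < e"
    by (rule trig_approx[OF D \<Phi>]) (assumption | rule that)+
  show ?thesis
  proof (rule borel_measurable_LIMSEQ_real)
    fix w assume "w \<in> space M"
    then show "(\<lambda>k. p k (\<lambda>t. X t w)) \<longlonglongrightarrow> \<Phi> (\<lambda>t. X t w)"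
      by (intro trig_approx_pointwise[OF D _ near] cont_process_continuous[OF X])
  next
    fix k
    show "(\<lambda>w. p k (\<lambda>t. X t w)) \<in> borel_measurable M"
      by (rule trig_measurable[OF p(3)], rule cont_process_borel[OF X], rule subsetD[OF p(2)])
  qed
qed

lemma (in prob_space) cont_fun_integrable:
  fixes D :: "'b::euclidean_space set"
  assumes D: "compact D" and \<Phi>: "cont_fun D \<Phi>" and X: "cont_process M D X"
    and C: "\<And>f. continuous_on D f \<Longrightarrow> \<bar>\<Phi> f\<bar> \<le> C"
  shows "integrable M (\<lambda>w. \<Phi> (\<lambda>t. X t w))"
proof (rule integrable_const_bound[where B = C])
  show "AE w in M. norm (\<Phi> (\<lambda>t. X t w)) \<le> C"
    unfolding real_norm_def by (rule AE_I2, rule C, rule cont_process_continuous[OF X])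
qed (rule cont_fun_measurable[OF D \<Phi> X])

lemma (in prob_space) trig_approx_expectation:
  fixes D :: "'b::euclidean_space set"
  assumes D: "compact D" and \<Phi>: "cont_fun D \<Phi>" and X: "cont_process M D X"
    and S: "\<And>k. S k \<subseteq> D" and p: "\<And>k. p k \<in> trig (S k)"
    and bound: "\<And>k f. \<bar>p k f\<bar> \<le> C"
    and near: "\<And>K e. equicont_family D K \<Longrightarrow> e > 0 \<Longrightarrow> \<forall>\<^sub>F k in sequentially. \<forall>f\<in>K. \<bar>p k f - \<Phi> f\<bar> < e"
  shows "(\<lambda>k. expectation (\<lambda>w. p k (\<lambda>t. X t w))) \<longlonglongrightarrow> expectation (\<lambda>w. \<Phi> (\<lambda>t. X t w))"
proof (rule integral_dominated_convergence[where w = "\<lambda>_. C"])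
  show "(\<lambda>w. \<Phi> (\<lambda>t. X t w)) \<in> borel_measurable M" by (rule cont_fun_measurable[OF D \<Phi> X])
  show "(\<lambda>w. p k (\<lambda>t. X t w)) \<in> borel_measurable M" for k
    by (rule trig_measurable[OF p], rule cont_process_borel[OF X], rule subsetD[OF S])
  show "AE w in M. (\<lambda>k. p k (\<lambda>t. X t w)) \<longlonglongrightarrow> \<Phi> (\<lambda>t. X t w)"
    by (rule AE_I2, rule trig_approx_pointwise[OF D _ near], rule cont_process_continuous[OF X])
  show "AE w in M. norm (p k (\<lambda>t. X t w)) \<le> C" for k
    unfolding real_norm_def by (rule AE_I2, rule bound)
qed simp

text \<open>With constant sequences \<open>trig_conv\<close> is equality of finite-dimensional
  distributions. The approximants then have equal expectations for each \<open>k\<close>, and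
  dominated convergence in \<open>k\<close> carries the equality over to
  \<open>\<Phi>\<close>.\<close>

lemma same_law_expectation:
  fixes D :: "'a::euclidean_space set"
  assumes D: "compact D" and \<Phi>: "cont_fun D \<Phi>" and C: "\<And>f. continuous_on D f \<Longrightarrow> \<bar>\<Phi> f\<bar> \<le> C"
    and M: "prob_space M" and X: "cont_process M D X"
    and N: "prob_space N" and Y: "cont_process N D Y"
    and conv: "trig_conv (\<lambda>_. M) D (\<lambda>_. X) N Y"
  shows "(\<integral>w. \<Phi> (\<lambda>t. X t w) \<partial>M) = (\<integral>w. \<Phi> (\<lambda>t. Y t w) \<partial>N)"
proof -
  obtain S p where p: "\<And>k. finite (S k)" "\<And>k. S k \<subseteq> D" "\<And>k. p k \<in> trig (S k)"
    and bound': "\<forall>C. (\<forall>f. continuous_on D f \<longrightarrow> \<bar>\<Phi> f\<bar> \<le> C) \<longrightarrow> (\<forall>k f. \<bar>p k f\<bar> \<le> C + 1)"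
    and near: "\<And>K e. equicont_family D K \<Longrightarrow> e > 0 \<Longrightarrow> \<forall>\<^sub>F k in sequentially. \<forall>f\<in>K. \<bar>p k f - \<Phi> f\<bar> < e"
    by (rule trig_approx[OF D \<Phi>]) (assumption | rule that)+
  note bound = bound'[rule_format]
  have "(\<integral>w. p k (\<lambda>t. X t w) \<partial>M) = (\<integral>w. p k (\<lambda>t. Y t w) \<partial>N)" for k
  proof -
    have "(\<lambda>n::nat. \<integral>w. p k (\<lambda>t. X t w) \<partial>M) \<longlonglongrightarrow> (\<integral>w. p k (\<lambda>t. Y t w) \<partial>N)"
      by (rule trig_conv_tendsto[OF M _ N _ p(1,2) conv p(3)])
        (rule cont_process_borel[OF X] cont_process_borel[OF Y], rule subsetD[OF p(2)], assumption)+
    then show ?thesis by (simp only: LIMSEQ_const_iff)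
  qed
  note eq = this
  have "(\<lambda>k. \<integral>w. p k (\<lambda>t. X t w) \<partial>M) \<longlonglongrightarrow> (\<integral>w. \<Phi> (\<lambda>t. X t w) \<partial>M)"
    by (rule prob_space.trig_approx_expectation[OF M D \<Phi> X p(2,3) bound[OF C] near])
  moreover have "(\<lambda>k. \<integral>w. p k (\<lambda>t. X t w) \<partial>M) \<longlonglongrightarrow> (\<integral>w. \<Phi> (\<lambda>t. Y t w) \<partial>N)"
    unfolding eq by (rule prob_space.trig_approx_expectation[OF N D \<Phi> Y p(2,3) bound[OF C] near])
  ultimately show ?thesis by (rule LIMSEQ_unique)
qed

text \<open>One family \<open>K\<close> serves all \<open>n\<close>. The event \<open>A\<close> need
  only be contained in the set where the path lies in \<open>K\<close>, so the measurability of that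
  set is never at issue.\<close>

definition uniformly_tight ::
  "(nat \<Rightarrow> 'w measure) \<Rightarrow> 'a::metric_space set \<Rightarrow> (nat \<Rightarrow> 'a \<Rightarrow> 'w \<Rightarrow> real) \<Rightarrow> bool" where
  "uniformly_tight M D X \<longleftrightarrow> (\<forall>\<epsilon>>0. \<exists>K. equicont_family D K \<and>
     (\<forall>n. \<exists>A\<in>sets (M n). 1 - \<epsilon> \<le> measure (M n) A \<and> (\<forall>w\<in>A. (\<lambda>t. X n t w) \<in> K)))"

text \<open>Three-term estimate through \<open>p k\<close>: it is uniformly close to
  \<open>\<Phi>\<close> on the family \<open>K\<close>, and off \<open>K\<close> the difference is
  at most \<open>2 * C + 1\<close>, which is harmless on an event of small probability. It is here
  that a bound on the approximants over all paths matters, since \<open>K\<close> says nothing about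
  the exceptional ones.\<close>

lemma weak_convergence:
  fixes D :: "'a::euclidean_space set"
  assumes D: "compact D" and \<Phi>: "cont_fun D \<Phi>" and C: "\<And>f. continuous_on D f \<Longrightarrow> \<bar>\<Phi> f\<bar> \<le> C"
    and M: "\<And>n. prob_space (M n)" and X: "\<And>n. cont_process (M n) D (X n)"
    and N: "prob_space N" and Y: "cont_process N D Y"
    and conv: "trig_conv M D X N Y" and tight: "uniformly_tight M D X"
  shows "(\<lambda>n. \<integral>w. \<Phi> (\<lambda>t. X n t w) \<partial>M n) \<longlonglongrightarrow> (\<integral>w. \<Phi> (\<lambda>t. Y t w) \<partial>N)"
proof (rule tendstoI)
  fix e :: real assume e: "e > 0"
  have C0: "C \<ge> 0" using C[of "\<lambda>_. 0"] by simp
  obtain S p where p: "\<And>k. finite (S k)" "\<And>k. S k \<subseteq> D" "\<And>k. p k \<in> trig (S k)"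
    and bound': "\<forall>C. (\<forall>f. continuous_on D f \<longrightarrow> \<bar>\<Phi> f\<bar> \<le> C) \<longrightarrow> (\<forall>k f. \<bar>p k f\<bar> \<le> C + 1)"
    and near: "\<And>K e. equicont_family D K \<Longrightarrow> e > 0 \<Longrightarrow> \<forall>\<^sub>F k in sequentially. \<forall>f\<in>K. \<bar>p k f - \<Phi> f\<bar> < e"
    by (rule trig_approx[OF D \<Phi>]) (assumption | rule that)+
  note bound = bound'[rule_format]
  \<comment> \<open>The error budget: \<open>2 * \<delta>\<close> for \<open>\<Phi>\<close> against
    \<open>p k\<close> under \<open>M n\<close>, \<open>\<delta>\<close> for the convergence of the
    expectation of \<open>p k\<close>, and \<open>\<delta>\<close> for \<open>p k\<close> against
    \<open>\<Phi>\<close> under \<open>N\<close>. The choice of \<open>\<epsilon>\<close> makes the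
    exceptional part \<open>(2 * C + 1) * \<epsilon>\<close> equal to
    \<open>\<delta>\<close>.\<close>
  define \<delta> where "\<delta> = e / 4"
  define \<epsilon> where "\<epsilon> = \<delta> / (2 * C + 1)"
  have pos: "\<delta> > 0" "\<epsilon> > 0" using e C0 by (simp_all add: \<delta>_def \<epsilon>_def)
  obtain K where K: "equicont_family D K"
    and A: "\<And>n. \<exists>A\<in>sets (M n). 1 - \<epsilon> \<le> measure (M n) A \<and> (\<forall>w\<in>A. (\<lambda>t. X n t w) \<in> K)"
    using tight pos(2) unfolding uniformly_tight_def by meson
  have "\<forall>\<^sub>F k in sequentially. (\<forall>f\<in>K. \<bar>p k f - \<Phi> f\<bar> < \<delta>) \<and>
      dist (\<integral>w. p k (\<lambda>t. Y t w) \<partial>N) (\<integral>w. \<Phi> (\<lambda>t. Y t w) \<partial>N) < \<delta>"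
    by (rule eventually_conj[OF near[OF K pos(1)]
          tendstoD[OF prob_space.trig_approx_expectation[OF N D \<Phi> Y p(2,3) bound[OF C] near] pos(1)]])
  from eventually_happens'[OF sequentially_bot this] obtain k where k: "\<forall>f\<in>K. \<bar>p k f - \<Phi> f\<bar> < \<delta>"
      "dist (\<integral>w. p k (\<lambda>t. Y t w) \<partial>N) (\<integral>w. \<Phi> (\<lambda>t. Y t w) \<partial>N) < \<delta>"
    by (elim exE conjE) simp_all
  have approx: "\<bar>(\<integral>w. p k (\<lambda>t. X n t w) \<partial>M n) - (\<integral>w. \<Phi> (\<lambda>t. X n t w) \<partial>M n)\<bar> \<le> 2 * \<delta>" for n
  proof -
    interpret prob_space "M n" by (rule M)
    obtain A where A: "A \<in> events" "1 - \<epsilon> \<le> prob A" "\<forall>w\<in>A. (\<lambda>t. X n t w) \<in> K"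
      using A[of n] by (elim bexE conjE)
    have ip: "integrable (M n) (\<lambda>w. p k (\<lambda>t. X n t w))"
      by (rule trig_integrable[OF p(3)], rule cont_process_borel[OF X], rule subsetD[OF p(2)])
    have i\<Phi>: "integrable (M n) (\<lambda>w. \<Phi> (\<lambda>t. X n t w))"
      by (rule cont_fun_integrable[OF D \<Phi> X C])
    have "\<bar>(\<integral>w. p k (\<lambda>t. X n t w) \<partial>M n) - (\<integral>w. \<Phi> (\<lambda>t. X n t w) \<partial>M n)\<bar> =
        \<bar>\<integral>w. p k (\<lambda>t. X n t w) - \<Phi> (\<lambda>t. X n t w) \<partial>M n\<bar>"
      by (subst Bochner_Integration.integral_diff[OF ip i\<Phi>]) (rule refl)
    also have "\<dots> \<le> (\<integral>w. \<bar>p k (\<lambda>t. X n t w) - \<Phi> (\<lambda>t. X n t w)\<bar> \<partial>M n)"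
      by (rule integral_abs_bound)
    also have "\<dots> \<le> (\<integral>w. \<delta> + (2 * C + 1) * indicator (space (M n) - A) w \<partial>M n)"
    proof (rule integral_mono)
      fix w assume w: "w \<in> space (M n)"
      show "\<bar>p k (\<lambda>t. X n t w) - \<Phi> (\<lambda>t. X n t w)\<bar> \<le> \<delta> + (2 * C + 1) * indicator (space (M n) - A) w"
      proof (cases "w \<in> A")
        case True
        have "\<bar>p k (\<lambda>t. X n t w) - \<Phi> (\<lambda>t. X n t w)\<bar> < \<delta>"
          by (rule bspec[OF k(1)], rule bspec[OF A(3) True])
        then show ?thesis using True by simp
      next
        case False
        have "\<bar>p k (\<lambda>t. X n t w)\<bar> \<le> C + 1" by (rule bound[OF C])
        moreover have "\<bar>\<Phi> (\<lambda>t. X n t w)\<bar> \<le> C" by (rule C, rule cont_process_continuous[OF X w])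
        ultimately have "\<bar>p k (\<lambda>t. X n t w) - \<Phi> (\<lambda>t. X n t w)\<bar> \<le> 2 * C + 1" by linarith
        then show ?thesis using False w pos by simp
      qed
    qed (use A(1) in \<open>auto intro!: Bochner_Integration.integrable_add integrable_real_mult_indicator
           Bochner_Integration.integrable_diff[OF ip i\<Phi>] simp: less_top[symmetric]\<close>)
    also have "\<dots> = \<delta> + (2 * C + 1) * (1 - prob A)"
      using A(1) by (subst Bochner_Integration.integral_add)
        (auto simp: prob_space prob_compl less_top[symmetric] intro!: integrable_real_mult_indicator)
    also have "\<dots> \<le> \<delta> + (2 * C + 1) * \<epsilon>"
      using A(2) C0 by (intro add_left_mono mult_left_mono) auto
    also have "\<dots> = 2 * \<delta>" using C0 by (simp add: \<epsilon>_def)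
    finally show ?thesis .
  qed
  have "(\<lambda>n. \<integral>w. p k (\<lambda>t. X n t w) \<partial>M n) \<longlonglongrightarrow> (\<integral>w. p k (\<lambda>t. Y t w) \<partial>N)"
    by (rule trig_conv_tendsto[OF M _ N _ p(1,2) conv p(3)])
      (rule cont_process_borel[OF X] cont_process_borel[OF Y], rule subsetD[OF p(2)], assumption)+
  from tendstoD[OF this pos(1)]
  show "\<forall>\<^sub>F n in sequentially. dist (\<integral>w. \<Phi> (\<lambda>t. X n t w) \<partial>M n) (\<integral>w. \<Phi> (\<lambda>t. Y t w) \<partial>N) < e"
  proof (rule eventually_mono)
    fix n
    assume "dist (\<integral>w. p k (\<lambda>t. X n t w) \<partial>M n) (\<integral>w. p k (\<lambda>t. Y t w) \<partial>N) < \<delta>"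
    with approx[of n] k(2) show "dist (\<integral>w. \<Phi> (\<lambda>t. X n t w) \<partial>M n) (\<integral>w. \<Phi> (\<lambda>t. Y t w) \<partial>N) < e"
      unfolding dist_real_def \<delta>_def by linarith
  qed
qed

text \<open>Bounded continuous ramps converge to the indicator of the open half-line. They vanish at
  \<open>c\<close> itself, so the limit is correct even if \<open>c\<close> is an atom.\<close>

lemma same_law_tail:
  fixes D :: "'a::euclidean_space set"
  assumes D: "compact D" and \<Phi>: "cont_fun D \<Phi>"
    and M: "prob_space M" and X: "cont_process M D X"
    and N: "prob_space N" and Y: "cont_process N D Y"
    and conv: "trig_conv (\<lambda>_. M) D (\<lambda>_. X) N Y"
  shows "measure M {w \<in> space M. c < \<Phi> (\<lambda>t. X t w)} = measure N {w \<in> space N. c < \<Phi> (\<lambda>t. Y t w)}"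
proof -
  define h where "h m y = min 1 (max 0 (real m * (y - c)))" for m y
  have h_cont: "continuous_on UNIV (h m)" for m unfolding h_def by (intro continuous_intros)
  have h_bound: "\<bar>h m y\<bar> \<le> 1" for m y by (simp add: h_def)
  have h_lim: "(\<lambda>m. h m y) \<longlonglongrightarrow> indicator {c<..} y" for y
  proof (cases "c < y")
    case True
    then obtain m0 :: nat where m0: "1 / (y - c) < real m0" using reals_Archimedean2 by blast
    have "h m y = 1" if "m \<ge> m0" for m
    proof -
      have "1 / (y - c) \<le> real m" using m0 that by linarith
      then have "1 \<le> real m * (y - c)" using True by (simp add: field_simps)
      then show ?thesis by (simp add: h_def)
    qed
    then have "\<forall>\<^sub>F m in sequentially. h m y = indicator {c<..} y"
      using True unfolding eventually_sequentially by auto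
    then show ?thesis by (rule tendsto_eventually)
  next
    case False
    have "h m y = 0" for m
    proof -
      have "real m * (y - c) \<le> 0" using False by (intro mult_nonneg_nonpos) auto
      then show ?thesis by (simp add: h_def)
    qed
    then show ?thesis using False by simp
  qed
  have lim: "(\<lambda>m. \<integral>w. h m (\<Phi> (\<lambda>t. Z t w)) \<partial>P) \<longlonglongrightarrow> measure P {w \<in> space P. c < \<Phi> (\<lambda>t. Z t w)}"
    if P: "prob_space P" and Z: "cont_process P D Z" for P :: "'x measure" and Z
  proof -
    interpret P: prob_space P by (rule P)
    have [measurable]: "(\<lambda>w. \<Phi> (\<lambda>t. Z t w)) \<in> borel_measurable P" by (rule cont_fun_measurable[OF D \<Phi> Z])
    have "(\<lambda>m. \<integral>w. h m (\<Phi> (\<lambda>t. Z t w)) \<partial>P) \<longlonglongrightarrow> (\<integral>w. indicator {c<..} (\<Phi> (\<lambda>t. Z t w)) \<partial>P)"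
    proof (rule integral_dominated_convergence[where w = "\<lambda>_. 1"])
      show "(\<lambda>w. h m (\<Phi> (\<lambda>t. Z t w))) \<in> borel_measurable P" for m
        unfolding h_def by measurable
    qed (use h_lim h_bound in auto)
    also have "(\<integral>w. indicator {c<..} (\<Phi> (\<lambda>t. Z t w)) \<partial>P) =
        (\<integral>w. indicator {w \<in> space P. c < \<Phi> (\<lambda>t. Z t w)} w \<partial>P)"
      by (rule Bochner_Integration.integral_cong) (auto simp: indicator_def)
    also have "\<dots> = measure P {w \<in> space P. c < \<Phi> (\<lambda>t. Z t w)}" by simp
    finally show ?thesis .
  qed
  have "(\<lambda>m. \<integral>w. h m (\<Phi> (\<lambda>t. X t w)) \<partial>M) = (\<lambda>m. \<integral>w. h m (\<Phi> (\<lambda>t. Y t w)) \<partial>N)"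
    by (rule ext, rule same_law_expectation[OF D cont_fun_compose[OF \<Phi> h_cont] h_bound M X N Y conv])
  with lim[OF M X] lim[OF N Y] show ?thesis by (simp only:) (rule LIMSEQ_unique)
qed

text \<open>Weak convergence of the real laws of \<open>\<Phi>\<close>, read at a continuity point
  of the limiting distribution function; the assumption on \<open>x\<close> says that
  \<open>x\<close> is no atom.\<close>

lemma tail_convergence:
  fixes D :: "'a::euclidean_space set"
  assumes D: "compact D" and \<Phi>: "cont_fun D \<Phi>"
    and M: "\<And>n. prob_space (M n)" and X: "\<And>n. cont_process (M n) D (X n)"
    and N: "prob_space N" and Y: "cont_process N D Y"
    and conv: "trig_conv M D X N Y" and tight: "uniformly_tight M D X"
    and x: "measure N {w \<in> space N. \<Phi> (\<lambda>t. Y t w) = x} = 0"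
  shows "(\<lambda>n. measure (M n) {w \<in> space (M n). x < \<Phi> (\<lambda>t. X n t w)}) \<longlonglongrightarrow>
     measure N {w \<in> space N. x < \<Phi> (\<lambda>t. Y t w)}"
proof -
  define \<mu> where "\<mu> n = distr (M n) borel (\<lambda>w. \<Phi> (\<lambda>t. X n t w))" for n
  define \<nu> where "\<nu> = distr N borel (\<lambda>w. \<Phi> (\<lambda>t. Y t w))"
  note mX = cont_fun_measurable[OF D \<Phi> X]
  note mY = cont_fun_measurable[OF D \<Phi> Y]
  have \<mu>: "real_distribution (\<mu> n)" for n unfolding \<mu>_def
    by (rule prob_space.real_distribution_distr[OF M mX])
  have \<nu>: "real_distribution \<nu>" unfolding \<nu>_def
    by (rule prob_space.real_distribution_distr[OF N mY])
  have "weak_conv_m \<mu> \<nu>"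
  proof (rule integral_bdd_continuous_conv_imp_weak_conv[OF \<mu> \<nu>])
    fix f :: "real \<Rightarrow> real" assume f: "\<And>x. isCont f x" and b: "\<And>x. \<bar>f x\<bar> \<le> 1"
    have fc: "continuous_on UNIV f" using f by (simp add: continuous_on_eq_continuous_at)
    then have fm: "f \<in> borel_measurable borel" by (rule borel_measurable_continuous_onI)
    show "(\<lambda>n. integral\<^sup>L (\<mu> n) f) \<longlonglongrightarrow> integral\<^sup>L \<nu> f"
      unfolding \<mu>_def \<nu>_def integral_distr[OF mX fm] integral_distr[OF mY fm]
      by (rule weak_convergence[OF D cont_fun_compose[OF \<Phi> fc] b M X N Y conv tight])
  qed
  moreover have "isCont (cdf \<nu>) x"
  proof -
    interpret \<nu>: real_distribution \<nu> by (rule \<nu>)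
    have "measure \<nu> {x} = measure N ((\<lambda>w. \<Phi> (\<lambda>t. Y t w)) -` {x} \<inter> space N)"
      unfolding \<nu>_def by (rule measure_distr[OF mY]) simp
    also have "(\<lambda>w. \<Phi> (\<lambda>t. Y t w)) -` {x} \<inter> space N = {w \<in> space N. \<Phi> (\<lambda>t. Y t w) = x}" by auto
    finally show ?thesis using x by (simp add: \<nu>.isCont_cdf)
  qed
  ultimately have "(\<lambda>n. cdf (\<mu> n) x) \<longlonglongrightarrow> cdf \<nu> x"
    by (simp add: weak_conv_m_def weak_conv_def)
  then have "(\<lambda>n. 1 - cdf (\<mu> n) x) \<longlonglongrightarrow> 1 - cdf \<nu> x" by (intro tendsto_intros)
  moreover have tail: "1 - cdf (distr P borel Z) x = measure P {w \<in> space P. x < Z w}"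
    if P: "prob_space P" and Z: "Z \<in> borel_measurable P" for P :: "'x measure" and Z
  proof -
    interpret P: prob_space P by (rule P)
    have "cdf (distr P borel Z) x = measure P (Z -` {..x} \<inter> space P)"
      unfolding cdf_def by (rule measure_distr[OF Z]) simp
    also have "\<dots> = 1 - measure P (space P - (Z -` {..x} \<inter> space P))"
      using P.prob_compl[of "Z -` {..x} \<inter> space P"] Z by simp
    also have "space P - (Z -` {..x} \<inter> space P) = {w \<in> space P. x < Z w}" by auto
    finally show ?thesis by simp
  qed
  ultimately show ?thesis
    unfolding \<mu>_def \<nu>_def tail[OF M mX] tail[OF N mY] by simp
qed

section \<open>Chaining\<close>

lemma card_int_box:
  "finite {z :: int^'n. \<forall>i. \<bar>z $ i\<bar> \<le> m}" "card {z :: int^'n. \<forall>i. \<bar>z $ i\<bar> \<le> m} \<le> (2 * nat m + 1) ^ CARD('n)"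
proof -
  have eq: "{z :: int^'n. \<forall>i. \<bar>z $ i\<bar> \<le> m} = vec_lambda ` (\<Pi>\<^sub>E i\<in>UNIV. {-m..m})"
  proof (intro equalityI subsetI)
    fix z :: "int^'n" assume "z \<in> {z. \<forall>i. \<bar>z $ i\<bar> \<le> m}"
    then have "(\<lambda>i. z $ i) \<in> (\<Pi>\<^sub>E i\<in>UNIV. {-m..m})" by (auto simp: abs_le_iff minus_le_iff)
    then show "z \<in> vec_lambda ` (\<Pi>\<^sub>E i\<in>UNIV. {-m..m})" by (metis imageI vec_lambda_eta)
  qed (auto simp: PiE_iff abs_le_iff minus_le_iff)
  have fin: "finite (\<Pi>\<^sub>E i\<in>(UNIV :: 'n set). {-m..m})" by (intro finite_PiE) auto
  then show "finite {z :: int^'n. \<forall>i. \<bar>z $ i\<bar> \<le> m}" unfolding eq by simp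
  have "card {z :: int^'n. \<forall>i. \<bar>z $ i\<bar> \<le> m} \<le> card (\<Pi>\<^sub>E i\<in>(UNIV :: 'n set). {-m..m})"
    unfolding eq by (rule card_image_le[OF fin])
  also have "\<dots> = nat (2 * m + 1) ^ CARD('n)" by (simp add: card_PiE)
  also have "\<dots> \<le> (2 * nat m + 1) ^ CARD('n)" by (intro power_mono) auto
  finally show "card {z :: int^'n. \<forall>i. \<bar>z $ i\<bar> \<le> m} \<le> (2 * nat m + 1) ^ CARD('n)" .
qed

text \<open>A grid of mesh \<open>r * (1/2) ^ k\<close> divided by the dimension, so that the l1
  norm bounds the diameter of a cell by \<open>r * (1/2) ^ k\<close>. One point of \<open>D\<close>
  is picked in each occupied cell, because grid points themselves may lie outside \<open>D\<close>,
  where the process is not controlled.\<close>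

lemma finite_net:
  fixes D :: "(real^'n) set"
  assumes r: "r > 0" and D: "\<And>t. t \<in> D \<Longrightarrow> norm t \<le> r"
  shows "\<exists>S\<subseteq>D. finite S \<and> real (card S) \<le> (4 * real CARD('n) * 2 ^ k) ^ CARD('n) \<and>
    (\<forall>t\<in>D. \<exists>s\<in>S. dist t s \<le> r * (1/2) ^ k)"
proof -
  define h where "h = r * (1/2) ^ k / real CARD('n)"
  have h: "h > 0" using r by (simp add: h_def)
  define cell :: "real^'n \<Rightarrow> int^'n" where "cell t = (\<chi> i. \<lfloor>t $ i / h\<rfloor>)" for t
  define m where "m = int (CARD('n) * 2 ^ k)"
  have range: "cell ` D \<subseteq> {z. \<forall>i. \<bar>z $ i\<bar> \<le> m}"
  proof clarify
    fix t i assume "t \<in> D"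
    then have "\<bar>t $ i\<bar> \<le> r" using D component_le_norm_cart order_trans by blast
    then have "\<bar>t $ i / h\<bar> \<le> r / h" using h by (simp add: divide_right_mono)
    also have "r / h = of_int m" using r by (simp add: h_def m_def power_divide field_simps)
    finally have "- of_int m \<le> t $ i / h" "t $ i / h \<le> of_int m" by linarith+
    then have "- m \<le> \<lfloor>t $ i / h\<rfloor>" "\<lfloor>t $ i / h\<rfloor> \<le> m" by (simp_all add: le_floor_iff floor_le_iff)
    then show "\<bar>cell t $ i\<bar> \<le> m" by (simp add: cell_def abs_le_iff)
  qed
  have fin: "finite (cell ` D)" by (rule finite_subset[OF range card_int_box(1)])
  define c where "c z = (SOME s. s \<in> D \<and> cell s = z)" for z
  have c: "c z \<in> D \<and> cell (c z) = z" if "z \<in> cell ` D" for z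
    unfolding c_def by (rule someI_ex) (use that in auto)
  have close: "dist t s \<le> r * (1/2) ^ k" if "cell t = cell s" for t s
  proof -
    have "\<bar>(t - s) $ i\<bar> \<le> h" for i
    proof -
      have "\<lfloor>t $ i / h\<rfloor> = \<lfloor>s $ i / h\<rfloor>" using that by (simp add: cell_def vec_eq_iff)
      then have "\<bar>t $ i / h - s $ i / h\<bar> \<le> 1" by linarith
      then show ?thesis using h by (simp add: diff_divide_distrib[symmetric] field_simps abs_le_iff)
    qed
    then have "(\<Sum>i\<in>UNIV. \<bar>(t - s) $ i\<bar>) \<le> (\<Sum>i\<in>(UNIV::'n set). h)" by (intro sum_mono)
    then have "norm (t - s) \<le> (\<Sum>i\<in>(UNIV::'n set). h)" using norm_le_l1_cart order_trans by blast
    then show ?thesis by (simp add: dist_norm h_def)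
  qed
  show ?thesis
  proof (intro exI[of _ "c ` cell ` D"] conjI ballI)
    show "c ` cell ` D \<subseteq> D" using c by blast
    show "finite (c ` cell ` D)" using fin by simp
    have "card (c ` cell ` D) \<le> card (cell ` D)" by (rule card_image_le[OF fin])
    also have "\<dots> \<le> card {z :: int^'n. \<forall>i. \<bar>z $ i\<bar> \<le> m}" by (rule card_mono[OF card_int_box(1) range])
    also have "\<dots> \<le> (2 * nat m + 1) ^ CARD('n)" by (rule card_int_box)
    also have "\<dots> \<le> (4 * CARD('n) * 2 ^ k) ^ CARD('n)"
    proof (intro power_mono)
      have "1 \<le> CARD('n) * 2 ^ k" by (simp add: Suc_leI)
      then show "2 * nat m + 1 \<le> 4 * CARD('n) * 2 ^ k" unfolding m_def nat_int by linarith
    qed simp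
    finally have "real (card (c ` cell ` D)) \<le> real ((4 * CARD('n) * 2 ^ k) ^ CARD('n))" by (rule of_nat_mono)
    then show "real (card (c ` cell ` D)) \<le> (4 * real CARD('n) * 2 ^ k) ^ CARD('n)" by simp
    show "\<exists>s\<in>c ` cell ` D. dist t s \<le> r * (1/2) ^ k" if "t \<in> D" for t
      using c[of "cell t"] that by (intro bexI[of _ "c (cell t)"] close) auto
  qed
qed

text \<open>From the differentiated geometric series. The linear factor will come from the logarithm
  of the number of links at level \<open>j\<close>.\<close>

lemma summable_linear_geometric:
  fixes \<theta> :: real
  assumes "0 < \<theta>" "\<theta> < 1"
  shows "summable (\<lambda>j. \<theta> ^ j * (a + b * real j))"
proof -
  have "summable (\<lambda>j. diffs (\<lambda>_. 1) j * \<theta> ^ j)"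
    by (rule termdiff_converges[where K = 1]) (use assms in \<open>auto intro!: summable_geometric simp: power_one_right\<close>)
  then have "summable (\<lambda>j. (real j + 1) * \<theta> ^ j)" by (simp add: diffs_def add.commute)
  moreover have "summable (\<lambda>j. \<theta> ^ j)" using assms by (intro summable_geometric) auto
  ultimately have "summable (\<lambda>j. b * ((real j + 1) * \<theta> ^ j) + (a - b) * \<theta> ^ j)"
    by (intro summable_add summable_mult)
  moreover have "b * ((real j + 1) * \<theta> ^ j) + (a - b) * \<theta> ^ j = \<theta> ^ j * (a + b * real j)" for j
    by (simp add: algebra_simps)
  ultimately show ?thesis by simp
qed

text \<open>The deterministic half of chaining. A point is reached from its net point of level
  \<open>k\<close> through links of the levels from \<open>k\<close> on, and continuity of
  \<open>f\<close> closes the telescoping sum. The factor 3 counts the chain of \<open>t\<close>,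
  the chain of \<open>s\<close>, and the link between their net points of level \<open>k\<close>.
  Links between successive levels have length at most \<open>3/2 * r * (1/2) ^ j\<close>, the cross
  link at most \<open>3 * r * (1/2) ^ k\<close>, which explains the range in
  \<open>incr\<close>.\<close>

lemma chaining_modulus:
  fixes D :: "'a::metric_space set" and f :: "'a \<Rightarrow> real"
  assumes S: "\<And>k. S k \<subseteq> D" and net: "\<And>k t. t \<in> D \<Longrightarrow> \<exists>s\<in>S k. dist t s \<le> r * (1/2) ^ k"
    and r: "r > 0" and \<beta>: "summable \<beta>" "\<And>j. 0 \<le> \<beta> j" and f: "continuous_on D f" and b: "0 \<le> b"
    and incr: "\<And>j p q. p \<in> S j \<union> S (Suc j) \<Longrightarrow> q \<in> S j \<union> S (Suc j) \<Longrightarrow> dist p q \<le> 3 * r * (1/2) ^ j \<Longrightarrow>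
      \<bar>f p - f q\<bar> \<le> \<beta> j * (1 + b)"
    and t: "t \<in> D" and s: "s \<in> D" and ts: "dist t s \<le> r * (1/2) ^ k"
  shows "\<bar>f t - f s\<bar> \<le> 3 * (\<Sum>j. \<beta> (j + k)) * (1 + b)"
proof -
  define \<pi> where "\<pi> t k = (SOME s. s \<in> S k \<and> dist t s \<le> r * (1/2) ^ k)" for t k
  have \<pi>: "\<pi> t k \<in> S k" "dist t (\<pi> t k) \<le> r * (1/2) ^ k" if "t \<in> D" for t k
  proof -
    have "\<pi> t k \<in> S k \<and> dist t (\<pi> t k) \<le> r * (1/2) ^ k"
      unfolding \<pi>_def by (rule someI_ex) (use net[OF that] in blast)
    then show "\<pi> t k \<in> S k" "dist t (\<pi> t k) \<le> r * (1/2) ^ k" by simp_all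
  qed
  have sk: "summable (\<lambda>j. \<beta> (j + k))" using \<beta>(1) by (simp add: summable_iff_shift)
  have tail: "\<bar>f t - f (\<pi> t k)\<bar> \<le> (\<Sum>j. \<beta> (j + k)) * (1 + b)" if t: "t \<in> D" for t
  proof -
    have step: "\<bar>f (\<pi> t (Suc j)) - f (\<pi> t j)\<bar> \<le> \<beta> j * (1 + b)" for j
    proof (rule incr)
      have "dist (\<pi> t (Suc j)) (\<pi> t j) \<le> dist t (\<pi> t (Suc j)) + dist t (\<pi> t j)"
        by (metis dist_commute dist_triangle)
      also have "\<dots> \<le> r * (1/2) ^ Suc j + r * (1/2) ^ j" by (intro add_mono \<pi> t)
      also have "\<dots> \<le> 3 * r * (1/2) ^ j" using r by simp
      finally show "dist (\<pi> t (Suc j)) (\<pi> t j) \<le> 3 * r * (1/2) ^ j" .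
    qed (use \<pi> t in auto)
    have part: "\<bar>f (\<pi> t (m + k)) - f (\<pi> t k)\<bar> \<le> (\<Sum>j<m. \<beta> (j + k)) * (1 + b)" for m
    proof (induction m)
      case (Suc m)
      have "\<bar>f (\<pi> t (Suc m + k)) - f (\<pi> t k)\<bar> \<le>
          \<bar>f (\<pi> t (Suc (m + k))) - f (\<pi> t (m + k))\<bar> + \<bar>f (\<pi> t (m + k)) - f (\<pi> t k)\<bar>" by simp
      also have "\<dots> \<le> \<beta> (m + k) * (1 + b) + (\<Sum>j<m. \<beta> (j + k)) * (1 + b)"
        by (intro add_mono step Suc.IH)
      finally show ?case by (simp add: algebra_simps)
    qed simp
    have bnd: "\<bar>f (\<pi> t (m + k)) - f (\<pi> t k)\<bar> \<le> (\<Sum>j. \<beta> (j + k)) * (1 + b)" for m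
      by (rule order_trans[OF part mult_right_mono[OF sum_le_suminf[OF sk]]]) (use \<beta>(2) b in auto)
    have "(\<lambda>m. dist t (\<pi> t (m + k))) \<longlonglongrightarrow> 0"
    proof (rule tendsto_sandwich[OF _ _ tendsto_const])
      have "(\<lambda>m. r * (1/2) ^ (m + k)) \<longlonglongrightarrow> r * 0"
        by (intro tendsto_intros LIMSEQ_ignore_initial_segment LIMSEQ_power_zero) simp
      then show "(\<lambda>m. r * (1/2) ^ (m + k)) \<longlonglongrightarrow> 0" by simp
    qed (use \<pi>(2)[OF t] in auto)
    then have "(\<lambda>m. \<pi> t (m + k)) \<longlonglongrightarrow> t" by (subst tendsto_dist_iff) (simp add: dist_commute)
    moreover have "\<forall>\<^sub>F m in sequentially. \<pi> t (m + k) \<in> D"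
      by (intro always_eventually allI, rule subsetD[OF S \<pi>(1)[OF t]])
    ultimately have "(\<lambda>m. f (\<pi> t (m + k))) \<longlonglongrightarrow> f t"
      by (rule continuous_on_tendsto_compose[OF f _ t])
    then have "(\<lambda>m. \<bar>f (\<pi> t (m + k)) - f (\<pi> t k)\<bar>) \<longlonglongrightarrow> \<bar>f t - f (\<pi> t k)\<bar>"
      by (intro tendsto_intros)
    then show ?thesis by (rule LIMSEQ_le_const2) (use bnd in simp)
  qed
  have "\<bar>f (\<pi> t k) - f (\<pi> s k)\<bar> \<le> \<beta> k * (1 + b)"
  proof (rule incr)
    have "dist (\<pi> t k) (\<pi> s k) \<le> dist t (\<pi> t k) + dist t s + dist s (\<pi> s k)"
      using dist_triangle[of "\<pi> t k" "\<pi> s k" t] dist_triangle[of t "\<pi> s k" s] by (simp add: dist_commute)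
    also have "\<dots> \<le> r * (1/2) ^ k + r * (1/2) ^ k + r * (1/2) ^ k" by (intro add_mono \<pi> t s ts)
    finally show "dist (\<pi> t k) (\<pi> s k) \<le> 3 * r * (1/2) ^ k" by simp
  qed (use \<pi> t s in auto)
  also have "\<beta> k * (1 + b) \<le> (\<Sum>j. \<beta> (j + k)) * (1 + b)"
  proof (rule mult_right_mono)
    show "\<beta> k \<le> (\<Sum>j. \<beta> (j + k))"
      using sum_le_suminf[OF sk, of "{0}"] \<beta>(2) by simp
  qed (use b in simp)
  finally show ?thesis using tail[OF t] tail[OF s] by (simp add: abs_le_iff)
qed

text \<open>The constants \<open>A k\<close> depend neither on the process nor on \<open>l\<close>: taking \<open>l\<close> large gives all
  exponential moments of the supremum, and the convergence of \<open>A k\<close> to zero gives tightness.\<close>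

lemma gaussian_modulus:
  fixes D :: "(real^'n) set"
  assumes r: "r > 0" and D: "\<And>t. t \<in> D \<Longrightarrow> norm t \<le> r" and G: "G > 0" and \<nu>: "\<nu> > 0"
  obtains A :: "nat \<Rightarrow> real" where "A \<longlonglongrightarrow> 0" "\<And>k. 0 \<le> A k"
    "\<And>(M :: 'w measure) X l b. prob_space M \<Longrightarrow> (\<And>t. t \<in> D \<Longrightarrow> X t \<in> borel_measurable M) \<Longrightarrow>
       (\<And>w. w \<in> space M \<Longrightarrow> continuous_on D (\<lambda>t. X t w)) \<Longrightarrow>
       (\<And>t s. t \<in> D \<Longrightarrow> s \<in> D \<Longrightarrow> centered_normal M (\<lambda>w. X t w - X s w)) \<Longrightarrow>
       (\<And>t s. t \<in> D \<Longrightarrow> s \<in> D \<Longrightarrow> integral\<^sup>L M (\<lambda>w. (X t w - X s w)\<^sup>2) \<le> G * norm (t - s) powr \<nu>) \<Longrightarrow>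
       1 \<le> l \<Longrightarrow> 0 \<le> b \<Longrightarrow>
       \<exists>E\<in>sets M. 1 - 4 * exp (l\<^sup>2 / 2) * exp (- l * b) \<le> measure M E \<and>
         (\<forall>w\<in>E. \<forall>k. \<forall>t\<in>D. \<forall>s\<in>D. dist t s \<le> r * (1/2) ^ k \<longrightarrow> \<bar>X t w - X s w\<bar> \<le> A k * (1 + b))"
proof -
  define n where "n = CARD('n)"
  have n: "n \<ge> 1" by (simp add: n_def Suc_leI)
  have "\<forall>k. \<exists>S\<subseteq>D. finite S \<and> real (card S) \<le> (4 * real n * 2 ^ k) ^ n \<and>
    (\<forall>t\<in>D. \<exists>s\<in>S. dist t s \<le> r * (1/2) ^ k)"
    unfolding n_def using finite_net[OF r D] by blast
  then obtain S where S: "\<And>k. S k \<subseteq> D" "\<And>k. finite (S k)" "\<And>k. real (card (S k)) \<le> (4 * real n * 2 ^ k) ^ n"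
    and net: "\<And>k t. t \<in> D \<Longrightarrow> \<exists>s\<in>S k. dist t s \<le> r * (1/2) ^ k"
    by metis
  define U where "U j = S j \<union> S (Suc j)" for j
  \<comment> \<open>\<open>c * (2 ^ n) ^ j\<close> bounds the number of points in two successive
    nets: it is twice the bound for the finer net \<open>S (Suc j)\<close>.\<close>
  define c where "c = 2 * (4 * real n * 2) ^ n"
  have c: "c \<ge> 1"
  proof -
    have "1 \<le> (4 * real n * 2) ^ n" using n by (intro one_le_power) simp
    then show ?thesis by (simp add: c_def)
  qed
  have U: "U j \<subseteq> D" "finite (U j)" "real (card (U j)) \<le> c * (2 ^ n) ^ j" for j
  proof -
    show "U j \<subseteq> D" "finite (U j)" using S by (auto simp: U_def)
    have "real (card (U j)) \<le> real (card (S j)) + real (card (S (Suc j)))"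
      unfolding U_def using card_Un_le[of "S j" "S (Suc j)"] by linarith
    also have "\<dots> \<le> (4 * real n * 2 ^ Suc j) ^ n + (4 * real n * 2 ^ Suc j) ^ n"
      by (intro add_mono order_trans[OF S(3)] power_mono mult_left_mono order_refl) auto
    also have "\<dots> = c * (2 ^ n) ^ j"
      by (simp add: c_def power_mult_distrib mult.commute flip: power_mult)
    finally show "real (card (U j)) \<le> c * (2 ^ n) ^ j" .
  qed
  \<comment> \<open>At distance \<open>3 * r * (1/2) ^ j\<close> the standard deviation of an
    increment is at most \<open>\<kappa> * \<theta> ^ j\<close>; this is the content of
    \<open>sd\<close>.\<close>
  define \<theta> where "\<theta> = (1/2 :: real) powr (\<nu> / 2)"
  have \<theta>: "0 < \<theta>" "\<theta> < 1" using \<nu> by (simp_all add: \<theta>_def powr01_less_one)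
  define \<kappa> where "\<kappa> = sqrt (G * (3 * r) powr \<nu>)"
  have \<kappa>: "\<kappa> > 0" using G r by (simp add: \<kappa>_def)
  have sd: "G * (3 * r * (1/2) ^ j) powr \<nu> = (\<kappa> * \<theta> ^ j)\<^sup>2" for j
  proof -
    have "(\<theta> ^ j)\<^sup>2 = \<theta> powr real (2 * j)"
      by (subst powr_realpow[OF \<theta>(1)]) (simp add: power_mult power_mult_distrib mult.commute[of 2] flip: power_mult)
    also have "\<dots> = (1/2) powr (\<nu> / 2 * real (2 * j))" unfolding \<theta>_def by (rule powr_powr)
    also have "\<nu> / 2 * real (2 * j) = real j * \<nu>" by simp
    also have "(1/2) powr (real j * \<nu>) = ((1/2) powr real j) powr \<nu>" by (rule powr_powr[symmetric])
    also have "(1/2) powr real j = (1/2 :: real) ^ j" by (rule powr_realpow) simp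
    finally have "(\<theta> ^ j)\<^sup>2 = ((1/2) ^ j) powr \<nu>" .
    then show ?thesis using G r by (simp add: power_mult_distrib \<kappa>_def powr_mult)
  qed
  \<comment> \<open>The extra height \<open>lev j\<close> outweighs the number of pairs at level
    \<open>j\<close>: its coefficients are the logarithms for which the bound on that number, times
    \<open>exp (- lev j)\<close>, equals \<open>(1/2) ^ j\<close>. It grows only linearly, so
    \<open>\<theta> ^ j * lev j\<close> remains summable.\<close>
  define a where "a = 2 * ln c"
  define d where "d = 2 * n * ln 2 + ln 2"
  define lev where "lev j = a + d * real j" for j
  have a0: "a \<ge> 0" "d \<ge> 0" using c by (simp_all add: a_def d_def)
  have lev0: "lev j \<ge> 0" for j using a0 by (simp add: lev_def)
  have lev: "(c * (2 ^ n) ^ j)\<^sup>2 * exp (- lev j) = (1/2) ^ j" for j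
  proof -
    have "lev j = ln ((c * (2 ^ n) ^ j)\<^sup>2 * 2 ^ j)"
      using c by (simp add: lev_def a_def d_def ln_mult ln_realpow algebra_simps)
    moreover have "(c * (2 ^ n) ^ j)\<^sup>2 * 2 ^ j > 0" using c by simp
    ultimately have e: "exp (lev j) = (c * (2 ^ n) ^ j)\<^sup>2 * 2 ^ j" by (simp only: exp_ln)
    have "(c * (2 ^ n) ^ j)\<^sup>2 \<noteq> 0" using c by simp
    then show ?thesis unfolding exp_minus e by (simp add: field_simps power_divide)
  qed
  define \<beta> where "\<beta> j = \<theta> ^ j * (\<kappa> * (1 + a) + \<kappa> * d * real j)" for j
  have \<beta>: "summable \<beta>" unfolding \<beta>_def by (rule summable_linear_geometric[OF \<theta>])
  have \<beta>0: "0 \<le> \<beta> j" for j using \<theta> \<kappa> a0 by (simp add: \<beta>_def)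
  have \<beta>_le: "\<kappa> * \<theta> ^ j * (b + lev j) \<le> \<beta> j * (1 + b)" if "b \<ge> 0" for b :: real and j
  proof -
    \<comment> \<open>Separating \<open>b\<close> from \<open>j\<close> as factors keeps the final
      constants \<open>A k\<close> independent of \<open>b\<close>.\<close>
    have "b + lev j \<le> (1 + lev j) * (1 + b)" using that lev0[of j] by (simp add: algebra_simps)
    then have "\<kappa> * \<theta> ^ j * (b + lev j) \<le> \<kappa> * \<theta> ^ j * ((1 + lev j) * (1 + b))"
      using \<kappa> \<theta> by (intro mult_left_mono) auto
    also have "\<dots> = \<beta> j * (1 + b)" by (simp add: \<beta>_def lev_def algebra_simps)
    finally show ?thesis .
  qed
  define A where "A k = 3 * (\<Sum>j. \<beta> (j + k))" for k
  show ?thesis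
  proof (rule that)
    have "(\<lambda>k. 3 * (\<Sum>j. \<beta> (j + k))) \<longlonglongrightarrow> 3 * 0"
      by (intro tendsto_mult_left suminf_exist_split2 \<beta>)
    then show "A \<longlonglongrightarrow> 0" by (simp add: A_def[abs_def])
    show "0 \<le> A k" for k
      unfolding A_def using \<beta> \<beta>0 by (simp add: suminf_nonneg summable_iff_shift)
    fix M :: "'w measure" and X and l b :: real
    assume "prob_space M" and X: "\<And>t. t \<in> D \<Longrightarrow> X t \<in> borel_measurable M"
      and cont: "\<And>w. w \<in> space M \<Longrightarrow> continuous_on D (\<lambda>t. X t w)"
      and normal: "\<And>t s. t \<in> D \<Longrightarrow> s \<in> D \<Longrightarrow> centered_normal M (\<lambda>w. X t w - X s w)"
      and var: "\<And>t s. t \<in> D \<Longrightarrow> s \<in> D \<Longrightarrow> integral\<^sup>L M (\<lambda>w. (X t w - X s w)\<^sup>2) \<le> G * norm (t - s) powr \<nu>"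
      and l: "1 \<le> l" and b: "0 \<le> b"
    interpret prob_space M by fact
    define P where "P j = {(p, q) \<in> U j \<times> U j. dist p q \<le> 3 * r * (1/2) ^ j}" for j
    have P: "finite (P j)" "real (card (P j)) \<le> (c * (2 ^ n) ^ j)\<^sup>2" for j
    proof -
      have sub: "P j \<subseteq> U j \<times> U j" by (auto simp: P_def)
      then show "finite (P j)" using U(2) by (meson finite_SigmaI finite_subset)
      have "card (P j) \<le> card (U j \<times> U j)" using sub U(2) by (intro card_mono) auto
      then have "real (card (P j)) \<le> real (card (U j)) * real (card (U j))"
        by (simp add: card_cartesian_product flip: of_nat_mult)
      also have "\<dots> \<le> (c * (2 ^ n) ^ j) * (c * (2 ^ n) ^ j)" by (intro mult_mono U(3)) (use c in auto)
      finally show "real (card (P j)) \<le> (c * (2 ^ n) ^ j)\<^sup>2" by (simp add: power2_eq_square)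
    qed
    define B where "B j = (\<Union>(p, q)\<in>P j. {w \<in> space M. \<bar>X p w - X q w\<bar> > \<kappa> * \<theta> ^ j * (b + lev j)})" for j
    have inc: "(\<lambda>w. X p w - X q w) \<in> borel_measurable M" if "(p, q) \<in> P j" for p q j
      using that U(1)[of j] X by (auto simp: P_def intro!: borel_measurable_diff)
    have B_sets: "B j \<in> events" for j
      unfolding B_def
    proof (rule sets.finite_UN[OF P(1)], clarsimp)
      fix p q assume "(p, q) \<in> P j"
      from inc[OF this] show "{w \<in> space M. \<kappa> * \<theta> ^ j * (b + lev j) < \<bar>X p w - X q w\<bar>} \<in> events"
        by measurable
    qed
    have one: "prob {w \<in> space M. \<bar>X p w - X q w\<bar> > \<kappa> * \<theta> ^ j * (b + lev j)} \<le>
        2 * exp (l\<^sup>2 / 2) * exp (- l * b) * exp (- lev j)" if pq: "(p, q) \<in> P j" for p q j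
    proof -
      have pD: "p \<in> D" "q \<in> D" and d: "norm (p - q) \<le> 3 * r * (1/2) ^ j"
        using pq U(1)[of j] by (auto simp: P_def dist_norm)
      have "expectation (\<lambda>w. (X p w - X q w)\<^sup>2) \<le> G * norm (p - q) powr \<nu>" by (rule var[OF pD])
      also have "\<dots> \<le> G * (3 * r * (1/2) ^ j) powr \<nu>"
        using G \<nu> d by (intro mult_left_mono powr_mono2) auto
      also have "\<dots> = (\<kappa> * \<theta> ^ j)\<^sup>2" by (rule sd)
      finally have "prob {w \<in> space M. \<bar>X p w - X q w\<bar> > \<kappa> * \<theta> ^ j * (b + lev j)} \<le>
          2 * exp (l\<^sup>2 / 2) * exp (- l * (b + lev j))"
        by (intro centered_normal_tail[OF normal[OF pD]]) (use \<kappa> \<theta> l in auto)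
      also have "\<dots> \<le> 2 * exp (l\<^sup>2 / 2) * (exp (- l * b) * exp (- lev j))"
      proof (rule mult_left_mono)
        \<comment> \<open>Since \<open>l\<close> is at least 1, \<open>exp (- l * lev j)\<close> is
          at most \<open>exp (- lev j)\<close>; this is how the levels can be chosen independently
          of \<open>l\<close>.\<close>
        have "1 * lev j \<le> l * lev j" using l lev0 by (intro mult_right_mono)
        then show "exp (- l * (b + lev j)) \<le> exp (- l * b) * exp (- lev j)"
          by (simp add: algebra_simps flip: exp_add)
      qed simp
      finally show ?thesis by (simp add: mult.assoc)
    qed
    have PB: "prob (B j) \<le> 2 * exp (l\<^sup>2 / 2) * exp (- l * b) * (1/2) ^ j" for j
    proof -
      have "prob (B j) \<le> (\<Sum>pq\<in>P j. prob (case pq of (p, q) \<Rightarrow> {w \<in> space M. \<bar>X p w - X q w\<bar> > \<kappa> * \<theta> ^ j * (b + lev j)}))"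
        unfolding B_def
      proof (rule finite_measure_subadditive_finite[OF P(1)], clarsimp)
        fix p q assume "(p, q) \<in> P j"
        from inc[OF this] show "{w \<in> space M. \<kappa> * \<theta> ^ j * (b + lev j) < \<bar>X p w - X q w\<bar>} \<in> events"
          by measurable
      qed
      also have "\<dots> \<le> (\<Sum>pq\<in>P j. 2 * exp (l\<^sup>2 / 2) * exp (- l * b) * exp (- lev j))"
      proof (rule sum_mono)
        fix pq assume "pq \<in> P j"
        then show "prob (case pq of (p, q) \<Rightarrow> {w \<in> space M. \<bar>X p w - X q w\<bar> > \<kappa> * \<theta> ^ j * (b + lev j)}) \<le>
            2 * exp (l\<^sup>2 / 2) * exp (- l * b) * exp (- lev j)"
          using one[of "fst pq" "snd pq" j] by (simp add: case_prod_beta)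
      qed
      also have "\<dots> = real (card (P j)) * (2 * exp (l\<^sup>2 / 2) * exp (- l * b) * exp (- lev j))" by simp
      also have "\<dots> \<le> (c * (2 ^ n) ^ j)\<^sup>2 * (2 * exp (l\<^sup>2 / 2) * exp (- l * b) * exp (- lev j))"
        by (intro mult_right_mono P) auto
      also have "\<dots> = 2 * exp (l\<^sup>2 / 2) * exp (- l * b) * ((c * (2 ^ n) ^ j)\<^sup>2 * exp (- lev j))"
        by (simp only: mult_ac)
      finally show ?thesis unfolding lev .
    qed
    \<comment> \<open>Summing \<open>(1/2) ^ j\<close> over the levels turns the constant 2 of a
      single increment into 4.\<close>
    have geo: "(\<lambda>j. 2 * exp (l\<^sup>2 / 2) * exp (- l * b) * (1/2) ^ j) sums (2 * exp (l\<^sup>2 / 2) * exp (- l * b) * (1 / (1 - 1/2)))"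
      by (intro sums_mult geometric_sums) simp
    have sB: "summable (\<lambda>j. prob (B j))"
      by (rule summable_comparison_test_ev[OF _ sums_summable[OF geo]]) (use PB in auto)
    have "prob (\<Union>j. B j) \<le> (\<Sum>j. prob (B j))"
      by (rule finite_measure_subadditive_countably[OF _ sB]) (use B_sets in auto)
    also have "\<dots> \<le> (\<Sum>j. 2 * exp (l\<^sup>2 / 2) * exp (- l * b) * (1/2) ^ j)"
      by (rule suminf_le[OF PB sB sums_summable[OF geo]])
    also have "\<dots> = 4 * exp (l\<^sup>2 / 2) * exp (- l * b)" using sums_unique[OF geo] by simp
    finally have PUB: "prob (\<Union>j. B j) \<le> 4 * exp (l\<^sup>2 / 2) * exp (- l * b)" .
    show "\<exists>E\<in>sets M. 1 - 4 * exp (l\<^sup>2 / 2) * exp (- l * b) \<le> measure M E \<and>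
         (\<forall>w\<in>E. \<forall>k. \<forall>t\<in>D. \<forall>s\<in>D. dist t s \<le> r * (1/2) ^ k \<longrightarrow> \<bar>X t w - X s w\<bar> \<le> A k * (1 + b))"
    proof (intro bexI[of _ "space M - (\<Union>j. B j)"] conjI ballI allI impI)
      have UB: "(\<Union>j. B j) \<in> events" using B_sets by auto
      then show "space M - (\<Union>j. B j) \<in> events" by auto
      show "1 - 4 * exp (l\<^sup>2 / 2) * exp (- l * b) \<le> prob (space M - (\<Union>j. B j))"
        using PUB prob_compl[OF UB] by simp
      fix w k t s
      assume w: "w \<in> space M - (\<Union>j. B j)" and ts: "t \<in> D" "s \<in> D" "dist t s \<le> r * (1/2) ^ k"
      show "\<bar>X t w - X s w\<bar> \<le> A k * (1 + b)"
        unfolding A_def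
      proof (rule chaining_modulus[where S = S and D = D and f = "\<lambda>t. X t w", OF S(1) net r \<beta> \<beta>0 _ b _ ts])
        show "continuous_on D (\<lambda>t. X t w)" using cont w by simp
        fix j p q
        assume "p \<in> S j \<union> S (Suc j)" "q \<in> S j \<union> S (Suc j)" "dist p q \<le> 3 * r * (1/2) ^ j"
        then have "(p, q) \<in> P j" by (simp add: P_def U_def)
        then have "\<bar>X p w - X q w\<bar> \<le> \<kappa> * \<theta> ^ j * (b + lev j)"
          using w by (force simp: B_def not_less)
        also have "\<dots> \<le> \<beta> j * (1 + b)" by (rule \<beta>_le[OF b])
        finally show "\<bar>X p w - X q w\<bar> \<le> \<beta> j * (1 + b)" .
      qed
    qed
  qed
qed

section \<open>Laplace-type integrals\<close>

lemma integrable_exp_neg_half_abs: "integrable lborel (\<lambda>y::real. exp (- \<bar>y\<bar> / 2))"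
proof -
  have "has_bochner_integral lborel (\<lambda>x::real. x ^ 0 * exp (- x) * indicator {0 ..} x) (fact 0)"
    by (rule has_bochner_integral_I0i_power_exp_m')
  then have i: "integrable lborel (\<lambda>x::real. exp (- x) * indicator {0 ..} x)"
    by (auto simp: has_bochner_integral_iff)
  have "integrable lborel (\<lambda>x::real. exp (- (0 + (1/2) * x)) * indicator {0 ..} (0 + (1/2) * x))"
    by (rule lborel_integrable_real_affine[OF i]) simp
  moreover have "integrable lborel (\<lambda>x::real. exp (- (0 + (-1/2) * x)) * indicator {0 ..} (0 + (-1/2) * x))"
    by (rule lborel_integrable_real_affine[OF i]) simp
  ultimately have "integrable lborel (\<lambda>x::real. exp (- (0 + (1/2) * x)) * indicator {0 ..} (0 + (1/2) * x) +
      exp (- (0 + (-1/2) * x)) * indicator {0 ..} (0 + (-1/2) * x))"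
    by (rule Bochner_Integration.integrable_add)
  then show ?thesis
    by (rule Bochner_Integration.integrable_bound) (auto simp: indicator_def)
qed

lemma std_normal_density_affine:
  assumes "g > 0"
  shows "std_normal_density (g - y / g) = std_normal_density g * exp (y - y\<^sup>2 / (2 * g\<^sup>2))"
proof -
  have "- (g - y / g)\<^sup>2 / 2 = - g\<^sup>2 / 2 + (y - y\<^sup>2 / (2 * g\<^sup>2))"
    using assms by (simp add: power2_eq_square field_simps)
  then have "exp (- (g - y / g)\<^sup>2 / 2) = exp (- g\<^sup>2 / 2) * exp (y - y\<^sup>2 / (2 * g\<^sup>2))"
    by (simp only: exp_add)
  then show ?thesis by (simp add: std_normal_density_def)
qed

lemma integral_std_normal_affine:
  assumes "g > 0"
  shows "(\<integral>z. std_normal_density z * h z \<partial>lborel) =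
    std_normal_density g / g * (\<integral>y. exp (y - y\<^sup>2 / (2 * g\<^sup>2)) * h (g - y / g) \<partial>lborel)"
proof -
  have "(\<integral>z. std_normal_density z * h z \<partial>lborel) =
      \<bar>- 1 / g\<bar> *\<^sub>R (\<integral>y. std_normal_density (g + (- 1 / g) * y) * h (g + (- 1 / g) * y) \<partial>lborel)"
    using assms by (intro lborel_integral_real_affine) simp
  also have "\<dots> = 1 / g * (\<integral>y. std_normal_density g * (exp (y - y\<^sup>2 / (2 * g\<^sup>2)) * h (g - y / g)) \<partial>lborel)"
    using assms by (simp add: std_normal_density_affine mult.assoc)
  finally show ?thesis by simp
qed

text \<open>The weight is at most \<open>exp y\<close>. For \<open>y > 0\<close> the rate 3/2 leaves
  \<open>exp (- y / 2)\<close>, and for the other \<open>y\<close> the trivial bound 1 on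
  \<open>q n y\<close> leaves \<open>exp y\<close>; both lie below a multiple of
  \<open>exp (- \<bar>y\<bar> / 2)\<close>. The second claim is the source of the finiteness of the
  limiting constant.\<close>

lemma laplace_dominated_convergence:
  fixes q :: "nat \<Rightarrow> real \<Rightarrow> real"
  assumes g: "filterlim g at_top sequentially"
    and meas: "\<And>n. q n \<in> borel_measurable borel" "q0 \<in> borel_measurable borel"
    and lim: "AE y in lborel. (\<lambda>n. q n y) \<longlonglongrightarrow> q0 y"
    and q: "\<And>n y. 0 \<le> q n y" "\<And>n y. q n y \<le> 1" and C: "\<And>n y. y > 0 \<Longrightarrow> q n y \<le> C * exp (- 3 * y / 2)"
  shows "(\<lambda>n. \<integral>y. exp (y - y\<^sup>2 / (2 * (g n)\<^sup>2)) * q n y \<partial>lborel) \<longlonglongrightarrow> (\<integral>y. exp y * q0 y \<partial>lborel)"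
    and "integrable lborel (\<lambda>y. exp y * q0 y)"
proof -
  have C0: "0 \<le> C"
  proof (rule ccontr)
    assume "\<not> 0 \<le> C"
    then have "C * exp (- 3 * 1 / 2) < 0" by (simp add: mult_neg_pos)
    with C[of 1 0] q(1)[of 0 1] show False by simp
  qed
  have w: "integrable lborel (\<lambda>y::real. (1 + C) * exp (- \<bar>y\<bar> / 2))"
    by (intro integrable_mult_right integrable_exp_neg_half_abs)
  have bound: "norm (exp (y - y\<^sup>2 / (2 * (g n)\<^sup>2)) * q n y) \<le> (1 + C) * exp (- \<bar>y\<bar> / 2)" for n y
  proof -
    have "norm (exp (y - y\<^sup>2 / (2 * (g n)\<^sup>2)) * q n y) = exp (y - y\<^sup>2 / (2 * (g n)\<^sup>2)) * q n y"
      using q by (simp add: abs_mult)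
    also have "\<dots> \<le> exp y * q n y" using q by (intro mult_right_mono) auto
    also have "\<dots> \<le> (1 + C) * exp (- \<bar>y\<bar> / 2)"
    proof (cases "y > 0")
      case True
      then have "exp y * q n y \<le> exp y * (C * exp (- 3 * y / 2))" using C by (intro mult_left_mono) auto
      also have "\<dots> = C * exp (- \<bar>y\<bar> / 2)" using True by (simp add: exp_add[symmetric])
      also have "\<dots> \<le> (1 + C) * exp (- \<bar>y\<bar> / 2)" by (intro mult_right_mono) auto
      finally show ?thesis .
    next
      case False
      then have "exp y * q n y \<le> exp (- \<bar>y\<bar> / 2) * 1" using q by (intro mult_mono) auto
      also have "\<dots> \<le> (1 + C) * exp (- \<bar>y\<bar> / 2)" using C0 by (simp add: algebra_simps)
      finally show ?thesis .
    qed
    finally show ?thesis .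
  qed
  have conv: "(\<lambda>n. exp (y - y\<^sup>2 / (2 * (g n)\<^sup>2)) * q n y) \<longlonglongrightarrow> exp y * q0 y" if "(\<lambda>n. q n y) \<longlonglongrightarrow> q0 y" for y
  proof -
    have "filterlim (\<lambda>n. 2 * (g n)\<^sup>2) at_top sequentially"
      by (intro filterlim_tendsto_pos_mult_at_top[OF tendsto_const] filterlim_pow_at_top g) auto
    then have "(\<lambda>n. y\<^sup>2 / (2 * (g n)\<^sup>2)) \<longlonglongrightarrow> 0"
      by (intro real_tendsto_divide_at_top[OF tendsto_const])
    then have "(\<lambda>n. exp (y - y\<^sup>2 / (2 * (g n)\<^sup>2)) * q n y) \<longlonglongrightarrow> exp (y - 0) * q0 y"
      by (intro tendsto_intros that)
    then show ?thesis by simp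
  qed
  have lim': "AE y in lborel. (\<lambda>n. exp (y - y\<^sup>2 / (2 * (g n)\<^sup>2)) * q n y) \<longlonglongrightarrow> exp y * q0 y"
    using lim by eventually_elim (rule conv)
  have m: "(\<lambda>y. exp y * q0 y) \<in> borel_measurable lborel"
      "(\<lambda>y. exp (y - y\<^sup>2 / (2 * (g n)\<^sup>2)) * q n y) \<in> borel_measurable lborel" for n
    using meas by (auto intro!: borel_measurable_times)
  show "(\<lambda>n. \<integral>y. exp (y - y\<^sup>2 / (2 * (g n)\<^sup>2)) * q n y \<partial>lborel) \<longlonglongrightarrow> (\<integral>y. exp y * q0 y \<partial>lborel)"
    by (rule integral_dominated_convergence[OF m w lim']) (use bound in simp)
  show "integrable lborel (\<lambda>y. exp y * q0 y)"
    by (rule integrable_dominated_convergence[OF m w lim']) (use bound in simp)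
qed

lemma nn_integral_exp_lessThan: "(\<integral>\<^sup>+y. ennreal (exp y) * indicator {..<z} y \<partial>lborel) = ennreal (exp z)"
proof -
  have "(\<integral>\<^sup>+y. ennreal (exp y) * indicator {..<z} y \<partial>lborel) =
      ennreal \<bar>-1\<bar> * (\<integral>\<^sup>+x. ennreal (exp (z + (-1) * x)) * indicator {..<z} (z + (-1) * x) \<partial>lborel)"
    by (rule nn_integral_real_affine) auto
  \<comment> \<open>The reflected half-line is open at 0, while the gamma integral is over the
    closed one; the two differ in a null set.\<close>
  also have "\<dots> = (\<integral>\<^sup>+x. ennreal (exp z) * (ennreal (x ^ 0 * exp (- x)) * indicator {0..} x) \<partial>lborel)"
    by (simp, rule nn_integral_cong_AE, rule AE_mp[OF AE_lborel_singleton[of 0]])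
      (auto simp: indicator_def exp_diff exp_minus divide_inverse ennreal_mult)
  also have "\<dots> = ennreal (exp z) * (\<integral>\<^sup>+x. ennreal (x ^ 0 * exp (- x)) * indicator {0..} x \<partial>lborel)"
    by (rule nn_integral_cmult) auto
  also have "\<dots> = ennreal (exp z)" using nn_intergal_power_times_exp_Ici[of 0] by simp
  finally show ?thesis .
qed

text \<open>Tonelli applied to \<open>exp z\<close> as the integral of \<open>exp y\<close> over
  \<open>y < z\<close>. Nonnegative integrals come first, because the integrability of
  \<open>exp Z\<close> is itself deduced from that of the tail integral.\<close>

lemma (in prob_space) expectation_exp_layer_cake:
  assumes Z: "Z \<in> borel_measurable M"
    and int: "integrable lborel (\<lambda>y. exp y * prob {w \<in> space M. y < Z w})"
  shows "integrable M (\<lambda>w. exp (Z w))"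
    and "expectation (\<lambda>w. exp (Z w)) = (\<integral>y. exp y * prob {w \<in> space M. y < Z w} \<partial>lborel)"
proof -
  note Z[measurable]
  interpret pair_sigma_finite lborel M ..
  have "(\<integral>\<^sup>+y. ennreal (exp y * prob {w \<in> space M. y < Z w}) \<partial>lborel) =
      (\<integral>\<^sup>+y. (\<integral>\<^sup>+w. ennreal (exp y) * indicator {..<Z w} y \<partial>M) \<partial>lborel)"
  proof (rule nn_integral_cong)
    fix y :: real
    have "(\<integral>\<^sup>+w. ennreal (exp y) * indicator {..<Z w} y \<partial>M) =
        (\<integral>\<^sup>+w. ennreal (exp y) * indicator {w \<in> space M. y < Z w} w \<partial>M)"
      by (rule nn_integral_cong) (simp add: indicator_def)
    also have "\<dots> = ennreal (exp y) * emeasure M {w \<in> space M. y < Z w}"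
      by (rule nn_integral_cmult_indicator) measurable
    finally show "ennreal (exp y * prob {w \<in> space M. y < Z w}) = (\<integral>\<^sup>+w. ennreal (exp y) * indicator {..<Z w} y \<partial>M)"
      by (simp add: emeasure_eq_measure ennreal_mult)
  qed
  also have "\<dots> = (\<integral>\<^sup>+w. (\<integral>\<^sup>+y. ennreal (exp y) * indicator {..<Z w} y \<partial>lborel) \<partial>M)"
  proof (rule Fubini'[symmetric])
    have "(\<lambda>(y, w). ennreal (exp y) * indicator {p \<in> space (lborel \<Otimes>\<^sub>M M). fst p < Z (snd p)} (y, w)) \<in> borel_measurable (lborel \<Otimes>\<^sub>M M)"
      by measurable
    then show "(\<lambda>(y, w). ennreal (exp y) * indicator {..<Z w} y) \<in> borel_measurable (lborel \<Otimes>\<^sub>M M)"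
      by (rule measurable_cong[THEN iffD1, rotated]) (auto simp: indicator_def space_pair_measure)
  qed
  also have "\<dots> = (\<integral>\<^sup>+w. ennreal (exp (Z w)) \<partial>M)" by (simp add: nn_integral_exp_lessThan)
  finally have eq: "(\<integral>\<^sup>+w. ennreal (exp (Z w)) \<partial>M) = (\<integral>\<^sup>+y. ennreal (exp y * prob {w \<in> space M. y < Z w}) \<partial>lborel)" ..
  also have "\<dots> = ennreal (\<integral>y. exp y * prob {w \<in> space M. y < Z w} \<partial>lborel)"
    by (rule nn_integral_eq_integral[OF int]) simp
  finally have e: "(\<integral>\<^sup>+w. ennreal (exp (Z w)) \<partial>M) = ennreal (\<integral>y. exp y * prob {w \<in> space M. y < Z w} \<partial>lborel)" .
  show i: "integrable M (\<lambda>w. exp (Z w))"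
    by (rule integrableI_nonneg) (auto simp: e)
  have "0 \<le> (\<integral>y. exp y * prob {w \<in> space M. y < Z w} \<partial>lborel)" by (rule Bochner_Integration.integral_nonneg) simp
  with e show "expectation (\<lambda>w. exp (Z w)) = (\<integral>y. exp y * prob {w \<in> space M. y < Z w} \<partial>lborel)"
    using nn_integral_eq_integral[OF i] by simp
qed

text \<open>Mills' ratio, read off from the same integral representation as the main asymptotics.\<close>

lemma Psi_asymptotics:
  assumes g: "filterlim g at_top sequentially" "\<And>n. g n > 0"
  shows "(\<lambda>n. Psi (g n) / (std_normal_density (g n) / g n)) \<longlonglongrightarrow> 1"
proof -
  have Psi: "Psi x = (\<integral>z. std_normal_density z * indicator {x<..} z \<partial>lborel)" for x
  proof -
    have "Psi x = (\<integral>z. indicator {x<..} z \<partial>density lborel std_normal_density)" by (simp add: Psi_def)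
    also have "\<dots> = (\<integral>z. std_normal_density z * indicator {x<..} z \<partial>lborel)"
      by (subst integral_real_density) auto
    finally show ?thesis .
  qed
  have ratio: "Psi (g n) / (std_normal_density (g n) / g n) =
      (\<integral>y. exp (y - y\<^sup>2 / (2 * (g n)\<^sup>2)) * indicator {..<0} y \<partial>lborel)" for n
  proof -
    have "indicator {g n<..} (g n - y / g n) = (indicator {..<0} y :: real)" for y
      using g(2)[of n] by (auto simp: indicator_def field_simps)
    moreover have "std_normal_density (g n) > 0" by (simp add: normal_density_pos)
    ultimately show ?thesis
      using g(2)[of n] unfolding Psi integral_std_normal_affine[OF g(2)[of n]] by simp
  qed
  have "(\<lambda>n. \<integral>y. exp (y - y\<^sup>2 / (2 * (g n)\<^sup>2)) * indicator {..<0} y \<partial>lborel) \<longlonglongrightarrow>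
      (\<integral>y. exp y * indicator {..<0} y \<partial>lborel)"
    by (rule laplace_dominated_convergence[OF g(1), where C = 0]) (auto simp: indicator_def)
  also have "(\<integral>y. exp y * indicator {..<0} y \<partial>lborel) = (1::real)"
    using nn_integral_exp_lessThan[of 0]
    by (subst integral_eq_nn_integral) (auto simp: ennreal_mult ennreal_indicator)
  finally show ?thesis unfolding ratio .
qed

section \<open>Second moments and Gaussian fields\<close>

definition sq_int :: "'w measure \<Rightarrow> ('w \<Rightarrow> real) \<Rightarrow> bool" where
  "sq_int M f \<longleftrightarrow> f \<in> borel_measurable M \<and> integrable M (\<lambda>w. (f w)\<^sup>2)"

lemma sq_int_integrable: "sq_int M f \<Longrightarrow> integrable M (\<lambda>w. (f w)\<^sup>2)"
  by (simp add: sq_int_def)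

lemma sq_int_mult:
  assumes "sq_int M f" "sq_int M h"
  shows "integrable M (\<lambda>w. f w * h w)"
proof (rule Bochner_Integration.integrable_bound)
  show "integrable M (\<lambda>w. (f w)\<^sup>2 + (h w)\<^sup>2)" using assms by (simp add: sq_int_def)
  show "(\<lambda>w. f w * h w) \<in> borel_measurable M" using assms by (auto simp: sq_int_def)
  have "\<bar>x * y\<bar> \<le> x\<^sup>2 + y\<^sup>2" for x y :: real
    using sum_squares_bound[of x y] sum_squares_bound[of x "- y"] zero_le_power2[of x] zero_le_power2[of y]
    by (simp add: abs_le_iff)
  then show "AE w in M. norm (f w * h w) \<le> norm ((f w)\<^sup>2 + (h w)\<^sup>2)" by simp
qed

lemma sq_int_add: "sq_int M f \<Longrightarrow> sq_int M h \<Longrightarrow> sq_int M (\<lambda>w. f w + h w)"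
  using sq_int_mult[of M f h] by (auto simp: sq_int_def power2_sum mult.assoc)

lemma sq_int_cmult: "sq_int M f \<Longrightarrow> sq_int M (\<lambda>w. c * f w)"
  by (auto simp: sq_int_def power_mult_distrib)

lemma sq_int_diff: "sq_int M f \<Longrightarrow> sq_int M h \<Longrightarrow> sq_int M (\<lambda>w. f w - h w)"
  using sq_int_add[of M f "\<lambda>w. (-1) * h w"] sq_int_cmult[of M h "-1"] by simp

lemma sq_int_sum: "(\<And>s. s \<in> S \<Longrightarrow> sq_int M (f s)) \<Longrightarrow> sq_int M (\<lambda>w. \<Sum>s\<in>S. f s w)"
proof (induction S rule: infinite_finite_induct)
  case (insert x F)
  then show ?case by (simp add: sq_int_add)
qed (simp_all add: sq_int_def)

text \<open>\<open>\<bar>x\<^sup>2 - y\<^sup>2\<bar>\<close> factors as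
  \<open>\<bar>x - y\<bar> * \<bar>x + y\<bar>\<close>, and the arithmetic-geometric mean inequality
  with free weight \<open>\<kappa>\<close> splits the product. The result plays the role of
  Cauchy-Schwarz while staying linear in the second moments.\<close>

lemma second_moment_diff:
  assumes A: "sq_int M A" and B: "sq_int M B" and \<kappa>: "\<kappa> > 0"
  shows "\<bar>(\<integral>w. (A w)\<^sup>2 \<partial>M) - (\<integral>w. (B w)\<^sup>2 \<partial>M)\<bar> \<le>
    \<kappa> / 2 * (\<integral>w. (A w - B w)\<^sup>2 \<partial>M) + ((\<integral>w. (A w)\<^sup>2 \<partial>M) + (\<integral>w. (B w)\<^sup>2 \<partial>M)) / \<kappa>"
proof -
  have pt: "\<bar>x\<^sup>2 - y\<^sup>2\<bar> \<le> \<kappa> / 2 * (x - y)\<^sup>2 + (x\<^sup>2 + y\<^sup>2) / \<kappa>" for x y :: real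
  proof -
    have "0 \<le> (\<kappa> * \<bar>x - y\<bar> - \<bar>x + y\<bar>)\<^sup>2" by simp
    then have "2 * \<kappa> * (\<bar>x - y\<bar> * \<bar>x + y\<bar>) \<le> \<kappa>\<^sup>2 * (x - y)\<^sup>2 + (x + y)\<^sup>2"
      by (simp add: power2_diff power_mult_distrib mult_ac)
    also have "(x + y)\<^sup>2 \<le> 2 * (x\<^sup>2 + y\<^sup>2)"
      using sum_squares_bound[of x y] by (simp add: power2_sum)
    finally have "2 * \<kappa> * (\<bar>x - y\<bar> * \<bar>x + y\<bar>) \<le> \<kappa>\<^sup>2 * (x - y)\<^sup>2 + 2 * (x\<^sup>2 + y\<^sup>2)" by simp
    moreover have "\<bar>x - y\<bar> * \<bar>x + y\<bar> = \<bar>x\<^sup>2 - y\<^sup>2\<bar>"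
      by (simp add: abs_mult[symmetric] power2_eq_square algebra_simps)
    ultimately show ?thesis using \<kappa> by (simp add: field_simps power2_eq_square)
  qed
  note i = sq_int_integrable[OF A] sq_int_integrable[OF B] sq_int_integrable[OF sq_int_diff[OF A B]]
  have "\<bar>(\<integral>w. (A w)\<^sup>2 \<partial>M) - (\<integral>w. (B w)\<^sup>2 \<partial>M)\<bar> = \<bar>\<integral>w. (A w)\<^sup>2 - (B w)\<^sup>2 \<partial>M\<bar>"
    by (subst Bochner_Integration.integral_diff[OF i(1,2)]) (rule refl)
  also have "\<dots> \<le> (\<integral>w. \<bar>(A w)\<^sup>2 - (B w)\<^sup>2\<bar> \<partial>M)" by (rule integral_abs_bound)
  also have "\<dots> \<le> (\<integral>w. \<kappa> / 2 * (A w - B w)\<^sup>2 + ((A w)\<^sup>2 + (B w)\<^sup>2) / \<kappa> \<partial>M)"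
    by (rule integral_mono) (use i pt in \<open>auto intro!: Bochner_Integration.integrable_add Bochner_Integration.integrable_diff integrable_divide\<close>)
  also have "\<dots> = \<kappa> / 2 * (\<integral>w. (A w - B w)\<^sup>2 \<partial>M) + ((\<integral>w. (A w)\<^sup>2 \<partial>M) + (\<integral>w. (B w)\<^sup>2 \<partial>M)) / \<kappa>"
    using i by simp
  finally show ?thesis .
qed

text \<open>Turns the inequality with free weight into a modulus of continuity:
  \<open>\<kappa>\<close> is taken large enough for the term with \<open>1 / \<kappa>\<close>, then
  the distance small enough for the other. The radius depends on \<open>C\<close>, \<open>G\<close>,
  \<open>\<nu>\<close> and \<open>e\<close> alone, so it is common to all functions that share these
  constants.\<close>

lemma second_moment_modulus:
  fixes C G \<nu> e :: real
  assumes "C \<ge> 0" "G \<ge> 0" "\<nu> > 0" "e > 0"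
  shows "\<exists>r>0. \<forall>x y v \<delta>. x \<le> C \<longrightarrow> y \<le> C \<longrightarrow> v \<le> G * \<delta> powr \<nu> \<longrightarrow> 0 \<le> \<delta> \<longrightarrow> \<delta> < r \<longrightarrow>
    (\<forall>\<kappa>>0. \<bar>x - y\<bar> \<le> \<kappa> / 2 * v + (x + y) / \<kappa>) \<longrightarrow> \<bar>x - y\<bar> < e"
proof -
  define \<kappa> where "\<kappa> = 4 * C / e + 1"
  have \<kappa>: "\<kappa> > 0" using assms by (simp add: \<kappa>_def add_nonneg_pos)
  have 1: "(C + C) / \<kappa> < e / 2"
  proof -
    have "4 * C < e * \<kappa>" using assms by (simp add: \<kappa>_def field_simps)
    then show ?thesis using \<kappa> by (simp add: field_simps)
  qed
  define \<epsilon> where "\<epsilon> = e / (\<kappa> * (G + 1))"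
  have \<epsilon>: "\<epsilon> > 0" using assms \<kappa> by (simp add: \<epsilon>_def)
  show ?thesis
  proof (intro exI[of _ "\<epsilon> powr (1 / \<nu>)"] conjI allI impI)
    fix x y v \<delta> :: real
    assume x: "x \<le> C" "y \<le> C" and v: "v \<le> G * \<delta> powr \<nu>" and \<delta>: "0 \<le> \<delta>" "\<delta> < \<epsilon> powr (1 / \<nu>)"
      and le: "\<forall>\<kappa>>0. \<bar>x - y\<bar> \<le> \<kappa> / 2 * v + (x + y) / \<kappa>"
    have "\<delta> powr \<nu> \<le> (\<epsilon> powr (1 / \<nu>)) powr \<nu>" using \<delta> assms by (intro powr_mono2) auto
    also have "\<dots> = \<epsilon>" using assms \<epsilon> by (simp add: powr_powr)
    finally have "G * \<delta> powr \<nu> \<le> (G + 1) * \<epsilon>" using assms \<epsilon> by (intro mult_mono) auto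
    with v have "v \<le> (G + 1) * \<epsilon>" by simp
    then have "\<kappa> / 2 * v \<le> \<kappa> / 2 * ((G + 1) * \<epsilon>)" using \<kappa> by (intro mult_left_mono) auto
    also have "\<dots> = \<kappa> * (G + 1) * \<epsilon> / 2" by simp
    also have "\<kappa> * (G + 1) * \<epsilon> = e" using assms \<kappa> by (simp add: \<epsilon>_def)
    finally have "\<kappa> / 2 * v \<le> e / 2" .
    moreover have "(x + y) / \<kappa> \<le> (C + C) / \<kappa>" using x \<kappa> by (intro divide_right_mono) auto
    ultimately show "\<bar>x - y\<bar> < e" using le[rule_format, OF \<kappa>] 1 by linarith
  qed (use \<epsilon> in simp)
qed

text \<open>Pythagoras: \<open>\<rho> * Z\<close> is the orthogonal projection of \<open>W\<close>
  on the unit vector \<open>Z\<close>.\<close>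

lemma residual_second_moment:
  assumes W: "sq_int M W" and Z: "sq_int M Z" and "(\<integral>w. (Z w)\<^sup>2 \<partial>M) = 1" and "(\<integral>w. W w * Z w \<partial>M) = \<rho>"
  shows "(\<integral>w. (W w - \<rho> * Z w)\<^sup>2 \<partial>M) = (\<integral>w. (W w)\<^sup>2 \<partial>M) - \<rho>\<^sup>2"
proof -
  note i = sq_int_integrable[OF W] sq_int_integrable[OF Z] sq_int_mult[OF W Z]
  have "(\<integral>w. (W w - \<rho> * Z w)\<^sup>2 \<partial>M) = (\<integral>w. (W w)\<^sup>2 - 2 * \<rho> * (W w * Z w) + \<rho>\<^sup>2 * (Z w)\<^sup>2 \<partial>M)"
    by (rule Bochner_Integration.integral_cong) (simp_all add: power2_eq_square algebra_simps)
  also have "\<dots> = (\<integral>w. (W w)\<^sup>2 \<partial>M) - 2 * \<rho> * (\<integral>w. W w * Z w \<partial>M) + \<rho>\<^sup>2 * (\<integral>w. (Z w)\<^sup>2 \<partial>M)"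
    using i by simp
  finally show ?thesis using assms(3,4) by (simp add: power2_eq_square)
qed

lemma integral_mult_polarization:
  assumes W: "sq_int M W" and Z: "sq_int M Z"
  shows "(\<integral>w. W w * Z w \<partial>M) = ((\<integral>w. (W w)\<^sup>2 \<partial>M) + (\<integral>w. (Z w)\<^sup>2 \<partial>M) - (\<integral>w. (W w - Z w)\<^sup>2 \<partial>M)) / 2"
proof -
  note i = sq_int_integrable[OF W] sq_int_integrable[OF Z] sq_int_integrable[OF sq_int_diff[OF W Z]]
  have "(\<integral>w. W w * Z w \<partial>M) = (\<integral>w. ((W w)\<^sup>2 + (Z w)\<^sup>2 - (W w - Z w)\<^sup>2) / 2 \<partial>M)"
    by (rule Bochner_Integration.integral_cong) (simp_all add: power2_eq_square algebra_simps)
  also have "\<dots> = ((\<integral>w. (W w)\<^sup>2 \<partial>M) + (\<integral>w. (Z w)\<^sup>2 \<partial>M) - (\<integral>w. (W w - Z w)\<^sup>2 \<partial>M)) / 2"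
    using i by simp
  finally show ?thesis .
qed

text \<open>Polarisation reduces a combination of increments to second moments of pairwise
  increments, which are the quantities whose limits are assumed.\<close>

lemma second_moment_sum_increments:
  assumes X: "\<And>s. s \<in> insert z S \<Longrightarrow> sq_int M (X s)"
  shows "(\<integral>w. (\<Sum>s\<in>S. c s * (X s w - X z w))\<^sup>2 \<partial>M) = (\<Sum>s\<in>S. \<Sum>t\<in>S. c s * c t *
    (((\<integral>w. (X s w - X z w)\<^sup>2 \<partial>M) + (\<integral>w. (X t w - X z w)\<^sup>2 \<partial>M) - (\<integral>w. (X s w - X t w)\<^sup>2 \<partial>M)) / 2))"
proof -
  have sq: "sq_int M (\<lambda>w. X s w - X z w)" if "s \<in> S" for s
    using that X by (intro sq_int_diff) auto
  have "(\<integral>w. (\<Sum>s\<in>S. c s * (X s w - X z w))\<^sup>2 \<partial>M) =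
      (\<integral>w. (\<Sum>s\<in>S. \<Sum>t\<in>S. c s * c t * ((X s w - X z w) * (X t w - X z w))) \<partial>M)"
    by (rule Bochner_Integration.integral_cong) (simp_all add: power2_eq_square sum_product mult_ac)
  also have "\<dots> = (\<Sum>s\<in>S. \<integral>w. (\<Sum>t\<in>S. c s * c t * ((X s w - X z w) * (X t w - X z w))) \<partial>M)"
    by (intro Bochner_Integration.integral_sum Bochner_Integration.integrable_sum integrable_mult_right sq_int_mult sq)
  also have "\<dots> = (\<Sum>s\<in>S. \<Sum>t\<in>S. \<integral>w. c s * c t * ((X s w - X z w) * (X t w - X z w)) \<partial>M)"
    by (intro sum.cong refl Bochner_Integration.integral_sum integrable_mult_right sq_int_mult sq)
  also have "\<dots> = (\<Sum>s\<in>S. \<Sum>t\<in>S. c s * c t *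
    (((\<integral>w. (X s w - X z w)\<^sup>2 \<partial>M) + (\<integral>w. (X t w - X z w)\<^sup>2 \<partial>M) - (\<integral>w. (X s w - X t w)\<^sup>2 \<partial>M)) / 2))"
    by (intro sum.cong refl) (simp add: integral_mult_polarization[OF sq sq])
  finally show ?thesis .
qed

section \<open>Linear images of Gaussian fields\<close>

lemma centered_gaussian_field_sum:
  "centered_gaussian_field M D X \<Longrightarrow> finite S \<Longrightarrow> S \<subseteq> D \<Longrightarrow> centered_normal M (\<lambda>w. \<Sum>t\<in>S. c t * X t w)"
  by (simp add: centered_gaussian_field_def)

lemma centered_gaussian_field_component:
  assumes "centered_gaussian_field M D X" "t \<in> D"
  shows "centered_normal M (X t)"
  using centered_gaussian_field_sum[OF assms(1), of "{t}" "\<lambda>_. 1"] assms(2) by simp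

text \<open>One closure property for scaling, differences and the removal of a projection on
  \<open>X z\<close>. All multiples of \<open>X z\<close> are collected into a single coefficient;
  summing over \<open>insert z S\<close> covers both the case that \<open>z\<close> is already an
  index and the case that it is new.\<close>

lemma centered_gaussian_field_affine:
  assumes X: "centered_gaussian_field M D X" and z: "z \<in> D"
  shows "centered_gaussian_field M D (\<lambda>t w. \<alpha> t * X t w + \<beta> t * X z w)"
  unfolding centered_gaussian_field_def
proof (intro allI impI)
  fix S c assume S: "finite S \<and> S \<subseteq> D"
  define c' where "c' t = (if t \<in> S then c t * \<alpha> t else 0) + (if t = z then \<Sum>s\<in>S. c s * \<beta> s else 0)" for t
  have "(\<Sum>t\<in>insert z S. c' t * X t w) = (\<Sum>t\<in>S. c t * (\<alpha> t * X t w + \<beta> t * X z w))" for w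
  proof -
    have "(\<Sum>t\<in>insert z S. c' t * X t w) = (\<Sum>t\<in>insert z S. (if t \<in> S then c t * \<alpha> t * X t w else 0)) +
        (\<Sum>t\<in>insert z S. (if t = z then (\<Sum>s\<in>S. c s * \<beta> s) * X t w else 0))"
      unfolding sum.distrib[symmetric] by (rule sum.cong) (auto simp: c'_def distrib_right)
    also have "(\<Sum>t\<in>insert z S. (if t \<in> S then c t * \<alpha> t * X t w else 0)) = (\<Sum>t\<in>S. c t * \<alpha> t * X t w)"
      using S by (intro sum.mono_neutral_cong_right) auto
    also have "(\<Sum>t\<in>insert z S. (if t = z then (\<Sum>s\<in>S. c s * \<beta> s) * X t w else 0)) = (\<Sum>s\<in>S. c s * \<beta> s) * X z w"
      using S by simp
    finally show ?thesis by (simp add: sum_distrib_right sum_distrib_left sum.distrib algebra_simps)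
  qed
  then show "centered_normal M (\<lambda>w. \<Sum>t\<in>S. c t * (\<alpha> t * X t w + \<beta> t * X z w))"
    using centered_gaussian_field_sum[OF X, of "insert z S" c'] S z by simp
qed

lemma centered_gaussian_field_diff:
  assumes X: "centered_gaussian_field M D X" and "t \<in> D" "s \<in> D"
  shows "centered_normal M (\<lambda>w. X t w - X s w)"
  using centered_gaussian_field_component[OF centered_gaussian_field_affine[OF X assms(3), of "\<lambda>_. 1" "\<lambda>_. -1"] assms(2)]
  by simp

lemma (in prob_space) centered_normal_sq_int: "centered_normal M X \<Longrightarrow> sq_int M X"
  by (simp add: sq_int_def centered_normal_borel centered_normal_square_integrable)

section \<open>Equicontinuity, uniform limits and tightness\<close>

lemma uniform_limit_of_equicontinuous:
  fixes f :: "nat \<Rightarrow> 'a::metric_space \<Rightarrow> real"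
  assumes D: "compact D" and eq: "\<And>e. e > 0 \<Longrightarrow> \<exists>r>0. \<forall>n. \<forall>t\<in>D. \<forall>s\<in>D. dist t s < r \<longrightarrow> \<bar>f n t - f n s\<bar> < e"
    and lim: "\<And>t. t \<in> D \<Longrightarrow> (\<lambda>n. f n t) \<longlonglongrightarrow> h t"
  shows "uniform_limit D f h sequentially"
  unfolding uniform_limit_iff
proof (intro allI impI)
  fix e :: real assume "e > 0"
  then have e3: "e / 3 > 0" by simp
  obtain r where r: "r > 0" "\<forall>n. \<forall>t\<in>D. \<forall>s\<in>D. dist t s < r \<longrightarrow> \<bar>f n t - f n s\<bar> < e / 3"
    using eq[OF e3] by blast
  obtain S where S: "finite S" "S \<subseteq> D" "D \<subseteq> (\<Union>s\<in>S. ball s r)"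
    using seq_compact_imp_totally_bounded[OF iffD1[OF compact_eq_seq_compact_metric D], rule_format, OF r(1)]
    by (elim exE conjE)
  have "\<forall>\<^sub>F n in sequentially. \<forall>s\<in>S. dist (f n s) (h s) < e / 3"
    by (rule eventually_ball_finite[OF S(1)]) (rule ballI, rule tendstoD[OF lim[OF subsetD[OF S(2)]] e3])
  then show "\<forall>\<^sub>F n in sequentially. \<forall>t\<in>D. dist (f n t) (h t) < e"
  proof eventually_elim
    case (elim n)
    show ?case
    proof
      fix t assume t: "t \<in> D"
      then obtain s where s: "s \<in> S" "t \<in> ball s r" using S(3) by blast
      then have sD: "s \<in> D" "dist t s < r" using S(2) by (auto simp: dist_commute)
      have "(\<lambda>n. \<bar>f n t - f n s\<bar>) \<longlonglongrightarrow> \<bar>h t - h s\<bar>" by (intro tendsto_intros lim t sD)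
      then have "\<bar>h t - h s\<bar> \<le> e / 3"
        by (rule LIMSEQ_le_const2) (use r(2) t sD in \<open>auto intro!: less_imp_le\<close>)
      moreover have "\<bar>f n t - f n s\<bar> < e / 3" using r(2) t sD by blast
      moreover have "\<bar>f n s - h s\<bar> < e / 3" using elim s(1) by (simp add: dist_real_def)
      ultimately show "dist (f n t) (h t) < e" unfolding dist_real_def by linarith
    qed
  qed
qed

lemma equicont_family_bound: "equicont_family D K \<Longrightarrow> \<exists>b. \<forall>f\<in>K. \<forall>t\<in>D. \<bar>f t\<bar> \<le> b"
  by (simp add: equicont_family_def)

lemma equicont_family_modulus:
  "equicont_family D K \<Longrightarrow> e > 0 \<Longrightarrow> \<exists>r>0. \<forall>f\<in>K. \<forall>t\<in>D. \<forall>s\<in>D. dist t s < r \<longrightarrow> \<bar>f t - f s\<bar> < e"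
  by (simp add: equicont_family_def)

lemma equicont_family_Un:
  assumes "equicont_family D K" "equicont_family D L"
  shows "equicont_family D (K \<union> L)"
  unfolding equicont_family_def
proof (intro conjI allI impI)
  obtain b c where "\<forall>f\<in>K. \<forall>t\<in>D. \<bar>f t\<bar> \<le> b" "\<forall>f\<in>L. \<forall>t\<in>D. \<bar>f t\<bar> \<le> c"
    using assms unfolding equicont_family_def by (elim conjE exE)
  then have "\<forall>f\<in>K \<union> L. \<forall>t\<in>D. \<bar>f t\<bar> \<le> max b c" by (auto simp: le_max_iff_disj)
  then show "\<exists>b. \<forall>f\<in>K \<union> L. \<forall>t\<in>D. \<bar>f t\<bar> \<le> b" by (rule exI)
  fix e :: real assume "e > 0"
  from equicont_family_modulus[OF assms(1) this] obtain r
    where r: "r > 0" "\<forall>f\<in>K. \<forall>t\<in>D. \<forall>s\<in>D. dist t s < r \<longrightarrow> \<bar>f t - f s\<bar> < e"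
    by (elim exE conjE)
  from equicont_family_modulus[OF assms(2) \<open>e > 0\<close>] obtain q
    where q: "q > 0" "\<forall>f\<in>L. \<forall>t\<in>D. \<forall>s\<in>D. dist t s < q \<longrightarrow> \<bar>f t - f s\<bar> < e"
    by (elim exE conjE)
  show "\<exists>r>0. \<forall>f\<in>K \<union> L. \<forall>t\<in>D. \<forall>s\<in>D. dist t s < r \<longrightarrow> \<bar>f t - f s\<bar> < e"
    using r q by (intro exI[of _ "min r q"]) (simp add: ball_Un)
qed

lemma equicont_family_finite:
  assumes D: "compact D" and f: "\<And>n. continuous_on D (f n)"
  shows "equicont_family D (f ` {..<N::nat})"
proof (induction N)
  case (Suc N)
  have "f ` {..<Suc N} = f ` {..<N} \<union> {f N}" by (auto simp: lessThan_Suc)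
  then show ?case using equicont_family_Un[OF Suc equicont_family_singleton[OF D f]] by simp
next
  case 0
  have "\<exists>r::real. r > 0" by (rule exI[of _ 1]) simp
  then show ?case by (simp add: equicont_family_def)
qed

text \<open>Beyond some \<open>N\<close> the functions are uniformly close to \<open>h\<close> and
  share its modulus up to a small error; the finitely many earlier ones are equicontinuous by
  themselves. They cannot be dropped, because tightness is required for every
  \<open>n\<close>.\<close>

lemma equicont_family_uniform_limit:
  assumes D: "compact D" and f: "\<And>n. continuous_on D (f n)" and u: "uniform_limit D f h sequentially"
  shows "equicont_family D (range f)"
  unfolding equicont_family_def
proof (intro conjI allI impI)
  have h: "continuous_on D h" by (rule uniform_limit_theorem[OF _ u]) (use f in auto)
  note single = equicont_family_singleton[OF D h]
  have close: "\<exists>N. \<forall>n\<ge>N. \<forall>t\<in>D. \<bar>f n t - h t\<bar> < e" if "e > 0" for e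
    using u that unfolding uniform_limit_iff eventually_sequentially dist_real_def by blast
  obtain N where N: "\<forall>n\<ge>N. \<forall>t\<in>D. \<bar>f n t - h t\<bar> < 1" using close[OF zero_less_one] by blast
  obtain b where b: "\<forall>t\<in>D. \<bar>h t\<bar> \<le> b" using equicont_family_bound[OF single] by auto
  obtain c where c: "\<forall>k\<in>f ` {..<N}. \<forall>t\<in>D. \<bar>k t\<bar> \<le> c"
    using equicont_family_bound[OF equicont_family_finite[where f = f and N = N, OF D f]] by (elim exE)
  have "\<bar>f n t\<bar> \<le> max c (b + 1)" if "t \<in> D" for n t
  proof (cases "n < N")
    case True
    then have "\<bar>f n t\<bar> \<le> c" using c that by simp
    then show ?thesis by simp
  next
    case False
    then have "\<bar>f n t - h t\<bar> < 1" "\<bar>h t\<bar> \<le> b" using N b that by auto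
    then show ?thesis by linarith
  qed
  then show "\<exists>b. \<forall>k\<in>range f. \<forall>t\<in>D. \<bar>k t\<bar> \<le> b" by (intro exI[of _ "max c (b + 1)"]) simp
  fix e :: real assume "e > 0"
  then have e3: "e / 3 > 0" by simp
  obtain N where N: "\<forall>n\<ge>N. \<forall>t\<in>D. \<bar>f n t - h t\<bar> < e / 3" using close[OF e3] by blast
  obtain r where r: "r > 0" "\<forall>t\<in>D. \<forall>s\<in>D. dist t s < r \<longrightarrow> \<bar>h t - h s\<bar> < e / 3"
    using equicont_family_modulus[OF single e3] by auto
  obtain q where q: "q > 0" "\<forall>k\<in>f ` {..<N}. \<forall>t\<in>D. \<forall>s\<in>D. dist t s < q \<longrightarrow> \<bar>k t - k s\<bar> < e"
    using equicont_family_modulus[OF equicont_family_finite[where f = f and N = N, OF D f] \<open>e > 0\<close>] by (elim exE conjE)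
  have "\<bar>f n t - f n s\<bar> < e" if ts: "t \<in> D" "s \<in> D" "dist t s < min r q" for n t s
  proof (cases "n < N")
    case True
    then show ?thesis using q(2) ts by simp
  next
    case False
    then have "\<bar>f n t - h t\<bar> < e / 3" "\<bar>f n s - h s\<bar> < e / 3" "\<bar>h t - h s\<bar> < e / 3" using N r(2) ts by auto
    then show ?thesis by linarith
  qed
  then show "\<exists>r>0. \<forall>k\<in>range f. \<forall>t\<in>D. \<forall>s\<in>D. dist t s < r \<longrightarrow> \<bar>k t - k s\<bar> < e"
    using r(1) q(1) by (intro exI[of _ "min r q"]) simp
qed

lemma tight_add:
  assumes X: "uniformly_tight M D X" and m: "equicont_family D (range m)"
  shows "uniformly_tight M D (\<lambda>n t w. X n t w + m n t)"
  unfolding uniformly_tight_def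
proof (intro allI impI)
  fix \<epsilon> :: real assume "\<epsilon> > 0"
  from X[unfolded uniformly_tight_def, rule_format, OF this] obtain K where K: "equicont_family D K"
    and A: "\<forall>n. \<exists>A\<in>sets (M n). 1 - \<epsilon> \<le> measure (M n) A \<and> (\<forall>w\<in>A. (\<lambda>t. X n t w) \<in> K)"
    by (elim exE conjE)
  define L where "L = (\<lambda>(f, n). (\<lambda>t. f t + m n t)) ` (K \<times> UNIV)"
  have memL: "(\<lambda>t. f t + m n t) \<in> L" if "f \<in> K" for f n
    unfolding L_def using that by (intro image_eqI[of _ _ "(f, n)"]) simp_all
  have "equicont_family D L"
    unfolding equicont_family_def
  proof (intro conjI allI impI)
    obtain b c where bc: "\<forall>f\<in>K. \<forall>t\<in>D. \<bar>f t\<bar> \<le> b" "\<forall>f\<in>range m. \<forall>t\<in>D. \<bar>f t\<bar> \<le> c"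
      using equicont_family_bound[OF K] equicont_family_bound[OF m] by (elim exE)
    have "\<bar>f t + m n t\<bar> \<le> b + c" if "f \<in> K" "t \<in> D" for f n t
    proof -
      have "\<bar>f t\<bar> \<le> b" "\<bar>m n t\<bar> \<le> c" using bc that by auto
      then show ?thesis by linarith
    qed
    then have "\<forall>f\<in>L. \<forall>t\<in>D. \<bar>f t\<bar> \<le> b + c" by (simp add: L_def)
    then show "\<exists>b. \<forall>f\<in>L. \<forall>t\<in>D. \<bar>f t\<bar> \<le> b" by (rule exI)
    fix e :: real assume "e > 0"
    then have e2: "e / 2 > 0" by simp
    obtain r where r: "r > 0" "\<forall>f\<in>K. \<forall>t\<in>D. \<forall>s\<in>D. dist t s < r \<longrightarrow> \<bar>f t - f s\<bar> < e / 2"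
      using equicont_family_modulus[OF K e2] by (elim exE conjE)
    obtain q where q: "q > 0" "\<forall>f\<in>range m. \<forall>t\<in>D. \<forall>s\<in>D. dist t s < q \<longrightarrow> \<bar>f t - f s\<bar> < e / 2"
      using equicont_family_modulus[OF m e2] by (elim exE conjE)
    have "\<bar>f t + m n t - (f s + m n s)\<bar> < e" if "f \<in> K" "t \<in> D" "s \<in> D" "dist t s < min r q" for f n t s
    proof -
      have "\<bar>f t - f s\<bar> < e / 2" "\<bar>m n t - m n s\<bar> < e / 2" using r(2) q(2) that by auto
      then show ?thesis by linarith
    qed
    then show "\<exists>r>0. \<forall>f\<in>L. \<forall>t\<in>D. \<forall>s\<in>D. dist t s < r \<longrightarrow> \<bar>f t - f s\<bar> < e"
      using r(1) q(1) by (intro exI[of _ "min r q"]) (simp add: L_def)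
  qed
  moreover have "\<exists>A\<in>sets (M n). 1 - \<epsilon> \<le> measure (M n) A \<and> (\<forall>w\<in>A. (\<lambda>t. X n t w + m n t) \<in> L)" for n
  proof -
    obtain B where "B \<in> sets (M n)" "1 - \<epsilon> \<le> measure (M n) B" "\<forall>w\<in>B. (\<lambda>t. X n t w) \<in> K"
      using A[rule_format, of n] by (elim bexE conjE)
    then show ?thesis using memL by (intro bexI[of _ B]) simp_all
  qed
  ultimately show "\<exists>K. equicont_family D K \<and> (\<forall>n. \<exists>A\<in>sets (M n). 1 - \<epsilon> \<le> measure (M n) A \<and>
      (\<forall>w\<in>A. (\<lambda>t. X n t w + m n t) \<in> K))"
    by (intro exI[of _ L] conjI allI)
qed

section \<open>Asymptotics along a sequence\<close>

text \<open>The index \<open>n\<close> runs along a sequence \<open>u n\<close> tending to infinity, \<open>g n\<close> is the level at \<open>u n\<close>, and the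
  factor \<open>a\<close> is absorbed: \<open>\<zeta>\<close> stands for \<open>sqrt 2 * a * \<eta>\<close> and \<open>d\<close> for \<open>a\<^sup>2 * d\<close>. All paths are continuous.\<close>

locale gaussian_family =
  fixes D :: "(real^'n) set" and \<Phi> :: "(real^'n \<Rightarrow> real) \<Rightarrow> real"
    and M :: "nat \<Rightarrow> 'w measure" and \<xi> :: "nat \<Rightarrow> real^'n \<Rightarrow> 'w \<Rightarrow> real"
    and N :: "'v measure" and \<zeta> :: "real^'n \<Rightarrow> 'v \<Rightarrow> real"
    and g :: "nat \<Rightarrow> real" and d :: "real^'n \<Rightarrow> real" and G \<nu> :: real
  assumes D: "compact D" and zero: "0 \<in> D"
    and M: "\<And>n. prob_space (M n)" and \<xi>: "\<And>n. cont_process (M n) D (\<xi> n)"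
    and gauss: "\<And>n. centered_gaussian_field (M n) D (\<xi> n)"
    and N: "prob_space N" and \<zeta>: "cont_process N D \<zeta>" and gaussN: "centered_gaussian_field N D \<zeta>"
    and \<zeta>0: "\<And>w. w \<in> space N \<Longrightarrow> \<zeta> 0 w = 0"
    and unit: "\<And>n. (\<integral>w. (\<xi> n 0 w)\<^sup>2 \<partial>M n) = 1"
    and lim_var: "uniform_limit D (\<lambda>n t. (g n)\<^sup>2 * (1 - (\<integral>w. (\<xi> n t w)\<^sup>2 \<partial>M n))) (\<lambda>t. 2 * d t) sequentially"
    and lim_incr: "\<And>t s. t \<in> D \<Longrightarrow> s \<in> D \<Longrightarrow>
      (\<lambda>n. (g n)\<^sup>2 * (\<integral>w. (\<xi> n t w - \<xi> n s w)\<^sup>2 \<partial>M n)) \<longlonglongrightarrow> (\<integral>w. (\<zeta> t w - \<zeta> s w)\<^sup>2 \<partial>N)"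
    and bound_incr: "\<And>n t s. t \<in> D \<Longrightarrow> s \<in> D \<Longrightarrow>
      (g n)\<^sup>2 * (\<integral>w. (\<xi> n t w - \<xi> n s w)\<^sup>2 \<partial>M n) \<le> G * norm (t - s) powr \<nu>"
    and G: "G > 0" and \<nu>: "\<nu> > 0" and g: "\<And>n. g n > 0" "filterlim g at_top sequentially"
    and \<Phi>: "cont_fun D \<Phi>"
    and \<Phi>_bound: "\<And>f b. continuous_on D f \<Longrightarrow> (\<And>t. t \<in> D \<Longrightarrow> \<bar>f t\<bar> \<le> b) \<Longrightarrow> \<bar>\<Phi> f\<bar> \<le> b"
    and \<Phi>_affine: "\<And>f a b. continuous_on D f \<Longrightarrow> a > 0 \<Longrightarrow> \<Phi> (\<lambda>t. a * f t + b) = a * \<Phi> f + b"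
begin

section \<open>The projection on the value at the origin and its second moments\<close>

definition "S2 n t = (\<integral>w. (\<xi> n t w)\<^sup>2 \<partial>M n)"
definition "V n t s = (\<integral>w. (\<xi> n t w - \<xi> n s w)\<^sup>2 \<partial>M n)"
text \<open>The covariance of \<open>\<xi> n t\<close> with \<open>\<xi> n 0\<close>, written by
  polarisation in terms of quantities with known limits.\<close>

definition "R n t = (S2 n t + 1 - V n t 0) / 2"
definition "Y n t w = \<xi> n t w - R n t * \<xi> n 0 w"
definition "\<mu> n t = (g n)\<^sup>2 * (R n t - 1)"
text \<open>The limit of the drift \<open>\<mu>\<close>. With \<open>\<zeta>\<close> equal to
  \<open>sqrt 2 * a * \<eta>\<close>, half its variance is the variance of
  \<open>a * \<eta>\<close>, the term subtracted in the constant.\<close>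

definition "\<mu>0 t = - d t - (\<integral>w. (\<zeta> t w)\<^sup>2 \<partial>N) / 2"
definition "\<rho> = (SOME r. r > 0 \<and> (\<forall>t\<in>D. norm t \<le> r))"

lemma \<rho>: "\<rho> > 0" "t \<in> D \<Longrightarrow> norm t \<le> \<rho>"
proof -
  obtain B where "B > 0" "\<forall>t\<in>D. norm t \<le> B" using compact_imp_bounded[OF D] by (auto simp: bounded_pos)
  then have "\<exists>r. r > 0 \<and> (\<forall>t\<in>D. norm t \<le> r)" by blast
  then have "\<rho> > 0 \<and> (\<forall>t\<in>D. norm t \<le> \<rho>)" unfolding \<rho>_def by (rule someI_ex)
  then show "\<rho> > 0" "t \<in> D \<Longrightarrow> norm t \<le> \<rho>" by simp_all
qed

lemma \<xi>_sq: "t \<in> D \<Longrightarrow> sq_int (M n) (\<xi> n t)"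
  by (rule prob_space.centered_normal_sq_int[OF M centered_gaussian_field_component[OF gauss]])

lemma \<zeta>_sq: "t \<in> D \<Longrightarrow> sq_int N (\<zeta> t)"
  by (rule prob_space.centered_normal_sq_int[OF N centered_gaussian_field_component[OF gaussN]])

lemma S2_zero: "S2 n 0 = 1"
  by (simp add: S2_def unit)

lemma R_zero: "R n 0 = 1"
  by (simp add: R_def S2_zero V_def)

lemma R_cov: "t \<in> D \<Longrightarrow> (\<integral>w. \<xi> n t w * \<xi> n 0 w \<partial>M n) = R n t"
  by (simp add: integral_mult_polarization[OF \<xi>_sq \<xi>_sq[OF zero]] R_def S2_def V_def unit)

lemma \<mu>_eq: "\<mu> n t = - ((g n)\<^sup>2 * (1 - S2 n t)) / 2 - ((g n)\<^sup>2 * V n t 0) / 2"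
  by (simp add: \<mu>_def R_def field_simps)

lemma V_bound0: "t \<in> D \<Longrightarrow> (g n)\<^sup>2 * V n t 0 \<le> G * \<rho> powr \<nu>"
  using bound_incr[OF _ zero, of t n] powr_mono2[of \<nu> "norm t" \<rho>] \<rho>(2)[of t] \<nu> G
  unfolding V_def by (smt (verit) diff_zero mult_left_mono norm_ge_zero)

text \<open>After scaling by \<open>(g n)\<^sup>2\<close> the Hoelder bound on increments is uniform
  in \<open>n\<close> and yields one modulus of continuity for all these functions. Pointwise limits
  then become uniform.\<close>

lemma V_equicontinuous:
  assumes "e > 0"
  shows "\<exists>r>0. \<forall>n. \<forall>t\<in>D. \<forall>s\<in>D. dist t s < r \<longrightarrow> \<bar>(g n)\<^sup>2 * V n t 0 - (g n)\<^sup>2 * V n s 0\<bar> < e"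
proof -
  have "G * \<rho> powr \<nu> \<ge> 0" using G by simp
  from second_moment_modulus[OF this less_imp_le[OF G] \<nu> assms] obtain r where r: "r > 0"
    and H: "\<forall>x y v \<delta>. x \<le> G * \<rho> powr \<nu> \<longrightarrow> y \<le> G * \<rho> powr \<nu> \<longrightarrow> v \<le> G * \<delta> powr \<nu> \<longrightarrow> 0 \<le> \<delta> \<longrightarrow> \<delta> < r \<longrightarrow>
      (\<forall>\<kappa>>0. \<bar>x - y\<bar> \<le> \<kappa> / 2 * v + (x + y) / \<kappa>) \<longrightarrow> \<bar>x - y\<bar> < e"
    by (elim exE conjE)
  show ?thesis
  proof (intro exI[of _ r] conjI allI ballI impI r)
    fix n t s assume ts: "t \<in> D" "s \<in> D" "dist t s < r"
    show "\<bar>(g n)\<^sup>2 * V n t 0 - (g n)\<^sup>2 * V n s 0\<bar> < e"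
    proof (rule H[rule_format])
      show "(g n)\<^sup>2 * V n t 0 \<le> G * \<rho> powr \<nu>" "(g n)\<^sup>2 * V n s 0 \<le> G * \<rho> powr \<nu>" using V_bound0 ts by auto
      show "(g n)\<^sup>2 * V n t s \<le> G * norm (t - s) powr \<nu>" unfolding V_def using bound_incr ts by blast
      show "0 \<le> norm (t - s)" "norm (t - s) < r" using ts by (auto simp: dist_norm)
      fix \<kappa> :: real assume \<kappa>: "\<kappa> > 0"
      have "\<bar>V n t 0 - V n s 0\<bar> \<le> \<kappa> / 2 * V n t s + (V n t 0 + V n s 0) / \<kappa>"
        using second_moment_diff[OF sq_int_diff[OF \<xi>_sq[OF ts(1)] \<xi>_sq[OF zero]]
            sq_int_diff[OF \<xi>_sq[OF ts(2)] \<xi>_sq[OF zero]] \<kappa>, of n]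
        unfolding V_def by simp
      then have "(g n)\<^sup>2 * \<bar>V n t 0 - V n s 0\<bar> \<le> (g n)\<^sup>2 * (\<kappa> / 2 * V n t s + (V n t 0 + V n s 0) / \<kappa>)"
        by (rule mult_left_mono) simp
      moreover have "(g n)\<^sup>2 * \<bar>V n t 0 - V n s 0\<bar> = \<bar>(g n)\<^sup>2 * V n t 0 - (g n)\<^sup>2 * V n s 0\<bar>"
        by (simp add: abs_mult flip: right_diff_distrib)
      moreover have "(g n)\<^sup>2 * (\<kappa> / 2 * V n t s + (V n t 0 + V n s 0) / \<kappa>) =
          \<kappa> / 2 * ((g n)\<^sup>2 * V n t s) + ((g n)\<^sup>2 * V n t 0 + (g n)\<^sup>2 * V n s 0) / \<kappa>"
        using \<kappa> by (simp add: field_simps)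
      ultimately show "\<bar>(g n)\<^sup>2 * V n t 0 - (g n)\<^sup>2 * V n s 0\<bar> \<le>
          \<kappa> / 2 * ((g n)\<^sup>2 * V n t s) + ((g n)\<^sup>2 * V n t 0 + (g n)\<^sup>2 * V n s 0) / \<kappa>"
        by simp
    qed
  qed
qed

text \<open>Here \<open>n\<close> is fixed and the constants may depend on it; the unscaled variance
  is bounded by comparison with the value at 0. Continuity of \<open>R n\<close>, and so of the
  paths of \<open>Y n\<close>, rests on this.\<close>

lemma S2_continuous: "continuous_on D (S2 n)"
  unfolding continuous_on_iff
proof (intro ballI allI impI)
  fix t e assume t: "t \<in> D" and e: "(e::real) > 0"
  define C where "C = 2 * (G * \<rho> powr \<nu> / (g n)\<^sup>2) + 2"
  have V_le: "V n t s \<le> G / (g n)\<^sup>2 * norm (t - s) powr \<nu>" if "t \<in> D" "s \<in> D" for t s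
    using bound_incr[OF that, of n] g(1)[of n] by (simp add: V_def field_simps)
  have S2_le: "S2 n t \<le> C" if t: "t \<in> D" for t
  proof -
    have "S2 n t \<le> (\<integral>w. 2 * (\<xi> n t w - \<xi> n 0 w)\<^sup>2 + 2 * (\<xi> n 0 w)\<^sup>2 \<partial>M n)"
      unfolding S2_def
    proof (rule integral_mono)
      show "(\<xi> n t w)\<^sup>2 \<le> 2 * (\<xi> n t w - \<xi> n 0 w)\<^sup>2 + 2 * (\<xi> n 0 w)\<^sup>2" for w
      proof -
        have "0 \<le> (\<xi> n t w - 2 * \<xi> n 0 w)\<^sup>2" by simp
        then show ?thesis by (simp add: power2_eq_square algebra_simps)
      qed
    qed (intro Bochner_Integration.integrable_add integrable_mult_right sq_int_integrable sq_int_diff \<xi>_sq t zero)+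
    also have "\<dots> = 2 * V n t 0 + 2"
      using sq_int_integrable[OF sq_int_diff[OF \<xi>_sq[OF t] \<xi>_sq[OF zero]]] sq_int_integrable[OF \<xi>_sq[OF zero]] unit
      by (simp add: V_def)
    also have "\<dots> \<le> C" using V_bound0[OF t, of n] g(1)[of n] by (simp add: C_def field_simps)
    finally show ?thesis .
  qed
  have C0: "C \<ge> 0" using G by (simp add: C_def)
  have G0: "G / (g n)\<^sup>2 \<ge> 0" using G by simp
  from second_moment_modulus[OF C0 G0 \<nu> e] obtain r where r: "r > 0"
    and H: "\<forall>x y v \<delta>. x \<le> C \<longrightarrow> y \<le> C \<longrightarrow> v \<le> G / (g n)\<^sup>2 * \<delta> powr \<nu> \<longrightarrow> 0 \<le> \<delta> \<longrightarrow> \<delta> < r \<longrightarrow>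
      (\<forall>\<kappa>>0. \<bar>x - y\<bar> \<le> \<kappa> / 2 * v + (x + y) / \<kappa>) \<longrightarrow> \<bar>x - y\<bar> < e"
    by (elim exE conjE)
  have "dist (S2 n s) (S2 n t) < e" if s: "s \<in> D" "dist s t < r" for s
    unfolding dist_real_def
  proof (rule H[rule_format])
    show "V n s t \<le> G / (g n)\<^sup>2 * norm (s - t) powr \<nu>" by (rule V_le[OF s(1) t])
    show "\<bar>S2 n s - S2 n t\<bar> \<le> \<kappa> / 2 * V n s t + (S2 n s + S2 n t) / \<kappa>" if "\<kappa> > 0" for \<kappa>
      using second_moment_diff[OF \<xi>_sq[OF s(1)] \<xi>_sq[OF t] that] unfolding V_def S2_def by simp
  qed (use s t S2_le in \<open>auto simp: dist_norm\<close>)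
  then show "\<exists>r>0. \<forall>s\<in>D. dist s t < r \<longrightarrow> dist (S2 n s) (S2 n t) < e" using r by blast
qed

lemma \<mu>_continuous: "continuous_on D (\<mu> n)"
proof -
  define v where "v t = (g n)\<^sup>2 * V n t 0" for t
  have "continuous_on D v"
    unfolding continuous_on_iff v_def
  proof (intro ballI allI impI)
    fix t e assume "t \<in> D" "(e::real) > 0"
    then show "\<exists>r>0. \<forall>s\<in>D. dist s t < r \<longrightarrow> dist ((g n)\<^sup>2 * V n s 0) ((g n)\<^sup>2 * V n t 0) < e"
      using V_equicontinuous[of e] unfolding dist_real_def by blast
  qed
  then have "continuous_on D (\<lambda>t. (-1/2) * ((g n)\<^sup>2 * (1 - S2 n t)) + (-1/2) * v t)"
    by (intro continuous_intros S2_continuous)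
  moreover have "\<mu> n = (\<lambda>t. (-1/2) * ((g n)\<^sup>2 * (1 - S2 n t)) + (-1/2) * v t)"
    by (rule ext) (simp add: \<mu>_eq v_def)
  ultimately show ?thesis by simp
qed

lemma R_continuous: "continuous_on D (R n)"
proof -
  have "R n = (\<lambda>t. \<mu> n t / (g n)\<^sup>2 + 1)"
    by (rule ext) (use g(1)[of n] in \<open>simp add: \<mu>_def\<close>)
  then show ?thesis using g(1)[of n] by (simp only:) (intro continuous_intros \<mu>_continuous, simp)
qed

text \<open>The variance part converges uniformly by assumption, the increment part by
  equicontinuity.\<close>

lemma \<mu>_limit: "uniform_limit D \<mu> \<mu>0 sequentially"
proof -
  have "uniform_limit D (\<lambda>n t. (g n)\<^sup>2 * V n t 0) (\<lambda>t. \<integral>w. (\<zeta> t w - \<zeta> 0 w)\<^sup>2 \<partial>N) sequentially"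
    by (rule uniform_limit_of_equicontinuous[OF D V_equicontinuous]) (use lim_incr[OF _ zero] in \<open>simp_all add: V_def\<close>)
  from uniform_limit_add[OF lim_var this]
  have "uniform_limit D (\<lambda>n t. (-1/2) * ((g n)\<^sup>2 * (1 - S2 n t) + (g n)\<^sup>2 * V n t 0))
      (\<lambda>t. (-1/2) * (2 * d t + (\<integral>w. (\<zeta> t w - \<zeta> 0 w)\<^sup>2 \<partial>N))) sequentially"
    unfolding S2_def by (rule uniform_limit_intros)
  moreover have "(-1/2) * ((g n)\<^sup>2 * (1 - S2 n t) + (g n)\<^sup>2 * V n t 0) = \<mu> n t" for n t
    by (simp add: \<mu>_eq field_simps)
  moreover have "(-1/2) * (2 * d t + (\<integral>w. (\<zeta> t w - \<zeta> 0 w)\<^sup>2 \<partial>N)) = \<mu>0 t" for t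
  proof -
    have "(\<integral>w. (\<zeta> t w - \<zeta> 0 w)\<^sup>2 \<partial>N) = (\<integral>w. (\<zeta> t w)\<^sup>2 \<partial>N)"
      by (rule Bochner_Integration.integral_cong) (simp_all add: \<zeta>0)
    then show ?thesis by (simp add: \<mu>0_def field_simps)
  qed
  ultimately show ?thesis by simp
qed

text \<open>The continuity comes from the approximating drifts and the uniformity of the limit, not
  from \<open>d\<close>, of which no regularity is known here.\<close>

lemma \<mu>0_continuous: "continuous_on D \<mu>0"
  by (rule uniform_limit_theorem[OF _ \<mu>_limit]) (simp_all add: \<mu>_continuous)

lemma \<mu>_bounded: "\<exists>B>0. \<forall>n. \<forall>t\<in>D. \<bar>\<mu> n t\<bar> \<le> B"
proof -
  obtain b where "\<forall>f\<in>range \<mu>. \<forall>t\<in>D. \<bar>f t\<bar> \<le> b"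
    using equicont_family_bound[OF equicont_family_uniform_limit[OF D \<mu>_continuous \<mu>_limit]] by (elim exE)
  then have "\<forall>n. \<forall>t\<in>D. \<bar>\<mu> n t\<bar> \<le> max b 1" by (simp add: le_max_iff_disj)
  then show ?thesis by (intro exI[of _ "max b 1"]) simp
qed

lemma Y_process: "cont_process (M n) D (Y n)"
  unfolding cont_process_def
proof (intro conjI ballI)
  show "Y n t \<in> borel_measurable (M n)" if "t \<in> D" for t
    unfolding Y_def[abs_def] using cont_process_borel[OF \<xi> that] cont_process_borel[OF \<xi> zero]
    by (intro borel_measurable_diff borel_measurable_times) auto
  show "continuous_on D (\<lambda>t. Y n t w)" if "w \<in> space (M n)" for w
    unfolding Y_def by (intro continuous_intros R_continuous cont_process_continuous[OF \<xi> that])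
qed

lemma Y_gauss: "centered_gaussian_field (M n) D (Y n)"
  using centered_gaussian_field_affine[OF gauss zero, of n "\<lambda>_. 1" "\<lambda>t. - R n t"]
  by (simp add: Y_def[abs_def])

lemma Y_zero: "Y n 0 w = 0"
  by (simp add: Y_def R_zero)

lemma \<xi>_0_cov_sum:
  assumes "finite S" "S \<subseteq> D"
  shows "(\<integral>w. (\<Sum>s\<in>S. c s * \<xi> n s w) * \<xi> n 0 w \<partial>M n) = (\<Sum>s\<in>S. c s * R n s)"
proof -
  have "(\<integral>w. (\<Sum>s\<in>S. c s * \<xi> n s w) * \<xi> n 0 w \<partial>M n) = (\<integral>w. (\<Sum>s\<in>S. c s * (\<xi> n s w * \<xi> n 0 w)) \<partial>M n)"
    by (simp add: sum_distrib_right mult.assoc)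
  also have "\<dots> = (\<Sum>s\<in>S. \<integral>w. c s * (\<xi> n s w * \<xi> n 0 w) \<partial>M n)"
    by (intro Bochner_Integration.integral_sum integrable_mult_right sq_int_mult \<xi>_sq zero subsetD[OF assms(2)])
  also have "\<dots> = (\<Sum>s\<in>S. c s * R n s)"
    by (intro sum.cong refl) (simp add: R_cov subsetD[OF assms(2)])
  finally show ?thesis .
qed

lemma Y_second_moment:
  assumes "finite S" "S \<subseteq> D"
  shows "(\<integral>w. (\<Sum>s\<in>S. c s * Y n s w)\<^sup>2 \<partial>M n) = (\<integral>w. (\<Sum>s\<in>S. c s * \<xi> n s w)\<^sup>2 \<partial>M n) - (\<Sum>s\<in>S. c s * R n s)\<^sup>2"
proof -
  have "(\<Sum>s\<in>S. c s * Y n s w) = (\<Sum>s\<in>S. c s * \<xi> n s w) - (\<Sum>s\<in>S. c s * R n s) * \<xi> n 0 w" for w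
    by (simp add: Y_def right_diff_distrib sum_subtractf sum_distrib_right mult.assoc)
  then show ?thesis
    using residual_second_moment[OF sq_int_sum[OF sq_int_cmult[OF \<xi>_sq[OF subsetD[OF assms(2)]]]] \<xi>_sq[OF zero] unit
        \<xi>_0_cov_sum[OF assms]] by simp
qed

text \<open>Removing a projection can only lower second moments, so \<open>Y\<close> inherits the
  increment bound of \<open>\<xi>\<close>.\<close>

lemma Y_increment:
  assumes "t \<in> D" "s \<in> D"
  shows "(\<integral>w. (g n * Y n t w - g n * Y n s w)\<^sup>2 \<partial>M n) \<le> G * norm (t - s) powr \<nu>"
\<comment> \<open>For \<open>t = s\<close> the set \<open>{t, s}\<close> cannot carry the two
  coefficients 1 and -1.\<close>
proof (cases "t = s")
  case False
  have "(\<integral>w. (\<Sum>r\<in>{t, s}. (if r = t then 1 else -1) * Y n r w)\<^sup>2 \<partial>M n) \<le>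
      (\<integral>w. (\<Sum>r\<in>{t, s}. (if r = t then 1 else -1) * \<xi> n r w)\<^sup>2 \<partial>M n)"
    using assms by (subst Y_second_moment) auto
  then have "(\<integral>w. (Y n t w - Y n s w)\<^sup>2 \<partial>M n) \<le> V n t s" using False by (simp add: V_def)
  then have "(g n)\<^sup>2 * (\<integral>w. (Y n t w - Y n s w)\<^sup>2 \<partial>M n) \<le> (g n)\<^sup>2 * V n t s"
    by (rule mult_left_mono) simp
  also have "\<dots> \<le> G * norm (t - s) powr \<nu>" unfolding V_def by (rule bound_incr[OF assms])
  finally show ?thesis by (simp add: right_diff_distrib[symmetric] power_mult_distrib)
qed simp

text \<open>In terms of the increments \<open>\<xi> n s - \<xi> n 0\<close> the projection
  coefficient is \<open>R n s - 1\<close>, of order \<open>1 / (g n)\<^sup>2\<close>. After scaling,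
  its square contributes \<open>(\<Sum>s\<in>S. c s * \<mu> n s)\<^sup>2 / (g n)\<^sup>2\<close>,
  which vanishes in the limit, so that pairwise increments alone determine the limit.\<close>

lemma Y_limit_second_moment:
  assumes "finite S" "S \<subseteq> D"
  shows "(\<lambda>n. (g n)\<^sup>2 * (\<integral>w. (\<Sum>s\<in>S. c s * Y n s w)\<^sup>2 \<partial>M n)) \<longlonglongrightarrow> (\<integral>w. (\<Sum>s\<in>S. c s * \<zeta> s w)\<^sup>2 \<partial>N)"
proof -
  have sD: "s \<in> D" if "s \<in> insert 0 S" for s using that assms zero by auto
  have eq: "(g n)\<^sup>2 * (\<integral>w. (\<Sum>s\<in>S. c s * Y n s w)\<^sup>2 \<partial>M n) =
    (\<Sum>s\<in>S. \<Sum>t\<in>S. c s * c t * (((g n)\<^sup>2 * V n s 0 + (g n)\<^sup>2 * V n t 0 - (g n)\<^sup>2 * V n s t) / 2)) -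
      (\<Sum>s\<in>S. c s * \<mu> n s)\<^sup>2 / (g n)\<^sup>2" for n
  proof -
    have W: "(\<integral>w. (\<Sum>s\<in>S. c s * (\<xi> n s w - \<xi> n 0 w)) * \<xi> n 0 w \<partial>M n) = (\<Sum>s\<in>S. c s * (R n s - 1))"
    proof -
      have "(\<integral>w. (\<Sum>s\<in>S. c s * (\<xi> n s w - \<xi> n 0 w)) * \<xi> n 0 w \<partial>M n) =
          (\<integral>w. (\<Sum>s\<in>S. c s * \<xi> n s w) * \<xi> n 0 w - (\<Sum>s\<in>S. c s) * (\<xi> n 0 w)\<^sup>2 \<partial>M n)"
        by (simp add: right_diff_distrib sum_subtractf left_diff_distrib power2_eq_square mult.assoc flip: sum_distrib_right)
      also have "\<dots> = (\<Sum>s\<in>S. c s * R n s) - (\<Sum>s\<in>S. c s) * 1"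
        by (subst Bochner_Integration.integral_diff)
          (simp_all add: \<xi>_0_cov_sum[OF assms] unit sq_int_integrable[OF \<xi>_sq[OF zero]]
             sq_int_mult[OF sq_int_sum[OF sq_int_cmult[OF \<xi>_sq[OF subsetD[OF assms(2)]]]] \<xi>_sq[OF zero]])
      finally show ?thesis by (simp add: right_diff_distrib sum_subtractf)
    qed
    have "(\<Sum>s\<in>S. c s * Y n s w) = (\<Sum>s\<in>S. c s * (\<xi> n s w - \<xi> n 0 w)) - (\<Sum>s\<in>S. c s * (R n s - 1)) * \<xi> n 0 w" for w
      by (simp add: Y_def right_diff_distrib left_diff_distrib sum_subtractf sum_distrib_right mult.assoc)
    moreover have "sq_int (M n) (\<lambda>w. \<Sum>s\<in>S. c s * (\<xi> n s w - \<xi> n 0 w))"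
      by (intro sq_int_sum sq_int_cmult sq_int_diff \<xi>_sq zero subsetD[OF assms(2)])
    ultimately have "(\<integral>w. (\<Sum>s\<in>S. c s * Y n s w)\<^sup>2 \<partial>M n) =
        (\<integral>w. (\<Sum>s\<in>S. c s * (\<xi> n s w - \<xi> n 0 w))\<^sup>2 \<partial>M n) - (\<Sum>s\<in>S. c s * (R n s - 1))\<^sup>2"
      using residual_second_moment[OF _ \<xi>_sq[OF zero] unit W] by simp
    also have "(\<integral>w. (\<Sum>s\<in>S. c s * (\<xi> n s w - \<xi> n 0 w))\<^sup>2 \<partial>M n) =
        (\<Sum>s\<in>S. \<Sum>t\<in>S. c s * c t * ((V n s 0 + V n t 0 - V n s t) / 2))"
      unfolding V_def by (rule second_moment_sum_increments) (rule \<xi>_sq[OF sD])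
    finally have "(g n)\<^sup>2 * (\<integral>w. (\<Sum>s\<in>S. c s * Y n s w)\<^sup>2 \<partial>M n) =
        (g n)\<^sup>2 * (\<Sum>s\<in>S. \<Sum>t\<in>S. c s * c t * ((V n s 0 + V n t 0 - V n s t) / 2)) - (g n)\<^sup>2 * (\<Sum>s\<in>S. c s * (R n s - 1))\<^sup>2"
      by (simp add: right_diff_distrib)
    also have "(g n)\<^sup>2 * (\<Sum>s\<in>S. \<Sum>t\<in>S. c s * c t * ((V n s 0 + V n t 0 - V n s t) / 2)) =
        (\<Sum>s\<in>S. \<Sum>t\<in>S. c s * c t * (((g n)\<^sup>2 * V n s 0 + (g n)\<^sup>2 * V n t 0 - (g n)\<^sup>2 * V n s t) / 2))"
      unfolding sum_distrib_left by (intro sum.cong refl) (simp add: algebra_simps)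
    also have "(g n)\<^sup>2 * (\<Sum>s\<in>S. c s * (R n s - 1))\<^sup>2 = (\<Sum>s\<in>S. c s * \<mu> n s)\<^sup>2 / (g n)\<^sup>2"
    proof -
      have "(\<Sum>s\<in>S. c s * \<mu> n s) = (g n)\<^sup>2 * (\<Sum>s\<in>S. c s * (R n s - 1))"
        unfolding sum_distrib_left by (intro sum.cong refl) (simp add: \<mu>_def)
      then show ?thesis using g(1)[of n] by (simp add: power2_eq_square)
    qed
    finally show ?thesis .
  qed
  have "(\<lambda>n. (\<Sum>s\<in>S. c s * \<mu> n s)\<^sup>2 / (g n)\<^sup>2) \<longlonglongrightarrow> 0"
  proof (rule real_tendsto_divide_at_top)
    show "(\<lambda>n. (\<Sum>s\<in>S. c s * \<mu> n s)\<^sup>2) \<longlonglongrightarrow> (\<Sum>s\<in>S. c s * \<mu>0 s)\<^sup>2"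
      by (intro tendsto_intros tendsto_uniform_limitI[OF \<mu>_limit] subsetD[OF assms(2)])
    show "filterlim (\<lambda>n. (g n)\<^sup>2) at_top sequentially" by (intro filterlim_pow_at_top g(2)) simp
  qed
  moreover have "(\<lambda>n. \<Sum>s\<in>S. \<Sum>t\<in>S. c s * c t * (((g n)\<^sup>2 * V n s 0 + (g n)\<^sup>2 * V n t 0 - (g n)\<^sup>2 * V n s t) / 2)) \<longlonglongrightarrow>
     (\<Sum>s\<in>S. \<Sum>t\<in>S. c s * c t * (((\<integral>w. (\<zeta> s w - \<zeta> 0 w)\<^sup>2 \<partial>N) + (\<integral>w. (\<zeta> t w - \<zeta> 0 w)\<^sup>2 \<partial>N) -
        (\<integral>w. (\<zeta> s w - \<zeta> t w)\<^sup>2 \<partial>N)) / 2))"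
    unfolding V_def
    by (intro tendsto_sum tendsto_mult tendsto_const tendsto_divide tendsto_diff tendsto_add lim_incr zero
        subsetD[OF assms(2)]) simp_all
  ultimately have "(\<lambda>n. (g n)\<^sup>2 * (\<integral>w. (\<Sum>s\<in>S. c s * Y n s w)\<^sup>2 \<partial>M n)) \<longlonglongrightarrow>
     (\<Sum>s\<in>S. \<Sum>t\<in>S. c s * c t * (((\<integral>w. (\<zeta> s w - \<zeta> 0 w)\<^sup>2 \<partial>N) + (\<integral>w. (\<zeta> t w - \<zeta> 0 w)\<^sup>2 \<partial>N) -
        (\<integral>w. (\<zeta> s w - \<zeta> t w)\<^sup>2 \<partial>N)) / 2)) - 0"
    unfolding eq by (rule tendsto_diff[rotated])
  also have "(\<Sum>s\<in>S. \<Sum>t\<in>S. c s * c t * (((\<integral>w. (\<zeta> s w - \<zeta> 0 w)\<^sup>2 \<partial>N) + (\<integral>w. (\<zeta> t w - \<zeta> 0 w)\<^sup>2 \<partial>N) -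
        (\<integral>w. (\<zeta> s w - \<zeta> t w)\<^sup>2 \<partial>N)) / 2)) = (\<integral>w. (\<Sum>s\<in>S. c s * (\<zeta> s w - \<zeta> 0 w))\<^sup>2 \<partial>N)"
    by (rule second_moment_sum_increments[symmetric]) (rule \<zeta>_sq[OF sD])
  also have "(\<integral>w. (\<Sum>s\<in>S. c s * (\<zeta> s w - \<zeta> 0 w))\<^sup>2 \<partial>N) = (\<integral>w. (\<Sum>s\<in>S. c s * \<zeta> s w)\<^sup>2 \<partial>N)"
    by (rule Bochner_Integration.integral_cong) (simp_all add: \<zeta>0)
  finally show ?thesis by simp
qed

end

lemma std_normal_linear_cos:
  "(\<integral>z. cos (b + \<alpha> * z) \<partial>std_normal_distribution) = cos b * exp (- \<alpha>\<^sup>2 / 2)"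
proof -
  interpret S: prob_space std_normal_distribution by (rule prob_space_normal_density) simp
  have id: "distributed std_normal_distribution lborel (\<lambda>z. z) std_normal_density"
    by (auto simp: distributed_def distr_id2)
  show ?thesis
  proof (cases "\<alpha> = 0")
    case True
    then show ?thesis using S.prob_space by simp
  next
    case False
    have D: "distributed std_normal_distribution lborel (\<lambda>z. \<alpha> * z) (normal_density 0 \<bar>\<alpha>\<bar>)"
      using S.normal_density_affine[OF id, of \<alpha> 0] False by simp
    then have "centered_normal std_normal_distribution (\<lambda>z. \<alpha> * z)"
      using False by (auto simp: centered_normal_def intro!: exI[of _ "\<bar>\<alpha>\<bar>"])
    from S.centered_normal_cos[OF this, of b] S.centered_normal_variance_normal[OF _ D] False
    show ?thesis by simp
  qed
qed

context gaussian_family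
begin

section \<open>Tightness and convergence of the scaled fields\<close>

lemma gY_process: "cont_process (M n) D (\<lambda>t w. g n * Y n t w)"
  using Y_process[of n] unfolding cont_process_def by (auto intro!: continuous_intros)

lemma gY_gauss: "centered_gaussian_field (M n) D (\<lambda>t w. g n * Y n t w)"
  using centered_gaussian_field_affine[OF Y_gauss zero, of n "\<lambda>_. g n" "\<lambda>_. 0"] by simp

lemma gY_modulus:
  "\<exists>A :: nat \<Rightarrow> real. A \<longlonglongrightarrow> 0 \<and> (\<forall>k. 0 \<le> A k) \<and> (\<forall>n l b. 1 \<le> l \<longrightarrow> 0 \<le> b \<longrightarrow>
     (\<exists>E\<in>sets (M n). 1 - 4 * exp (l\<^sup>2 / 2) * exp (- l * b) \<le> measure (M n) E \<and>
       (\<forall>w\<in>E. \<forall>k. \<forall>t\<in>D. \<forall>s\<in>D. dist t s \<le> \<rho> * (1/2) ^ k \<longrightarrow> \<bar>g n * Y n t w - g n * Y n s w\<bar> \<le> A k * (1 + b))))"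
proof (rule gaussian_modulus[where 'w = 'w, OF \<rho> G \<nu>])
  fix A :: "nat \<Rightarrow> real"
  assume A: "A \<longlonglongrightarrow> 0" "\<And>k. 0 \<le> A k"
    and H: "\<And>(M :: 'w measure) X l b. prob_space M \<Longrightarrow> (\<And>t. t \<in> D \<Longrightarrow> X t \<in> borel_measurable M) \<Longrightarrow>
       (\<And>w. w \<in> space M \<Longrightarrow> continuous_on D (\<lambda>t. X t w)) \<Longrightarrow>
       (\<And>t s. t \<in> D \<Longrightarrow> s \<in> D \<Longrightarrow> centered_normal M (\<lambda>w. X t w - X s w)) \<Longrightarrow>
       (\<And>t s. t \<in> D \<Longrightarrow> s \<in> D \<Longrightarrow> integral\<^sup>L M (\<lambda>w. (X t w - X s w)\<^sup>2) \<le> G * norm (t - s) powr \<nu>) \<Longrightarrow>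
       1 \<le> l \<Longrightarrow> 0 \<le> b \<Longrightarrow>
       \<exists>E\<in>sets M. 1 - 4 * exp (l\<^sup>2 / 2) * exp (- l * b) \<le> measure M E \<and>
         (\<forall>w\<in>E. \<forall>k. \<forall>t\<in>D. \<forall>s\<in>D. dist t s \<le> \<rho> * (1/2) ^ k \<longrightarrow> \<bar>X t w - X s w\<bar> \<le> A k * (1 + b))"
  show ?thesis
  proof (intro exI[of _ A] conjI allI impI A)
    fix n and l b :: real assume lb: "1 \<le> l" "0 \<le> b"
    show "\<exists>E\<in>sets (M n). 1 - 4 * exp (l\<^sup>2 / 2) * exp (- l * b) \<le> measure (M n) E \<and>
         (\<forall>w\<in>E. \<forall>k. \<forall>t\<in>D. \<forall>s\<in>D. dist t s \<le> \<rho> * (1/2) ^ k \<longrightarrow> \<bar>g n * Y n t w - g n * Y n s w\<bar> \<le> A k * (1 + b))"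
      by (rule H[OF M cont_process_borel[OF gY_process] cont_process_continuous[OF gY_process]
            centered_gaussian_field_diff[OF gY_gauss] Y_increment lb])
  qed
qed

text \<open>The rate \<open>l = 1\<close> is enough here: \<open>b\<close> is taken so large that
  the exceptional probability is at most \<open>\<epsilon>\<close>, and for this fixed
  \<open>b\<close> the moduli \<open>A k * (1 + b)\<close> still tend to 0.\<close>

lemma gY_tight: "uniformly_tight M D (\<lambda>n t w. g n * Y n t w)"
proof -
  obtain A :: "nat \<Rightarrow> real" where A: "A \<longlonglongrightarrow> 0" "\<forall>k. 0 \<le> A k"
    and H: "\<forall>n l b. 1 \<le> l \<longrightarrow> 0 \<le> b \<longrightarrow>
       (\<exists>E\<in>sets (M n). 1 - 4 * exp (l\<^sup>2 / 2) * exp (- l * b) \<le> measure (M n) E \<and>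
         (\<forall>w\<in>E. \<forall>k. \<forall>t\<in>D. \<forall>s\<in>D. dist t s \<le> \<rho> * (1/2) ^ k \<longrightarrow> \<bar>g n * Y n t w - g n * Y n s w\<bar> \<le> A k * (1 + b)))"
    using gY_modulus by (elim exE conjE)
  show ?thesis
    unfolding uniformly_tight_def
  proof (intro allI impI)
    fix \<epsilon> :: real assume \<epsilon>: "\<epsilon> > 0"
    define b where "b = max 0 (ln (4 * exp (1 / 2) / \<epsilon>))"
    have b: "b \<ge> 0" by (simp add: b_def)
    have "4 * exp (1 / 2) / \<epsilon> = exp (ln (4 * exp (1 / 2) / \<epsilon>))" using \<epsilon> by simp
    also have "\<dots> \<le> exp b" by (simp only: exp_le_cancel_iff) (simp add: b_def)
    finally have b\<epsilon>: "4 * exp (1 / 2) * exp (- b) \<le> \<epsilon>" using \<epsilon> by (simp add: exp_minus field_simps)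
    define K where "K = {f :: real^'n \<Rightarrow> real. (\<forall>t\<in>D. \<bar>f t\<bar> \<le> A 0 * (1 + b)) \<and>
      (\<forall>k. \<forall>t\<in>D. \<forall>s\<in>D. dist t s \<le> \<rho> * (1/2) ^ k \<longrightarrow> \<bar>f t - f s\<bar> \<le> A k * (1 + b))}"
    have "equicont_family D K"
      unfolding equicont_family_def
    proof (intro conjI allI impI)
      show "\<exists>b. \<forall>f\<in>K. \<forall>t\<in>D. \<bar>f t\<bar> \<le> b" by (intro exI[of _ "A 0 * (1 + b)"]) (simp add: K_def)
      fix e :: real assume e: "e > 0"
      have "(\<lambda>k. A k * (1 + b)) \<longlonglongrightarrow> 0 * (1 + b)" by (intro tendsto_intros A)
      then have "\<forall>\<^sub>F k in sequentially. A k * (1 + b) < e" using e by (intro order_tendstoD) auto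
      then obtain k where k: "A k * (1 + b) < e" by (auto simp: eventually_sequentially)
      have "\<bar>f t - f s\<bar> < e" if "f \<in> K" "t \<in> D" "s \<in> D" "dist t s < \<rho> * (1/2) ^ k" for f t s
      proof -
        have "\<bar>f t - f s\<bar> \<le> A k * (1 + b)" using that by (simp add: K_def)
        then show ?thesis using k by simp
      qed
      then show "\<exists>r>0. \<forall>f\<in>K. \<forall>t\<in>D. \<forall>s\<in>D. dist t s < r \<longrightarrow> \<bar>f t - f s\<bar> < e"
        using \<rho>(1) by (intro exI[of _ "\<rho> * (1/2) ^ k"]) simp
    qed
    moreover have "\<exists>E\<in>sets (M n). 1 - \<epsilon> \<le> measure (M n) E \<and> (\<forall>w\<in>E. (\<lambda>t. g n * Y n t w) \<in> K)" for n
    proof -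
      from H[rule_format, OF order_refl b, of n] obtain E where E: "E \<in> sets (M n)"
        "1 - 4 * exp (1\<^sup>2 / 2) * exp (- 1 * b) \<le> measure (M n) E"
        "\<forall>w\<in>E. \<forall>k. \<forall>t\<in>D. \<forall>s\<in>D. dist t s \<le> \<rho> * (1/2) ^ k \<longrightarrow> \<bar>g n * Y n t w - g n * Y n s w\<bar> \<le> A k * (1 + b)"
        by (elim bexE conjE)
      have "(\<lambda>t. g n * Y n t w) \<in> K" if w: "w \<in> E" for w
        unfolding K_def mem_Collect_eq
      proof (intro conjI ballI)
        fix t assume t: "t \<in> D"
        \<comment> \<open>Level 0 spans the distance from any point of \<open>D\<close> to the
          origin, where \<open>Y\<close> vanishes, so the modulus of level 0 bounds the path
          itself.\<close>
        have "dist t 0 \<le> \<rho> * (1/2) ^ 0" using \<rho>(2)[OF t] by simp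
        then show "\<bar>g n * Y n t w\<bar> \<le> A 0 * (1 + b)" using E(3) w t zero Y_zero by fastforce
      qed (use E(3) w in simp)
      then show ?thesis using E(1,2) b\<epsilon> by (intro bexI[of _ E]) simp_all
    qed
    ultimately show "\<exists>K. equicont_family D K \<and> (\<forall>n. \<exists>E\<in>sets (M n). 1 - \<epsilon> \<le> measure (M n) E \<and>
        (\<forall>w\<in>E. (\<lambda>t. g n * Y n t w) \<in> K))" by (intro exI[of _ K] conjI allI)
  qed
qed

text \<open>\<open>m y n\<close> is the drift \<open>((g n)\<^sup>2 - y) * (R n t - 1)\<close> left by the substitution \<open>z = g n - y / g n\<close>.\<close>

definition "m y n t = (1 - y / (g n)\<^sup>2) * \<mu> n t"
definition "q n y = measure (M n) {w \<in> space (M n). y < \<Phi> (\<lambda>t. g n * Y n t w + m y n t)}"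
definition "q0 y = measure N {w \<in> space N. y < \<Phi> (\<lambda>t. \<zeta> t w + \<mu>0 t)}"

lemma m_continuous: "continuous_on D (m y n)"
  unfolding m_def[abs_def] by (intro continuous_intros \<mu>_continuous)

lemma m_limit: "uniform_limit D (m y) \<mu>0 sequentially"
proof -
  have "filterlim (\<lambda>n. (g n)\<^sup>2) at_top sequentially" by (intro filterlim_pow_at_top g(2)) simp
  then have "(\<lambda>n. y / (g n)\<^sup>2) \<longlonglongrightarrow> 0" by (intro real_tendsto_divide_at_top[OF tendsto_const])
  then have "(\<lambda>n. 1 - y / (g n)\<^sup>2) \<longlonglongrightarrow> 1 - 0" by (intro tendsto_intros)
  then have "uniform_limit D (\<lambda>n t. 1 - y / (g n)\<^sup>2) (\<lambda>t. 1 - 0) sequentially"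
    unfolding uniform_limit_iff tendsto_iff by simp
  moreover have "bounded (\<mu>0 ` D)"
    using compact_continuous_image[OF \<mu>0_continuous D] by (rule compact_imp_bounded)
  ultimately have "uniform_limit D (\<lambda>n t. (1 - y / (g n)\<^sup>2) * \<mu> n t) (\<lambda>t. (1 - 0) * \<mu>0 t) sequentially"
    by (intro uniform_lim_mult \<mu>_limit) (auto simp: image_constant_conv)
  then show ?thesis by (simp add: m_def[abs_def])
qed

lemma T_process: "cont_process (M n) D (\<lambda>t w. g n * Y n t w + m y n t)"
  using gY_process[of n] m_continuous[of y n] unfolding cont_process_def
  by (auto intro!: continuous_on_add borel_measurable_add)

lemma \<zeta>\<mu>_process: "cont_process N D (\<lambda>t w. \<zeta> t w + \<mu>0 t)"
  using \<zeta> \<mu>0_continuous unfolding cont_process_def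
  by (auto intro!: continuous_on_add borel_measurable_add)

text \<open>For Gaussian fields the expected cosine is a function of the mean and the second moment
  of the linear combination, and the limits of both are known.\<close>

lemma T_trig_conv: "trig_conv M D (\<lambda>n t w. g n * Y n t w + m y n t) N (\<lambda>t w. \<zeta> t w + \<mu>0 t)"
  unfolding trig_conv_def
proof (intro allI impI)
  fix S b and c :: "real^'n \<Rightarrow> real" assume S: "finite S" "S \<subseteq> D"
  have 1: "(\<integral>w. cos (b + (\<Sum>s\<in>S. c s * (g n * Y n s w + m y n s))) \<partial>M n) =
      cos (b + (\<Sum>s\<in>S. c s * m y n s)) * exp (- ((g n)\<^sup>2 * (\<integral>w. (\<Sum>s\<in>S. c s * Y n s w)\<^sup>2 \<partial>M n)) / 2)" for n
  proof -
    interpret prob_space "M n" by (rule M)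
    have "(\<Sum>s\<in>S. c s * (g n * Y n s w + m y n s)) = (\<Sum>s\<in>S. c s * m y n s) + (\<Sum>s\<in>S. c s * (g n * Y n s w))" for w
      by (simp add: distrib_left sum.distrib add.commute)
    then have "(\<integral>w. cos (b + (\<Sum>s\<in>S. c s * (g n * Y n s w + m y n s))) \<partial>M n) =
        (\<integral>w. cos ((b + (\<Sum>s\<in>S. c s * m y n s)) + (\<Sum>s\<in>S. c s * (g n * Y n s w))) \<partial>M n)"
      by (simp add: add.assoc)
    also have "\<dots> = cos (b + (\<Sum>s\<in>S. c s * m y n s)) * exp (- (\<integral>w. (\<Sum>s\<in>S. c s * (g n * Y n s w))\<^sup>2 \<partial>M n) / 2)"
      by (rule centered_normal_cos[OF centered_gaussian_field_sum[OF gY_gauss S]])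
    also have "(\<integral>w. (\<Sum>s\<in>S. c s * (g n * Y n s w))\<^sup>2 \<partial>M n) = (\<integral>w. (g n)\<^sup>2 * (\<Sum>s\<in>S. c s * Y n s w)\<^sup>2 \<partial>M n)"
      by (simp add: power_mult_distrib[symmetric] sum_distrib_left mult.left_commute)
    finally show ?thesis by simp
  qed
  interpret N: prob_space N by (rule N)
  have "(\<Sum>s\<in>S. c s * (\<zeta> s w + \<mu>0 s)) = (\<Sum>s\<in>S. c s * \<mu>0 s) + (\<Sum>s\<in>S. c s * \<zeta> s w)" for w
    by (simp add: distrib_left sum.distrib add.commute)
  then have 2: "(\<integral>w. cos (b + (\<Sum>s\<in>S. c s * (\<zeta> s w + \<mu>0 s))) \<partial>N) =
      cos (b + (\<Sum>s\<in>S. c s * \<mu>0 s)) * exp (- (\<integral>w. (\<Sum>s\<in>S. c s * \<zeta> s w)\<^sup>2 \<partial>N) / 2)"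
    using N.centered_normal_cos[OF centered_gaussian_field_sum[OF gaussN S], of "b + (\<Sum>s\<in>S. c s * \<mu>0 s)" c]
    by (simp add: add.assoc)
  show "(\<lambda>n. \<integral>w. cos (b + (\<Sum>s\<in>S. c s * (g n * Y n s w + m y n s))) \<partial>M n) \<longlonglongrightarrow>
      (\<integral>w. cos (b + (\<Sum>s\<in>S. c s * (\<zeta> s w + \<mu>0 s))) \<partial>N)"
    unfolding 1 2
    by (intro tendsto_intros Y_limit_second_moment[OF S] tendsto_uniform_limitI[OF m_limit] subsetD[OF S(2)]) auto
qed

lemma q_limit:
  assumes "measure N {w \<in> space N. \<Phi> (\<lambda>t. \<zeta> t w + \<mu>0 t) = y} = 0"
  shows "(\<lambda>n. q n y) \<longlonglongrightarrow> q0 y"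
  unfolding q_def q0_def
  by (rule tail_convergence[OF D \<Phi> M T_process N \<zeta>\<mu>_process T_trig_conv
        tight_add[OF gY_tight equicont_family_uniform_limit[OF D m_continuous m_limit]] assms])

lemma Z_borel: "(\<lambda>w. \<Phi> (\<lambda>t. \<zeta> t w + \<mu>0 t)) \<in> borel_measurable N"
  by (rule cont_fun_measurable[OF D \<Phi> \<zeta>\<mu>_process])

text \<open>The limit law has at most countably many atoms, which form a Lebesgue null set; away
  from them the tail probabilities converge.\<close>

lemma q_limit_AE: "AE y in lborel. (\<lambda>n. q n y) \<longlonglongrightarrow> q0 y"
proof -
  interpret N: prob_space N by (rule N)
  interpret Z: real_distribution "distr N borel (\<lambda>w. \<Phi> (\<lambda>t. \<zeta> t w + \<mu>0 t))"
    by (rule N.real_distribution_distr[OF Z_borel])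
  have atom: "measure (distr N borel (\<lambda>w. \<Phi> (\<lambda>t. \<zeta> t w + \<mu>0 t))) {y} = measure N {w \<in> space N. \<Phi> (\<lambda>t. \<zeta> t w + \<mu>0 t) = y}" for y
  proof -
    have "(\<lambda>w. \<Phi> (\<lambda>t. \<zeta> t w + \<mu>0 t)) -` {y} \<inter> space N = {w \<in> space N. \<Phi> (\<lambda>t. \<zeta> t w + \<mu>0 t) = y}" by auto
    then show ?thesis by (simp add: measure_distr[OF Z_borel])
  qed
  have "AE y in lborel. y \<notin> {y. 0 < measure N {w \<in> space N. \<Phi> (\<lambda>t. \<zeta> t w + \<mu>0 t) = y}}"
    using Z.countable_atoms unfolding atom by (intro AE_not_in countable_imp_null_set_lborel)
  then show ?thesis
  proof eventually_elim
    case (elim y)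
    then have "measure N {w \<in> space N. \<Phi> (\<lambda>t. \<zeta> t w + \<mu>0 t) = y} = 0"
      by (simp add: zero_less_measure_iff measure_nonneg antisym not_less)
    then show ?case by (rule q_limit)
  qed
qed

lemma q0_borel: "q0 \<in> borel_measurable borel"
proof -
  interpret N: prob_space N by (rule N)
  note Z_borel[measurable]
  have "antimono q0"
    unfolding q0_def by (intro antimonoI N.finite_measure_mono) auto
  then have "mono (\<lambda>y. - q0 y)" by (auto simp: mono_def antimono_def)
  then have "(\<lambda>y. - (- q0 y)) \<in> borel_measurable borel" by (intro borel_measurable_uminus borel_measurable_mono)
  then show ?thesis by simp
qed

text \<open>On the good event \<open>E\<close> the field \<open>gY\<close> is bounded by
  \<open>a * (1 + b)\<close>, and once \<open>(g n)\<^sup>2\<close> is at least \<open>2 * B\<close>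
  the drift is bounded by \<open>B + y / 2\<close>. With \<open>a * (1 + b) = y / 2 - B\<close> the
  sum stays within \<open>y\<close>, so exceeding \<open>y\<close> forces the sample point out of
  \<open>E\<close>. The exceptional probability has exponent \<open>l * b\<close>, and
  \<open>l = 3 * a\<close> makes this \<open>3 * y / 2\<close> up to a constant.\<close>

lemma q_bound: "\<exists>C n0. \<forall>n\<ge>n0. \<forall>y>0. q n y \<le> C * exp (- 3 * y / 2)"
proof -
  obtain A :: "nat \<Rightarrow> real" where A: "A \<longlonglongrightarrow> 0" "\<forall>k. 0 \<le> A k"
    and H: "\<forall>n l b. 1 \<le> l \<longrightarrow> 0 \<le> b \<longrightarrow>
       (\<exists>E\<in>sets (M n). 1 - 4 * exp (l\<^sup>2 / 2) * exp (- l * b) \<le> measure (M n) E \<and>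
         (\<forall>w\<in>E. \<forall>k. \<forall>t\<in>D. \<forall>s\<in>D. dist t s \<le> \<rho> * (1/2) ^ k \<longrightarrow> \<bar>g n * Y n t w - g n * Y n s w\<bar> \<le> A k * (1 + b)))"
    using gY_modulus by (elim exE conjE)
  obtain B where B: "B > 0" "\<forall>n. \<forall>t\<in>D. \<bar>\<mu> n t\<bar> \<le> B" using \<mu>_bounded by blast
  \<comment> \<open>Adding 1 keeps the divisor in \<open>b\<close> away from 0 and makes
    \<open>l\<close> at least 1.\<close>
  define a where "a = A 0 + 1"
  have a: "a \<ge> 1" "A 0 \<le> a" using A(2) by (simp_all add: a_def)
  define l where "l = 3 * a"
  have l: "l \<ge> 1" using a by (simp add: l_def)
  have "filterlim (\<lambda>n. (g n)\<^sup>2) at_top sequentially" by (intro filterlim_pow_at_top g(2)) simp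
  then have "\<forall>\<^sub>F n in sequentially. 2 * B \<le> (g n)\<^sup>2" by (simp add: filterlim_at_top)
  then obtain n0 where n0: "\<And>n. n \<ge> n0 \<Longrightarrow> 2 * B \<le> (g n)\<^sup>2" by (auto simp: eventually_sequentially)
  have "q n y \<le> (4 * exp (l\<^sup>2 / 2)) * exp (3 * (B + a)) * exp (- 3 * y / 2)" if n: "n \<ge> n0" and y: "y > 0" for n y
  proof -
    interpret prob_space "M n" by (rule M)
    have one: "1 \<le> 4 * exp (l\<^sup>2 / 2)" by (rule order_trans[of _ "4 * 1"]) (simp, intro mult_left_mono, auto)
    show ?thesis
    proof (cases "2 * (B + a) \<le> y")
      case False
      \<comment> \<open>For these \<open>y\<close> the height \<open>b\<close> chosen below would be
        negative; the claimed bound is at least 1 there anyway.\<close>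
      have "q n y \<le> 1" by (simp add: q_def)
      also have "1 \<le> exp (3 * (B + a)) * exp (- 3 * y / 2)" using False by (simp add: exp_add[symmetric])
      also have "\<dots> \<le> (4 * exp (l\<^sup>2 / 2)) * (exp (3 * (B + a)) * exp (- 3 * y / 2))"
        using mult_right_mono[OF one, of "exp (3 * (B + a)) * exp (- 3 * y / 2)"] by simp
      finally show ?thesis by (simp add: mult.assoc)
    next
      case True
      define b where "b = (y / 2 - B - a) / a"
      have b: "b \<ge> 0" using True a by (simp add: b_def)
      have ab: "a * (1 + b) = y / 2 - B" using a by (simp add: b_def field_simps)
      from H[rule_format, OF l b, of n] obtain E where E: "E \<in> events" "1 - 4 * exp (l\<^sup>2 / 2) * exp (- l * b) \<le> prob E"
        "\<forall>w\<in>E. \<forall>k. \<forall>t\<in>D. \<forall>s\<in>D. dist t s \<le> \<rho> * (1/2) ^ k \<longrightarrow> \<bar>g n * Y n t w - g n * Y n s w\<bar> \<le> A k * (1 + b)"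
        by (elim bexE conjE)
      have "{w \<in> space (M n). y < \<Phi> (\<lambda>t. g n * Y n t w + m y n t)} \<subseteq> space (M n) - E"
      proof clarify
        fix w assume w: "w \<in> space (M n)" "y < \<Phi> (\<lambda>t. g n * Y n t w + m y n t)" "w \<in> E"
        have "\<bar>g n * Y n t w + m y n t\<bar> \<le> y" if t: "t \<in> D" for t
        proof -
          have "dist t 0 \<le> \<rho> * (1/2) ^ 0" using \<rho>(2)[OF t] by simp
          then have "\<bar>g n * Y n t w - g n * Y n 0 w\<bar> \<le> A 0 * (1 + b)" using E(3) w(3) t zero by blast
          then have "\<bar>g n * Y n t w\<bar> \<le> A 0 * (1 + b)" by (simp add: Y_zero)
          also have "\<dots> \<le> a * (1 + b)" using a b by (intro mult_right_mono) auto
          finally have 1: "\<bar>g n * Y n t w\<bar> \<le> y / 2 - B" unfolding ab .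
          have g2: "(g n)\<^sup>2 > 0" using g(1)[of n] by simp
          have "\<bar>m y n t\<bar> \<le> (1 + y / (g n)\<^sup>2) * B"
            unfolding m_def abs_mult
          proof (rule mult_mono)
            have "0 \<le> y / (g n)\<^sup>2" using y by simp
            then show "\<bar>1 - y / (g n)\<^sup>2\<bar> \<le> 1 + y / (g n)\<^sup>2" by linarith
            show "0 \<le> 1 + y / (g n)\<^sup>2" using \<open>0 \<le> y / (g n)\<^sup>2\<close> by linarith
          qed (use B t in auto)
          also have "\<dots> = B + y * (B / (g n)\<^sup>2)" by (simp add: distrib_right)
          also have "\<dots> \<le> B + y * (1 / 2)"
            using n0[OF n] g2 y by (intro add_left_mono mult_left_mono) (auto simp: field_simps)
          finally show ?thesis using 1 by linarith
        qed
        then have "\<bar>\<Phi> (\<lambda>t. g n * Y n t w + m y n t)\<bar> \<le> y"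
          by (rule \<Phi>_bound[OF cont_process_continuous[OF T_process w(1)]])
        with w(2) show False by linarith
      qed
      then have "q n y \<le> prob (space (M n) - E)" unfolding q_def using E(1) by (intro finite_measure_mono) auto
      also have "\<dots> \<le> 4 * exp (l\<^sup>2 / 2) * exp (- l * b)" using E(2) prob_compl[OF E(1)] by simp
      also have "- l * b = 3 * (B + a) + - 3 * y / 2" using a by (simp add: l_def b_def field_simps)
      finally show ?thesis by (simp only: exp_add mult.assoc)
    qed
  qed
  then show ?thesis by blast
qed

text \<open>The field is split as \<open>\<xi> = Z R + Y\<close> with \<open>Z = \<xi> 0\<close> independent of \<open>Y\<close>; independence enters
  only as the equality in law with the corresponding field on a product space.\<close>

lemma decomposition:
  shows "q n \<in> borel_measurable borel"
    and "measure (M n) {w \<in> space (M n). g n < \<Phi> (\<lambda>t. \<xi> n t w)} =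
      std_normal_density (g n) / g n * (\<integral>y. exp (y - y\<^sup>2 / (2 * (g n)\<^sup>2)) * q n y \<partial>lborel)"
proof -
  interpret M: prob_space "M n" by (rule M)
  interpret S: prob_space std_normal_distribution by (rule prob_space_normal_density) simp
  interpret pair_prob_space std_normal_distribution "M n" ..
  define P where "P = std_normal_distribution \<Otimes>\<^sub>M M n"
  define \<xi>' where "\<xi>' t p = fst p * R n t + Y n t (snd p)" for t and p :: "real \<times> 'w"
  have P: "prob_space P" unfolding P_def by (rule P.prob_space_axioms)
  have \<xi>': "cont_process P D \<xi>'"
    unfolding cont_process_def
  proof (intro conjI ballI)
    fix t assume "t \<in> D"
    then have [measurable]: "Y n t \<in> borel_measurable (M n)" by (rule cont_process_borel[OF Y_process])
    show "\<xi>' t \<in> borel_measurable P" unfolding \<xi>'_def[abs_def] P_def by measurable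
  next
    fix p assume "p \<in> space P"
    then have "snd p \<in> space (M n)" by (auto simp: P_def space_pair_measure)
    then show "continuous_on D (\<lambda>t. \<xi>' t p)" unfolding \<xi>'_def
      by (intro continuous_intros R_continuous cont_process_continuous[OF Y_process])
  qed
  have "trig_conv (\<lambda>_. M n) D (\<lambda>_. \<xi> n) P \<xi>'"
    unfolding trig_conv_def
  proof (intro allI impI)
    fix T b and c :: "real^'n \<Rightarrow> real" assume T: "finite T" "T \<subseteq> D"
    define \<alpha> where "\<alpha> = (\<Sum>s\<in>T. c s * R n s)"
    have eq: "b + (\<Sum>s\<in>T. c s * \<xi>' s (z, w)) = (b + \<alpha> * z) + (\<Sum>s\<in>T. c s * Y n s w)" for z w
      by (simp add: \<xi>'_def \<alpha>_def distrib_left sum.distrib sum_distrib_left mult_ac)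
    have i: "integrable P (\<lambda>p. cos (b + (\<Sum>s\<in>T. c s * \<xi>' s p)))"
    proof -
      have [measurable]: "(\<lambda>p. \<Sum>s\<in>T. c s * \<xi>' s p) \<in> borel_measurable P"
        by (intro borel_measurable_sum borel_measurable_times cont_process_borel[OF \<xi>'] subsetD[OF T(2)]) auto
      show ?thesis
        by (rule finite_measure.integrable_const_bound[OF prob_space.finite_measure[OF P], where B = 1]) auto
    qed
    have "(\<integral>p. cos (b + (\<Sum>s\<in>T. c s * \<xi>' s p)) \<partial>P) =
        (\<integral>z. (\<integral>w. cos (b + (\<Sum>s\<in>T. c s * \<xi>' s (z, w))) \<partial>M n) \<partial>std_normal_distribution)"
      using integral_fst'[OF i[unfolded P_def]] by (simp add: P_def)
    also have "\<dots> = (\<integral>z. cos (b + \<alpha> * z) * exp (- (\<integral>w. (\<Sum>s\<in>T. c s * Y n s w)\<^sup>2 \<partial>M n) / 2) \<partial>std_normal_distribution)"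
      unfolding eq M.centered_normal_cos[OF centered_gaussian_field_sum[OF Y_gauss T]] ..
    also have "\<dots> = cos b * exp (- \<alpha>\<^sup>2 / 2) * exp (- (\<integral>w. (\<Sum>s\<in>T. c s * Y n s w)\<^sup>2 \<partial>M n) / 2)"
      by (simp add: std_normal_linear_cos)
    \<comment> \<open>The variance \<open>\<alpha>\<^sup>2\<close> that the projection removes from
      the combination of \<open>\<xi>\<close> is exactly what the independent normal factor
      restores.\<close>
    also have "\<dots> = cos b * exp (- (\<integral>w. (\<Sum>s\<in>T. c s * \<xi> n s w)\<^sup>2 \<partial>M n) / 2)"
      unfolding Y_second_moment[OF T] \<alpha>_def mult.assoc exp_add[symmetric] by (simp add: field_simps)
    also have "\<dots> = (\<integral>w. cos (b + (\<Sum>s\<in>T. c s * \<xi> n s w)) \<partial>M n)"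
      by (rule M.centered_normal_cos[OF centered_gaussian_field_sum[OF gauss T], symmetric])
    finally show "(\<lambda>_. \<integral>w. cos (b + (\<Sum>s\<in>T. c s * \<xi> n s w)) \<partial>M n) \<longlonglongrightarrow>
        (\<integral>p. cos (b + (\<Sum>s\<in>T. c s * \<xi>' s p)) \<partial>P)" by simp
  qed
  from same_law_tail[OF D \<Phi> M \<xi> P \<xi>' this]
  have law: "measure (M n) {w \<in> space (M n). g n < \<Phi> (\<lambda>t. \<xi> n t w)} =
      measure P {p \<in> space P. g n < \<Phi> (\<lambda>t. \<xi>' t p)}" .
  have [measurable]: "(\<lambda>p. \<Phi> (\<lambda>t. \<xi>' t p)) \<in> borel_measurable P" by (rule cont_fun_measurable[OF D \<Phi> \<xi>'])
  define A where "A = {p \<in> space P. g n < \<Phi> (\<lambda>t. \<xi>' t p)}"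
  have A: "A \<in> sets P" unfolding A_def by measurable
  \<comment> \<open>The conditional exceedance probability, given that the normal factor equals
    \<open>z\<close>.\<close>
  define h :: "real \<Rightarrow> real" where "h z = (\<integral>w. indicator A (z, w) \<partial>M n)" for z
  have h: "h \<in> borel_measurable borel"
  proof -
    have "(\<lambda>p. indicator A p :: real) \<in> borel_measurable (std_normal_distribution \<Otimes>\<^sub>M M n)"
      using A unfolding P_def by measurable
    then have "(\<lambda>z. \<integral>w. (indicator A (z, w) :: real) \<partial>M n) \<in> borel_measurable std_normal_distribution"
      by (intro M.borel_measurable_lebesgue_integral) (simp add: case_prod_beta)
    then show ?thesis by (simp add: h_def[abs_def] measurable_def)
  qed
  have q_h: "q n y = h (g n - y / g n)" for y
  proof -
    have "{w \<in> space (M n). y < \<Phi> (\<lambda>t. g n * Y n t w + m y n t)} = {w \<in> space (M n). (g n - y / g n, w) \<in> A}"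
    proof (rule Collect_cong, rule conj_cong[OF refl])
      fix w assume w: "w \<in> space (M n)"
      \<comment> \<open>At \<open>z = g n - y / g n\<close> the field \<open>z * R + Y\<close> is an
        affine image of the field in \<open>q\<close>: the slope \<open>1 / g n\<close> and the
        shift \<open>z\<close> come out of \<open>\<Phi>\<close>, and exceeding \<open>g n\<close>
        becomes exceeding \<open>y\<close>.\<close>
      have "\<xi>' t (g n - y / g n, w) = (1 / g n) * (g n * Y n t w + m y n t) + (g n - y / g n)" for t
        using g(1)[of n] by (simp add: \<xi>'_def m_def \<mu>_def field_simps power2_eq_square)
      then have e: "\<Phi> (\<lambda>t. \<xi>' t (g n - y / g n, w)) = (1 / g n) * \<Phi> (\<lambda>t. g n * Y n t w + m y n t) + (g n - y / g n)"
        using \<Phi>_affine[OF cont_process_continuous[OF T_process w], of "1 / g n"] g(1)[of n] by simp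
      have "(g n - y / g n, w) \<in> space P" using w by (simp add: P_def space_pair_measure)
      moreover have "g n < (1 / g n) * x + (g n - y / g n) \<longleftrightarrow> y < x" for x
      proof -
        have "g n < (1 / g n) * x + (g n - y / g n) \<longleftrightarrow> y / g n < x / g n" by auto
        then show ?thesis using g(1)[of n] by (simp add: divide_less_cancel)
      qed
      ultimately show "y < \<Phi> (\<lambda>t. g n * Y n t w + m y n t) \<longleftrightarrow> (g n - y / g n, w) \<in> A"
        unfolding A_def mem_Collect_eq e by simp
    qed
    moreover have "h z = measure (M n) {w \<in> space (M n). (z, w) \<in> A}" for z
    proof -
      have "h z = (\<integral>w. indicator {w \<in> space (M n). (z, w) \<in> A} w \<partial>M n)"
        unfolding h_def by (rule Bochner_Integration.integral_cong) (simp_all add: indicator_def)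
      also have "\<dots> = measure (M n) ({w \<in> space (M n). (z, w) \<in> A} \<inter> space (M n))" by simp
      also have "{w \<in> space (M n). (z, w) \<in> A} \<inter> space (M n) = {w \<in> space (M n). (z, w) \<in> A}" by blast
      finally show ?thesis .
    qed
    ultimately show ?thesis by (simp add: q_def)
  qed
  show "q n \<in> borel_measurable borel"
    unfolding q_h[abs_def] by (rule measurable_compose[OF _ h]) measurable
  have "measure P A = (\<integral>p. indicator A p \<partial>P)" using A sets.sets_into_space[OF A] by (simp add: Int_absorb2)
  also have "\<dots> = (\<integral>z. h z \<partial>std_normal_distribution)"
  proof -
    have "integrable P (\<lambda>p. indicator A p :: real)"
      by (rule integrable_real_indicator[OF A])
        (simp add: finite_measure.emeasure_finite[OF prob_space.finite_measure[OF P]] less_top[symmetric])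
    then show ?thesis unfolding h_def P_def by (rule integral_fst'[symmetric])
  qed
  also have "\<dots> = (\<integral>z. std_normal_density z * h z \<partial>lborel)"
    by (subst integral_real_density) (use h in auto)
  also have "\<dots> = std_normal_density (g n) / g n * (\<integral>y. exp (y - y\<^sup>2 / (2 * (g n)\<^sup>2)) * q n y \<partial>lborel)"
    unfolding integral_std_normal_affine[OF g(1)[of n]] q_h ..
  finally show "measure (M n) {w \<in> space (M n). g n < \<Phi> (\<lambda>t. \<xi> n t w)} =
      std_normal_density (g n) / g n * (\<integral>y. exp (y - y\<^sup>2 / (2 * (g n)\<^sup>2)) * q n y \<partial>lborel)"
    unfolding law A_def .
qed

text \<open>The factor \<open>std_normal_density (g n) / g n\<close> is exact for the exceedance
  probability and asymptotic for \<open>Psi\<close>, so the quotient leaves the Laplace integral.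
  The layer-cake formula identifies its limit with \<open>H\<close> and shows that the integrand of
  \<open>H\<close> is integrable; being an exponential, it cannot integrate to 0.\<close>

lemma tail_asymptotics:
  defines "H \<equiv> \<integral>w. exp (\<Phi> (\<lambda>t. \<zeta> t w + \<mu>0 t)) \<partial>N"
  shows "H > 0"
    and "(\<lambda>n. measure (M n) {w \<in> space (M n). g n < \<Phi> (\<lambda>t. \<xi> n t w)} / Psi (g n)) \<longlonglongrightarrow> H"
proof -
  interpret N: prob_space N by (rule N)
  \<comment> \<open>The domination starts only at \<open>n0\<close>; the sequences are shifted by
    \<open>n0\<close>, and \<open>LIMSEQ_offset\<close> undoes the shift.\<close>
  obtain C n0 where C: "\<And>n y. n \<ge> n0 \<Longrightarrow> y > 0 \<Longrightarrow> q n y \<le> C * exp (- 3 * y / 2)" using q_bound by blast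
  have g': "filterlim (\<lambda>n. g (n + n0)) at_top sequentially"
    by (rule filterlim_compose[OF g(2) filterlim_subseq]) (simp add: strict_mono_def)
  have q01: "0 \<le> q n y" "q n y \<le> 1" for n y
    unfolding q_def using prob_space.prob_le_1[OF M] by auto
  have lim: "AE y in lborel. (\<lambda>n. q (n + n0) y) \<longlonglongrightarrow> q0 y"
    using q_limit_AE by eventually_elim (rule LIMSEQ_ignore_initial_segment)
  note L = laplace_dominated_convergence[OF g', of "\<lambda>n. q (n + n0)" q0 C, OF decomposition(1) q0_borel lim q01 C]
  have int: "integrable lborel (\<lambda>y. exp y * q0 y)" by (rule L(2)) simp_all
  have layer: "integrable N (\<lambda>w. exp (\<Phi> (\<lambda>t. \<zeta> t w + \<mu>0 t)))" "H = (\<integral>y. exp y * q0 y \<partial>lborel)"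
    using N.expectation_exp_layer_cake[OF Z_borel int[unfolded q0_def]] by (simp_all add: H_def q0_def)
  have "(\<lambda>n. \<integral>y. exp (y - y\<^sup>2 / (2 * (g (n + n0))\<^sup>2)) * q (n + n0) y \<partial>lborel) \<longlonglongrightarrow> H"
    unfolding layer(2) by (rule L(1)) simp_all
  then have "(\<lambda>n. \<integral>y. exp (y - y\<^sup>2 / (2 * (g n)\<^sup>2)) * q n y \<partial>lborel) \<longlonglongrightarrow> H"
    by (rule LIMSEQ_offset)
  from tendsto_divide[OF this Psi_asymptotics[OF g(2,1)]]
  have "(\<lambda>n. (\<integral>y. exp (y - y\<^sup>2 / (2 * (g n)\<^sup>2)) * q n y \<partial>lborel) / (Psi (g n) / (std_normal_density (g n) / g n))) \<longlonglongrightarrow> H"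
    by simp
  then show "(\<lambda>n. measure (M n) {w \<in> space (M n). g n < \<Phi> (\<lambda>t. \<xi> n t w)} / Psi (g n)) \<longlonglongrightarrow> H"
    unfolding decomposition(2) by (simp add: mult.commute)
  have "H \<noteq> 0"
  proof
    assume "H = 0"
    then have "AE w in N. exp (\<Phi> (\<lambda>t. \<zeta> t w + \<mu>0 t)) = 0"
      using integral_nonneg_eq_0_iff_AE[OF layer(1)] by (simp add: H_def)
    then show False using N.not_empty N.AE_False by simp
  qed
  moreover have "H \<ge> 0" unfolding H_def by (rule Bochner_Integration.integral_nonneg) simp
  ultimately show "H > 0" by simp
qed

end

section \<open>The tail asymptotics\<close>

lemma cond_F1_bound:
  fixes D :: "(real^'n) set"
  assumes "compact D" "D \<noteq> {}" "cond_F1 D F" "continuous_on D f" "\<And>t. t \<in> D \<Longrightarrow> \<bar>f t\<bar> \<le> b"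
  shows "\<bar>F (restrict f D)\<bar> \<le> b"
proof -
  have "\<bar>F (restrict f D)\<bar> \<le> (SUP t\<in>D. \<bar>restrict f D t\<bar>)"
    using assms(3) restrict_mem_CD[OF assms(1,4)] unfolding cond_F1_def by blast
  also have "\<dots> \<le> b" by (rule cSUP_least[OF assms(2)]) (simp add: assms(5))
  finally show ?thesis .
qed

lemma cond_F2_affine:
  fixes D :: "(real^'n) set"
  assumes "compact D" "cond_F2 D F" "continuous_on D f" "a > 0"
  shows "F (restrict (\<lambda>t. a * f t + b) D) = a * F (restrict f D) + b"
proof -
  have "F (\<lambda>t\<in>D. a * restrict f D t + b) = a * F (restrict f D) + b"
    using assms(2,4) restrict_mem_CD[OF assms(1,3)] unfolding cond_F2_def by blast
  moreover have "(\<lambda>t\<in>D. a * restrict f D t + b) = restrict (\<lambda>t. a * f t + b) D" by (rule restrict_ext) simp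
  ultimately show ?thesis by simp
qed

section \<open>Replacement of almost sure continuity by continuity of every path\<close>

lemma centered_normal_cong_AE:
  assumes f: "centered_normal M f" and f': "f' \<in> borel_measurable M" and eq: "AE w in M. f' w = f w"
  shows "centered_normal M f'"
proof -
  have fm: "f \<in> borel_measurable M" using f by (simp add: centered_normal_def)
  have "distr M lborel f' = distr M lborel f"
    by (rule distr_cong_AE) (use eq f' fm in auto)
  then have "distributed M lborel f' h \<longleftrightarrow> distributed M lborel f h" for h
    using f' fm by (simp add: distributed_def)
  moreover have "(AE w in M. f' w = 0) \<longleftrightarrow> (AE w in M. f w = 0)"
    by (rule eventually_subst) (use eq in eventually_elim, simp)
  ultimately show ?thesis using f f' by (simp add: centered_normal_def)
qed

text \<open>Paths are set to 0 on one measurable null set \<open>B\<close> containing the bad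
  points, which preserves measurability and Gaussian laws. \<open>Q\<close> carries a further
  property that holds for almost every path and for the zero path; it serves to make
  \<open>\<eta>\<close> vanish at 0 everywhere.\<close>

lemma continuous_modification:
  assumes M: "prob_space M" and X: "centered_gaussian_field M D X"
    and cont: "AE w in M. continuous_on D (\<lambda>t. X t w) \<and> Q (\<lambda>t. X t w)" and Q: "Q (\<lambda>_. 0)"
  shows "\<exists>X'. cont_process M D X' \<and> centered_gaussian_field M D X' \<and> (\<forall>w\<in>space M. Q (\<lambda>t. X' t w)) \<and>
    (AE w in M. \<forall>t. X' t w = X t w)"
proof -
  obtain B where B: "{w \<in> space M. \<not> (continuous_on D (\<lambda>t. X t w) \<and> Q (\<lambda>t. X t w))} \<subseteq> B" "B \<in> null_sets M"
    using cont unfolding eventually_ae_filter by blast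
  define X' where "X' t w = (if w \<in> B then 0 else X t w)" for t w
  have eq: "AE w in M. \<forall>t. X' t w = X t w"
    using AE_not_in[OF B(2)] by eventually_elim (simp add: X'_def)
  have good: "continuous_on D (\<lambda>t. X' t w) \<and> Q (\<lambda>t. X' t w)" if "w \<in> space M" for w
  proof (cases "w \<in> B")
    case True
    then show ?thesis using Q by (simp add: X'_def)
  next
    case False
    then have "continuous_on D (\<lambda>t. X t w) \<and> Q (\<lambda>t. X t w)" using B(1) that by blast
    then show ?thesis using False by (simp add: X'_def)
  qed
  have meas: "X' t \<in> borel_measurable M" if "t \<in> D" for t
  proof -
    have "X t \<in> borel_measurable M"
      by (rule prob_space.centered_normal_borel[OF M centered_gaussian_field_component[OF X that]])
    moreover have "B \<inter> space M \<in> sets M" using B(2) by (intro sets.Int) auto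
    ultimately show ?thesis unfolding X'_def[abs_def] by (intro measurable_If_set) auto
  qed
  have "centered_gaussian_field M D X'"
    unfolding centered_gaussian_field_def
  proof (intro allI impI)
    fix S c assume S: "finite S \<and> S \<subseteq> D"
    then have "centered_normal M (\<lambda>w. \<Sum>t\<in>S. c t * X t w)" using X by (simp add: centered_gaussian_field_def)
    moreover have "(\<lambda>w. \<Sum>t\<in>S. c t * X' t w) \<in> borel_measurable M"
      using S meas by (intro borel_measurable_sum borel_measurable_times) auto
    moreover have "AE w in M. (\<Sum>t\<in>S. c t * X' t w) = (\<Sum>t\<in>S. c t * X t w)"
      using eq by eventually_elim simp
    ultimately show "centered_normal M (\<lambda>w. \<Sum>t\<in>S. c t * X' t w)" by (rule centered_normal_cong_AE)
  qed
  then show ?thesis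
    using good meas eq by (intro exI[of _ X'] conjI) (simp_all add: cont_process_def)
qed

lemma borel_measurable_completion_cong_AE:
  fixes f :: "'w \<Rightarrow> real"
  assumes f: "f \<in> borel_measurable M" and eq: "AE w in M. f' w = f w"
  shows "f' \<in> borel_measurable (completion M)"
proof (rule measurableI)
  fix S :: "real set" assume S: "S \<in> sets borel"
  have A: "f -` S \<inter> space M \<in> sets (completion M)"
    using measurable_sets[OF f S] by (rule sets_completionI_sets)
  have AE: "AE w in completion M. w \<in> f -` S \<inter> space M \<longleftrightarrow> w \<in> f' -` S \<inter> space (completion M)"
    using AE_completion[OF eq] by eventually_elim simp
  show "f' -` S \<inter> space (completion M) \<in> sets (completion M)"
    by (rule completion.in_sets_AE[OF AE A Int_lower2])
qed simp

text \<open>The event for the original field agrees almost everywhere with a measurable event for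
  the modification, so the completed measure gives both the same value.\<close>

lemma prob_F_exceeds_modification:
  fixes D :: "(real^'n) set"
  assumes D: "compact D" and F: "cont_fun D (\<lambda>f. F (restrict f D))" and X': "cont_process M D X'"
    and eq: "AE w in M. \<forall>t. X' t w = X t w"
  shows "prob_F_exceeds M D F X x = measure M {w \<in> space M. x < F (restrict (\<lambda>t. X' t w) D)}"
proof -
  have [measurable]: "(\<lambda>w. F (restrict (\<lambda>t. X' t w) D)) \<in> borel_measurable M"
    by (rule cont_fun_measurable[OF D F X'])
  have A: "{w \<in> space M. x < F (restrict (\<lambda>t. X' t w) D)} \<in> sets M" by measurable
  have "AE w in M. w \<in> {w \<in> space M. x < F (restrict (\<lambda>t. X' t w) D)} \<longleftrightarrow> w \<in> {w \<in> space M. F (\<lambda>t\<in>D. X t w) > x}"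
    using eq by eventually_elim simp
  then have AE: "AE w in completion M. w \<in> {w \<in> space M. x < F (restrict (\<lambda>t. X' t w) D)} \<longleftrightarrow>
      w \<in> {w \<in> space M. F (\<lambda>t\<in>D. X t w) > x}" by (rule AE_completion)
  then have B: "{w \<in> space M. F (\<lambda>t\<in>D. X t w) > x} \<in> sets (completion M)"
    by (rule completion.in_sets_AE) (use A in auto)
  have "measure (completion M) {w \<in> space M. x < F (restrict (\<lambda>t. X' t w) D)} =
      measure (completion M) {w \<in> space M. F (\<lambda>t\<in>D. X t w) > x}"
    by (rule measure_eq_AE[OF AE]) (use A B in auto)
  then show ?thesis using A by (simp add: prob_F_exceeds_def)
qed

section \<open>Variances along a sequence\<close>

lemma cond_C1_uniform_limit:
  fixes D :: "(real^'n) set"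
  assumes "cond_C1 M D \<xi> d" "filterlim u at_top sequentially"
  shows "uniform_limit D (\<lambda>n t. (u n)\<^sup>2 * (1 - sqrt (var (M (u n)) (\<xi> (u n) t)))) d sequentially"
  unfolding uniform_limit_iff
proof (intro allI impI)
  fix e :: real assume "e > 0"
  have "((\<lambda>u. SUP t\<in>D. ereal \<bar>u\<^sup>2 * (1 - sqrt (var (M u) (\<xi> u t))) - d t\<bar>) \<longlongrightarrow> 0) at_top"
    using assms(1) by (simp add: cond_C1_def)
  from filterlim_compose[OF this assms(2)]
  have "\<forall>\<^sub>F n in sequentially. (SUP t\<in>D. ereal \<bar>(u n)\<^sup>2 * (1 - sqrt (var (M (u n)) (\<xi> (u n) t))) - d t\<bar>) < ereal e"
    using \<open>e > 0\<close> by (intro order_tendstoD) auto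
  then show "\<forall>\<^sub>F n in sequentially. \<forall>t\<in>D. dist ((u n)\<^sup>2 * (1 - sqrt (var (M (u n)) (\<xi> (u n) t)))) (d t) < e"
  proof eventually_elim
    case (elim n)
    show ?case
    proof
      fix t assume "t \<in> D"
      then have "ereal \<bar>(u n)\<^sup>2 * (1 - sqrt (var (M (u n)) (\<xi> (u n) t))) - d t\<bar> \<le>
          (SUP t\<in>D. ereal \<bar>(u n)\<^sup>2 * (1 - sqrt (var (M (u n)) (\<xi> (u n) t))) - d t\<bar>)"
        by (rule SUP_upper)
      also note elim
      finally show "dist ((u n)\<^sup>2 * (1 - sqrt (var (M (u n)) (\<xi> (u n) t)))) (d t) < e"
        by (simp add: dist_real_def)
    qed
  qed
qed

text \<open>The condition concerns standard deviations, the locale variances: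
  \<open>1 - v = (1 - sqrt v) * (2 - (1 - sqrt v))\<close>, and the second factor tends to 2
  uniformly because \<open>1 - sqrt v\<close> is of order \<open>1 / (u n)\<^sup>2\<close>. Passing
  from the scale \<open>u\<close> to the scale \<open>c\<close> contributes
  \<open>a\<^sup>2\<close>.\<close>

lemma uniform_limit_variance_scaled:
  fixes v :: "nat \<Rightarrow> 'a \<Rightarrow> real"
  assumes A: "uniform_limit D (\<lambda>n t. (u n)\<^sup>2 * (1 - sqrt (v n t))) d sequentially"
    and d: "bounded (d ` D)" and u: "filterlim u at_top sequentially" "\<And>n. u n > 0"
    and c: "(\<lambda>n. c n / u n) \<longlonglongrightarrow> a" and v: "\<And>n t. t \<in> D \<Longrightarrow> 0 \<le> v n t"
  shows "uniform_limit D (\<lambda>n t. (c n)\<^sup>2 * (1 - v n t)) (\<lambda>t. 2 * (a\<^sup>2 * d t)) sequentially"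
proof -
  have const: "uniform_limit D (\<lambda>n t. x n) (\<lambda>t. y) sequentially" if "x \<longlonglongrightarrow> y" for x and y :: real
    using that unfolding uniform_limit_iff tendsto_iff by simp
  have "filterlim (\<lambda>n. (u n)\<^sup>2) at_top sequentially" by (intro filterlim_pow_at_top u) simp
  then have "(\<lambda>n. 1 / (u n)\<^sup>2) \<longlonglongrightarrow> 0" by (intro real_tendsto_divide_at_top[OF tendsto_const])
  then have "uniform_limit D (\<lambda>n t. 2 - (1 / (u n)\<^sup>2) * ((u n)\<^sup>2 * (1 - sqrt (v n t)))) (\<lambda>t. 2 - 0 * d t) sequentially"
    using d by (intro uniform_limit_minus uniform_lim_mult A const tendsto_const) (auto simp: image_constant_conv)
  then have "uniform_limit D (\<lambda>n t. (c n / u n)\<^sup>2 * (((u n)\<^sup>2 * (1 - sqrt (v n t))) *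
      (2 - (1 / (u n)\<^sup>2) * ((u n)\<^sup>2 * (1 - sqrt (v n t)))))) (\<lambda>t. a\<^sup>2 * (d t * (2 - 0 * d t))) sequentially"
  proof (intro uniform_lim_mult A const tendsto_intros c)
    have "bounded ((\<lambda>x. x * 2) ` d ` D)" by (rule bounded_linear_image[OF d bounded_linear_mult_left])
    then show "bounded ((\<lambda>t. d t * (2 - 0 * d t)) ` D)" by (simp add: image_image)
  qed (use d in \<open>auto simp: image_constant_conv\<close>)
  moreover have "(c n / u n)\<^sup>2 * (((u n)\<^sup>2 * (1 - sqrt (v n t))) * (2 - (1 / (u n)\<^sup>2) * ((u n)\<^sup>2 * (1 - sqrt (v n t))))) =
      (c n)\<^sup>2 * (1 - v n t)" if "t \<in> D" for n t
  proof -
    have u0: "(u n)\<^sup>2 \<noteq> 0" using u(2)[of n] by simp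
    have "(1 - sqrt (v n t)) * (1 + sqrt (v n t)) = 1 - v n t" using v[OF that, of n] by (simp add: algebra_simps)
    moreover have "2 - (1 / (u n)\<^sup>2) * ((u n)\<^sup>2 * (1 - sqrt (v n t))) = 1 + sqrt (v n t)" using u0 by simp
    moreover have "(c n / u n)\<^sup>2 * (u n)\<^sup>2 = (c n)\<^sup>2" using u0 by (simp add: power_divide)
    ultimately show ?thesis by (metis mult.assoc)
  qed
  ultimately have "uniform_limit D (\<lambda>n t. (c n)\<^sup>2 * (1 - v n t)) (\<lambda>t. a\<^sup>2 * (d t * (2 - 0 * d t))) sequentially"
    by (rule uniform_limit_cong'[THEN iffD1, rotated 2]) simp_all
  then show ?thesis by (simp add: mult_ac)
qed

theorem lemma5p1:
  fixes D :: "(real^'n) set"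
    and M :: "real \<Rightarrow> 'w measure"
    and \<xi> :: "real \<Rightarrow> real^'n \<Rightarrow> 'w \<Rightarrow> real"
    and N :: "'v measure"
    and \<eta> :: "real^'n \<Rightarrow> 'v \<Rightarrow> real"
    and d :: "real^'n \<Rightarrow> real"
    and F :: "(real^'n \<Rightarrow> real) \<Rightarrow> real"
    and g :: "real \<Rightarrow> real"
    and a :: real
  assumes "compact D" and "0 \<in> D"
    and "\<And>u. u > 0 \<Longrightarrow> prob_space (M u)"
    and "\<And>u. u > 0 \<Longrightarrow> centered_gaussian_field (M u) D (\<xi> u)"
    and "\<And>u. u > 0 \<Longrightarrow> as_continuous_paths (M u) D (\<xi> u)"
    and "cond_C1 M D \<xi> d"
    and "cond_C2 M D \<xi> N \<eta>"
    and "cond_C3 M D \<xi>"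
    and "continuous_functional D F"
    and "cond_F1 D F"
    and "cond_F2 D F"
    and "g \<in> borel_measurable (restrict_space borel {0<..})"
    and "\<And>u. u > 0 \<Longrightarrow> g u > 0"
    and "a > 0"
    and "((\<lambda>u. g u / u) \<longlongrightarrow> a) at_top"
    and "\<forall>\<^sub>F u in at_top. prob_F_exceeds (M u) D F (\<xi> u) (g u) > 0"
  shows "((\<lambda>u. prob_F_exceeds (M u) D F (\<xi> u) (g u) /
               (H_const N D F (\<lambda>t w. a * \<eta> t w) (\<lambda>t. a\<^sup>2 * d t) * Psi (g u)))
          \<longlongrightarrow> 1) at_top"
proof (rule tendsto_at_topI_sequentially)
  note D = \<open>compact D\<close> and zero = \<open>0 \<in> D\<close> and a = \<open>a > 0\<close>
  note F = continuous_functional_cont_fun[OF D \<open>continuous_functional D F\<close>]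
  have N: "prob_space N" and gN: "centered_gaussian_field N UNIV \<eta>" and cN: "as_continuous_paths N UNIV \<eta>"
    and \<eta>0: "AE w in N. \<eta> 0 w = 0"
    and C2: "\<And>t s. t \<in> D \<Longrightarrow> s \<in> D \<Longrightarrow> ((\<lambda>u. u\<^sup>2 * var (M u) (\<lambda>w. \<xi> u t w - \<xi> u s w))
           \<longlongrightarrow> 2 * var N (\<lambda>w. \<eta> t w - \<eta> s w)) at_top"
    using \<open>cond_C2 M D \<xi> N \<eta>\<close> by (auto simp: cond_C2_def)
  obtain G \<nu> u0 where G: "G > 0" and \<nu>: "\<nu> > 0" and C3: "\<And>u t s. u > u0 \<Longrightarrow> t \<in> D \<Longrightarrow> s \<in> D \<Longrightarrow>
        u\<^sup>2 * var (M u) (\<lambda>w. \<xi> u t w - \<xi> u s w) \<le> G * norm (t - s) powr \<nu>"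
    using \<open>cond_C3 M D \<xi>\<close> unfolding cond_C3_def by blast
  interpret N: prob_space N by (rule N)
  have gD: "centered_gaussian_field N D \<eta>" using gN by (simp add: centered_gaussian_field_def)
  have "AE w in N. continuous_on D (\<lambda>t. \<eta> t w) \<and> \<eta> 0 w = 0"
    using cN[unfolded as_continuous_paths_def] \<eta>0 by eventually_elim (auto intro: continuous_on_subset)
  from continuous_modification[where Q = "\<lambda>f. f 0 = 0", OF N gD this] obtain \<eta>' where
    \<eta>': "cont_process N D \<eta>'" "centered_gaussian_field N D \<eta>'" "\<forall>w\<in>space N. \<eta>' 0 w = 0"
      and \<eta>'_eq: "AE w in N. \<forall>t. \<eta>' t w = \<eta> t w" by auto
  define \<zeta> where "\<zeta> t w = sqrt 2 * a * \<eta>' t w" for t w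
  have \<eta>'_borel: "t \<in> D \<Longrightarrow> \<eta>' t \<in> borel_measurable N" for t using \<eta>'(1) by (rule cont_process_borel)
  have \<eta>_borel: "t \<in> D \<Longrightarrow> \<eta> t \<in> borel_measurable N" for t
    by (rule N.centered_normal_borel[OF centered_gaussian_field_component[OF gD]])
  have \<zeta>_incr: "(\<integral>w. (\<zeta> t w - \<zeta> s w)\<^sup>2 \<partial>N) = a\<^sup>2 * (2 * var N (\<lambda>w. \<eta> t w - \<eta> s w))" if ts: "t \<in> D" "s \<in> D" for t s
  proof -
    have "(\<integral>w. (\<zeta> t w - \<zeta> s w)\<^sup>2 \<partial>N) = (\<integral>w. 2 * a\<^sup>2 * (\<eta> t w - \<eta> s w)\<^sup>2 \<partial>N)"
    proof (rule integral_cong_AE)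
      show "AE w in N. (\<zeta> t w - \<zeta> s w)\<^sup>2 = 2 * a\<^sup>2 * (\<eta> t w - \<eta> s w)\<^sup>2"
        using \<eta>'_eq by eventually_elim (simp add: \<zeta>_def power_mult_distrib flip: right_diff_distrib)
    qed (use \<eta>'_borel \<eta>_borel ts in \<open>auto simp: \<zeta>_def\<close>)
    then show ?thesis by (simp add: N.centered_normal_var[OF centered_gaussian_field_diff[OF gD ts]])
  qed
  have \<zeta>_var: "(\<integral>w. (\<zeta> t w)\<^sup>2 \<partial>N) / 2 = var N (\<lambda>w. a * \<eta> t w)" if t: "t \<in> D" for t
  proof -
    have "(\<integral>w. (\<zeta> t w)\<^sup>2 \<partial>N) = (\<integral>w. 2 * (a * \<eta> t w)\<^sup>2 \<partial>N)"
    proof (rule integral_cong_AE)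
      show "AE w in N. (\<zeta> t w)\<^sup>2 = 2 * (a * \<eta> t w)\<^sup>2"
        using \<eta>'_eq by eventually_elim (simp add: \<zeta>_def power_mult_distrib)
    qed (use \<eta>'_borel \<eta>_borel t in \<open>auto simp: \<zeta>_def\<close>)
    moreover have "centered_normal N (\<lambda>w. a * \<eta> t w)"
      using centered_gaussian_field_sum[OF gD, of "{t}" "\<lambda>_. a"] t by simp
    ultimately show ?thesis by (simp add: N.centered_normal_var)
  qed
  \<comment> \<open>From here on the limit at infinity is tested on an arbitrary sequence, to suit
    the sequential limit theorems.\<close>
  fix X :: "nat \<Rightarrow> real" assume X: "filterlim X at_top sequentially"
  \<comment> \<open>The bound \<open>a + 1\<close> on \<open>g u / u\<close> is where the increment
    constant \<open>(a + 1)\<^sup>2 * G\<close> comes from.\<close>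
  have "\<forall>\<^sub>F u in at_top. u > 0 \<and> u > u0 \<and> sqrt (var (M u) (\<xi> u 0)) = 1 \<and> g u / u < a + 1"
    using \<open>cond_C1 M D \<xi> d\<close> order_tendstoD(2)[OF \<open>((\<lambda>u. g u / u) \<longlongrightarrow> a) at_top\<close>, of "a + 1"]
    by (intro eventually_conj eventually_gt_at_top) (simp_all add: cond_C1_def)
  from eventually_compose_filterlim[OF this X] obtain m where
    m: "\<And>n. n \<ge> m \<Longrightarrow> X n > 0 \<and> X n > u0 \<and> sqrt (var (M (X n)) (\<xi> (X n) 0)) = 1 \<and> g (X n) / X n < a + 1"
    by (auto simp: eventually_sequentially)
  \<comment> \<open>Discarding the first \<open>m\<close> terms makes the eventual properties hold
    for every index, as the locale demands; \<open>LIMSEQ_offset\<close> restores the full sequence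
    at the end.\<close>
  define u where "u n = X (n + m)" for n
  have u: "u n > 0" "u n > u0" "sqrt (var (M (u n)) (\<xi> (u n) 0)) = 1" "g (u n) / u n < a + 1" for n
    using m[of "n + m"] by (auto simp: u_def)
  have u_lim: "filterlim u at_top sequentially"
    unfolding u_def by (rule filterlim_compose[OF X filterlim_subseq]) (simp add: strict_mono_def)
  have gu: "(\<lambda>n. g (u n) / u n) \<longlonglongrightarrow> a" by (rule filterlim_compose[OF \<open>((\<lambda>u. g u / u) \<longlongrightarrow> a) at_top\<close> u_lim])
  have g_pos: "g (u n) > 0" for n using assms(13) u(1) by blast
  have g_lim: "filterlim (\<lambda>n. g (u n)) at_top sequentially"
  proof -
    have "filterlim (\<lambda>n. g (u n) / u n * u n) at_top sequentially"
      by (rule filterlim_tendsto_pos_mult_at_top[OF gu a u_lim])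
    moreover have "g (u n) / u n * u n = g (u n)" for n using u(1)[of n] by simp
    ultimately show ?thesis by simp
  qed
  \<comment> \<open>Trades the scale \<open>g\<close> for the scale \<open>u\<close> of the
    conditions; the squared ratio tends to \<open>a\<^sup>2\<close>.\<close>
  have g_sq: "(g (u n))\<^sup>2 * x = (g (u n) / u n)\<^sup>2 * ((u n)\<^sup>2 * x)" for n x
    using u(1)[of n] by (simp add: power_divide)
  note P = assms(3)[OF u(1)] and gauss = assms(4)[OF u(1)]
  have "\<forall>n. \<exists>X'. cont_process (M (u n)) D X' \<and> centered_gaussian_field (M (u n)) D X' \<and>
      (AE w in M (u n). \<forall>t. X' t w = \<xi> (u n) t w)"
  proof
    fix n
    have "AE w in M (u n). continuous_on D (\<lambda>t. \<xi> (u n) t w) \<and> True"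
      using assms(5)[OF u(1)[of n]] by (simp add: as_continuous_paths_def)
    from continuous_modification[OF P gauss this]
    show "\<exists>X'. cont_process (M (u n)) D X' \<and> centered_gaussian_field (M (u n)) D X' \<and>
      (AE w in M (u n). \<forall>t. X' t w = \<xi> (u n) t w)" by auto
  qed
  then obtain \<xi>' where \<xi>': "\<And>n. cont_process (M (u n)) D (\<xi>' n)" "\<And>n. centered_gaussian_field (M (u n)) D (\<xi>' n)"
    and \<xi>'_eq: "\<And>n. AE w in M (u n). \<forall>t. \<xi>' n t w = \<xi> (u n) t w"
    unfolding choice_iff by auto
  have \<xi>_borel: "t \<in> D \<Longrightarrow> \<xi> (u n) t \<in> borel_measurable (M (u n))" for n t
    by (rule prob_space.centered_normal_borel[OF P centered_gaussian_field_component[OF gauss]])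
  have \<xi>'_var: "(\<integral>w. (\<xi>' n t w)\<^sup>2 \<partial>M (u n)) = var (M (u n)) (\<xi> (u n) t)" if t: "t \<in> D" for n t
  proof -
    have "(\<integral>w. (\<xi>' n t w)\<^sup>2 \<partial>M (u n)) = (\<integral>w. (\<xi> (u n) t w)\<^sup>2 \<partial>M (u n))"
    proof (rule integral_cong_AE)
      show "AE w in M (u n). (\<xi>' n t w)\<^sup>2 = (\<xi> (u n) t w)\<^sup>2" using \<xi>'_eq[of n] by eventually_elim simp
    qed (use cont_process_borel[OF \<xi>'(1) t] \<xi>_borel[OF t] in auto)
    then show ?thesis by (simp add: prob_space.centered_normal_var[OF P centered_gaussian_field_component[OF gauss t]])
  qed
  have \<xi>'_incr: "(\<integral>w. (\<xi>' n t w - \<xi>' n s w)\<^sup>2 \<partial>M (u n)) = var (M (u n)) (\<lambda>w. \<xi> (u n) t w - \<xi> (u n) s w)"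
    if ts: "t \<in> D" "s \<in> D" for n t s
  proof -
    have "(\<integral>w. (\<xi>' n t w - \<xi>' n s w)\<^sup>2 \<partial>M (u n)) = (\<integral>w. (\<xi> (u n) t w - \<xi> (u n) s w)\<^sup>2 \<partial>M (u n))"
    proof (rule integral_cong_AE)
      show "AE w in M (u n). (\<xi>' n t w - \<xi>' n s w)\<^sup>2 = (\<xi> (u n) t w - \<xi> (u n) s w)\<^sup>2"
        using \<xi>'_eq[of n] by eventually_elim simp
    qed (use cont_process_borel[OF \<xi>'(1)] \<xi>_borel ts in auto)
    then show ?thesis by (simp add: prob_space.centered_normal_var[OF P centered_gaussian_field_diff[OF gauss ts]])
  qed
  interpret gaussian_family D "\<lambda>f. F (restrict f D)" "\<lambda>n. M (u n)" \<xi>' N \<zeta> "\<lambda>n. g (u n)" "\<lambda>t. a\<^sup>2 * d t" "(a + 1)\<^sup>2 * G" \<nu>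
  proof (rule gaussian_family.intro)
    show "cont_process N D \<zeta>" using \<eta>'(1) unfolding cont_process_def \<zeta>_def[abs_def]
      by (auto intro!: continuous_intros)
    show "centered_gaussian_field N D \<zeta>"
      using centered_gaussian_field_affine[OF \<eta>'(2) zero, of "\<lambda>_. sqrt 2 * a" "\<lambda>_. 0"] by (simp add: \<zeta>_def[abs_def])
    show "\<zeta> 0 w = 0" if "w \<in> space N" for w using \<eta>'(3) that by (simp add: \<zeta>_def)
    show "(\<integral>w. (\<xi>' n 0 w)\<^sup>2 \<partial>M (u n)) = 1" for n using u(3)[of n] by (simp add: \<xi>'_var[OF zero])
    have v: "0 \<le> var (M (u n)) (\<xi> (u n) t)" for n t
      unfolding var_def by (rule Bochner_Integration.integral_nonneg) simp
    have "uniform_limit D (\<lambda>n t. (g (u n))\<^sup>2 * (1 - var (M (u n)) (\<xi> (u n) t))) (\<lambda>t. 2 * (a\<^sup>2 * d t)) sequentially"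
      by (rule uniform_limit_variance_scaled[OF cond_C1_uniform_limit[OF \<open>cond_C1 M D \<xi> d\<close> u_lim] _ u_lim u(1) gu v])
        (use \<open>cond_C1 M D \<xi> d\<close> in \<open>simp add: cond_C1_def\<close>)
    then show "uniform_limit D (\<lambda>n t. (g (u n))\<^sup>2 * (1 - (\<integral>w. (\<xi>' n t w)\<^sup>2 \<partial>M (u n)))) (\<lambda>t. 2 * (a\<^sup>2 * d t)) sequentially"
      by (rule uniform_limit_cong'[THEN iffD1, rotated 2]) (simp_all add: \<xi>'_var)
    show "(\<lambda>n. (g (u n))\<^sup>2 * (\<integral>w. (\<xi>' n t w - \<xi>' n s w)\<^sup>2 \<partial>M (u n))) \<longlonglongrightarrow> (\<integral>w. (\<zeta> t w - \<zeta> s w)\<^sup>2 \<partial>N)"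
      if ts: "t \<in> D" "s \<in> D" for t s
      unfolding \<xi>'_incr[OF ts] \<zeta>_incr[OF ts] g_sq
      by (intro tendsto_mult tendsto_power gu filterlim_compose[OF C2[OF ts] u_lim])
    show "(g (u n))\<^sup>2 * (\<integral>w. (\<xi>' n t w - \<xi>' n s w)\<^sup>2 \<partial>M (u n)) \<le> (a + 1)\<^sup>2 * G * norm (t - s) powr \<nu>"
      if ts: "t \<in> D" "s \<in> D" for n t s
      unfolding \<xi>'_incr[OF ts] g_sq mult.assoc[of "(a + 1)\<^sup>2"]
    proof (rule mult_mono)
      show "(g (u n) / u n)\<^sup>2 \<le> (a + 1)\<^sup>2"
        using u(4)[of n] g_pos[of n] u(1)[of n] by (intro power_mono) auto
      have "0 \<le> var (M (u n)) (\<lambda>w. \<xi> (u n) t w - \<xi> (u n) s w)"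
        unfolding var_def by (rule Bochner_Integration.integral_nonneg) simp
      then show "0 \<le> (u n)\<^sup>2 * var (M (u n)) (\<lambda>w. \<xi> (u n) t w - \<xi> (u n) s w)" by simp
    qed (use C3[OF u(2) ts] in auto)
    show "\<bar>F (restrict f D)\<bar> \<le> b" if "continuous_on D f" "\<And>t. t \<in> D \<Longrightarrow> \<bar>f t\<bar> \<le> b" for f b
      using cond_F1_bound[OF D _ \<open>cond_F1 D F\<close> that] zero by blast
    show "F (restrict (\<lambda>t. c * f t + b) D) = c * F (restrict f D) + b" if "continuous_on D f" "c > 0" for f c b
      by (rule cond_F2_affine[OF D \<open>cond_F2 D F\<close> that])
    have "(a + 1)\<^sup>2 > 0" using a by simp
    then show "(a + 1)\<^sup>2 * G > 0" using G by (rule mult_pos_pos)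
  qed (rule D zero P \<xi>' N F \<nu> g_pos g_lim)+
  define H where "H = (\<integral>w. exp (F (restrict (\<lambda>t. \<zeta> t w + \<mu>0 t) D)) \<partial>N)"
  \<comment> \<open>The constant is an integral of the original \<open>\<eta>\<close> for the
    completed measure. Its integrand agrees almost everywhere with a measurable function of the
    modification, so the integral can be evaluated under \<open>N\<close>.\<close>
  have H: "H_const N D F (\<lambda>t w. a * \<eta> t w) (\<lambda>t. a\<^sup>2 * d t) = H"
  proof -
    have m: "(\<lambda>w. exp (F (restrict (\<lambda>t. \<zeta> t w + \<mu>0 t) D))) \<in> borel_measurable N"
      using Z_borel by measurable
    have eq: "AE w in N. exp (F (\<lambda>t\<in>D. sqrt 2 * (a * \<eta> t w) - var N (\<lambda>w. a * \<eta> t w) - a\<^sup>2 * d t)) =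
        exp (F (restrict (\<lambda>t. \<zeta> t w + \<mu>0 t) D))"
      using \<eta>'_eq
    proof eventually_elim
      case (elim w)
      have "(\<lambda>t\<in>D. sqrt 2 * (a * \<eta> t w) - var N (\<lambda>w. a * \<eta> t w) - a\<^sup>2 * d t) = restrict (\<lambda>t. \<zeta> t w + \<mu>0 t) D"
        by (rule restrict_ext) (use elim in \<open>simp add: \<mu>0_def \<zeta>_var\<close>, simp add: \<zeta>_def)
      then show ?case by simp
    qed
    have "H_const N D F (\<lambda>t w. a * \<eta> t w) (\<lambda>t. a\<^sup>2 * d t) =
        (\<integral>w. exp (F (restrict (\<lambda>t. \<zeta> t w + \<mu>0 t) D)) \<partial>completion N)"
      unfolding H_const_def
      by (rule integral_cong_AE[OF borel_measurable_completion_cong_AE[OF m eq] measurable_completion[OF m] AE_completion[OF eq]])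
    also have "\<dots> = H" unfolding H_def by (rule integral_completion[OF m])
    finally show ?thesis .
  qed
  have H_pos: "H > 0" unfolding H_def by (rule tail_asymptotics(1))
  have "(\<lambda>n. prob_F_exceeds (M (u n)) D F (\<xi> (u n)) (g (u n)) / Psi (g (u n))) \<longlonglongrightarrow> H"
    unfolding H_def prob_F_exceeds_modification[OF D F \<xi>'(1) \<xi>'_eq] by (rule tail_asymptotics(2))
  then have "(\<lambda>n. prob_F_exceeds (M (u n)) D F (\<xi> (u n)) (g (u n)) / Psi (g (u n)) / H) \<longlonglongrightarrow> H / H"
    by (intro tendsto_divide tendsto_const) (use H_pos in simp_all)
  then have "(\<lambda>n. prob_F_exceeds (M (X (n + m))) D F (\<xi> (X (n + m))) (g (X (n + m))) /
      (H_const N D F (\<lambda>t w. a * \<eta> t w) (\<lambda>t. a\<^sup>2 * d t) * Psi (g (X (n + m))))) \<longlonglongrightarrow> 1"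
    using H_pos unfolding H u_def by (simp add: mult.commute)
  then show "(\<lambda>n. prob_F_exceeds (M (X n)) D F (\<xi> (X n)) (g (X n)) /
      (H_const N D F (\<lambda>t w. a * \<eta> t w) (\<lambda>t. a\<^sup>2 * d t) * Psi (g (X n)))) \<longlonglongrightarrow> 1"
    by (rule LIMSEQ_offset)
qed

end
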